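(* Let $k_0=1$ and $k_j=2^{j-1}$ for $j\ge1$. For $n\ge0$ let $\mathcal{A}_n=M_{k_0}\oplus M_{k_1}\oplus\cdots\oplus M_{k_n}$, let $\varphi_n\colon\mathcal{A}_n\to\mathcal{A}_{n+1}$ be the unital $^*$-homomorphism $$\varphi_n(a_0,\dots,a_n)=\bigl(a_0,\dots,a_n,\mathrm{diag}(a_0,a_1,\dots,a_n)\bigr),$$ and let $\mathcal{A}=\varinjlim(\mathcal{A}_n,\varphi_n)$. For $0\le j<\infty$ let $\tau_j$ be the tracial state on $\mathcal{A}$ obtained by composing the canonical surjection $\pi_j\colon\mathcal{A}\to M_{k_j}$ with the normalized trace on $M_{k_j}$. Then the trace simplex $T(\mathcal{A})$ is affinely homeomorphic to the Bauer simplex $\Delta_\infty$. More precisely, there is a tracial state $\tau_\infty$ on $\mathcal{A}$ such that the set of extreme points of $T(\mathcal{A})$ equals $\{\tau_j:0\le j\le\infty\}$, and $\tau_j\to\tau_\infty$ as $j\to\infty$. The trace $\tau_j$ is of type I$_{k_j}$ for each $0\le j<\infty$, and $\tau_\infty$ is of type II$_1$; in particular $\mathcal{A}$ has precisely one extremal trace of type II$_1$. Moreover, $\tau_\infty$ is determined by the property that, for every $n\ge1$, its restriction to $\mathcal{A}_n$ is $$2^{-n}\bigl(\tau_0^{(n)}+\tau_1^{(n)}+2\tau_2^{(n)}+4\tau_3^{(n)}+\cdots+2^{n-1}\tau_n^{(n)}\bigr),$$ where $\tau_j^{(n)}$ is the tracial state on $\mathcal{A}_n$ given by the normalized trace on the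 $j$th summand $M_{k_j}$.
   Context: $T(\mathcal{A})$ is the set of tracial states on $\mathcal{A}$ with the weak$^*$ topology. $\Delta_\infty$ denotes the Bauer simplex whose extreme boundary is homeomorphic to the one-point compactification $\mathbb{N}_0\cup\{\infty\}$ of the discrete space $\mathbb{N}_0$ (i.e., the simplex of Borel probability measures on this space). With $\varphi_{\infty,n}\colon\mathcal{A}_n\to\mathcal{A}$ the canonical map, $\pi_j\colon\mathcal{A}\to M_{k_j}$ is the surjective $^*$-homomorphism determined by $\pi_j\circ\varphi_{\infty,n}=\pi_j^{(n)}$ for all $n\ge j$, where $\pi_j^{(n)}\colon\mathcal{A}_n\to M_{k_j}$ is the projection onto the $j$th summand. An extremal trace $\tau$ (an extreme point of the trace simplex) is of type I$_n$, respectively II$_1$, if the factor $\pi_\tau(\mathcal{A})''$ generated by its GNS representation is of type I$_n$, respectively II$_1$. The restriction of a trace $\tau$ to $\mathcal{A}_n$ means $\tau\circ\varphi_{\infty,n}$. *)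

theory Defs
  imports
    "HOL-Probability.Probability"
    "HOL-Library.Function_Algebras"
    "Jordan_Normal_Form.Schur_Decomposition"
begin

section \<open>Unital C*-algebras\<close>

class unital_cstar_algebra = real_normed_algebra_1 + banach +
  fixes scaleC :: "complex \<Rightarrow> 'a \<Rightarrow> 'a" (infixr \<open>*\<^sub>C\<close> 75)
    and adj :: "'a \<Rightarrow> 'a"
  assumes scaleC_of_real: "complex_of_real r *\<^sub>C x = r *\<^sub>R x"
    and scaleC_add_right: "c *\<^sub>C (x + y) = c *\<^sub>C x + c *\<^sub>C y"
    and scaleC_add_left: "(c + d) *\<^sub>C x = c *\<^sub>C x + d *\<^sub>C x"
    and scaleC_scaleC: "c *\<^sub>C d *\<^sub>C x = (c * d) *\<^sub>C x"
    and mult_scaleC_left: "(c *\<^sub>C x) * y = c *\<^sub>C (x * y)"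
    and mult_scaleC_right: "x * (c *\<^sub>C y) = c *\<^sub>C (x * y)"
    and norm_scaleC: "norm (c *\<^sub>C x) = cmod c * norm x"
    and adj_adj: "adj (adj x) = x"
    and adj_add: "adj (x + y) = adj x + adj y"
    and adj_scaleC: "adj (c *\<^sub>C x) = cnj c *\<^sub>C adj x"
    and adj_mult: "adj (x * y) = adj y * adj x"
    and cstar_identity: "norm (adj x * x) = (norm x)\<^sup>2"


section \<open>The trace space\<close>

text \<open>Pointwise real vector space structure on functionals, so that the library's
  \<^const>\<open>extreme_point_of\<close> applies to sets of functionals.\<close>

instantiation "fun" :: (type, real_vector) real_vector
begin

definition "r *\<^sub>R f = (\<lambda>x. r *\<^sub>R f x)" for f :: "'a \<Rightarrow> 'b"

instance
  by standard (simp_all add: scaleR_fun_def fun_eq_iff scaleR_add_right scaleR_add_left)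

end

definition is_state :: "('a::unital_cstar_algebra \<Rightarrow> complex) \<Rightarrow> bool" where
  "is_state \<tau> \<longleftrightarrow> bounded_linear \<tau> \<and> (\<forall>c x. \<tau> (c *\<^sub>C x) = c * \<tau> x) \<and>
     (\<forall>x. \<tau> (adj x * x) \<in> \<real>\<^sub>\<ge>\<^sub>0) \<and> \<tau> 1 = 1"

definition tracial_states :: "('a::unital_cstar_algebra \<Rightarrow> complex) set" where
  "tracial_states = {\<tau>. is_state \<tau> \<and> (\<forall>x y. \<tau> (x * y) = \<tau> (y * x))}"

text \<open>The library topology on a function type is the product topology, so the subspace
  topology below is the topology of pointwise convergence, i.e. the weak* topology.\<close>

definition trace_space :: "('a::unital_cstar_algebra \<Rightarrow> complex) topology" where
  "trace_space = top_of_set tracial_states"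


section \<open>Simplices of Borel probability measures\<close>

definition borel_prob_measures :: "'x topology \<Rightarrow> 'x measure set" where
  "borel_prob_measures X =
     {M. prob_space M \<and> sets M = sigma_sets (topspace X) {U. openin X U}}"

text \<open>The coarsest topology making integration against every continuous function continuous;
  meant for compact Hausdorff \<open>X\<close>, where continuous functions are bounded.\<close>

definition prob_simplex :: "'x topology \<Rightarrow> 'x measure topology" where
  "prob_simplex X =
     (let C = {f. continuous_map X euclideanreal f} in
      pullback_topology (borel_prob_measures X)
        (\<lambda>M. \<lambda>f\<in>C. integral\<^sup>L M f) (product_topology (\<lambda>_. euclideanreal) C))"

definition \<Delta>_space :: "nat option topology" where
  "\<Delta>_space = Alexandroff_compactification (discrete_topology UNIV)"

text \<open>Measures carry no vector space structure in the library, hence affinity on the measure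
  side is expressed setwise.\<close>

definition affine_into_measures :: "('v::real_vector) set \<Rightarrow> ('v \<Rightarrow> 'x measure) \<Rightarrow> bool" where
  "affine_into_measures S \<Psi> \<longleftrightarrow>
     (\<forall>\<sigma>\<in>S. \<forall>\<tau>\<in>S. \<forall>t\<in>{0..1}. \<forall>B.
        measure (\<Psi> ((1 - t) *\<^sub>R \<sigma> + t *\<^sub>R \<tau>)) B =
          (1 - t) * measure (\<Psi> \<sigma>) B + t * measure (\<Psi> \<tau>) B)"


section \<open>Finite direct sums of matrix algebras\<close>

definition mat_trace :: "complex mat \<Rightarrow> complex" where
  "mat_trace a = (\<Sum>i<dim_row a. a $$ (i, i))"

definition vec_l2norm :: "complex vec \<Rightarrow> real" where
  "vec_l2norm v = sqrt (Re (v \<bullet>c v))"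

definition mat_opnorm :: "complex mat \<Rightarrow> real" where
  "mat_opnorm a =
     Sup {vec_l2norm (a *\<^sub>v v) | v. v \<in> carrier_vec (dim_col a) \<and> vec_l2norm v \<le> 1}"

text \<open>An element \<open>(a\<^sub>0, \<dots>, a\<^sub>n)\<close> of \<open>M\<^bsub>d\<^sub>0\<^esub> \<oplus> \<dots> \<oplus> M\<^bsub>d\<^sub>n\<^esub>\<close> is the list of its components.\<close>

definition mat_sum :: "nat list \<Rightarrow> complex mat list set" where
  "mat_sum ds = {as. list_all2 (\<lambda>a d. a \<in> carrier_mat d d) as ds}"

definition ms_norm :: "complex mat list \<Rightarrow> real" where
  "ms_norm as = Max (set (map mat_opnorm as))"

definition unital_star_hom_on ::
  "complex mat list set \<Rightarrow> (complex mat list \<Rightarrow> 'a::unital_cstar_algebra) \<Rightarrow> bool" where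
  "unital_star_hom_on D \<phi> \<longleftrightarrow>
     (\<forall>as\<in>D. \<forall>bs\<in>D. \<phi> (map2 (+) as bs) = \<phi> as + \<phi> bs) \<and>
     (\<forall>as\<in>D. \<forall>c. \<phi> (map (\<lambda>a. c \<cdot>\<^sub>m a) as) = c *\<^sub>C \<phi> as) \<and>
     (\<forall>as\<in>D. \<forall>bs\<in>D. \<phi> (map2 (*) as bs) = \<phi> as * \<phi> bs) \<and>
     (\<forall>as\<in>D. \<phi> (map mat_adjoint as) = adj (\<phi> as)) \<and>
     (\<forall>as\<in>D. \<phi> (map (\<lambda>a. 1\<^sub>m (dim_row a)) as) = 1)"

text \<open>\<open>connect \<phi> n m\<close> is the composite \<open>\<phi>\<^bsub>n+m-1\<^esub> \<circ> \<dots> \<circ> \<phi>\<^sub>n\<close>.\<close>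

primrec connect :: "(nat \<Rightarrow> 'b \<Rightarrow> 'b) \<Rightarrow> nat \<Rightarrow> nat \<Rightarrow> 'b \<Rightarrow> 'b" where
  "connect \<phi> n 0 a = a"
| "connect \<phi> n (Suc m) a = \<phi> (n + m) (connect \<phi> n m a)"

text \<open>The C*-algebra \<open>'a\<close> with the canonical maps \<open>\<Phi> n\<close> is the inductive limit of the
  system: it is the completion of the algebraic direct limit in the limit seminorm.
  This determines the pair up to a unique isomorphism.\<close>

definition inductive_limit ::
  "(nat \<Rightarrow> complex mat list set) \<Rightarrow> (nat \<Rightarrow> complex mat list \<Rightarrow> complex mat list) \<Rightarrow>
   (nat \<Rightarrow> complex mat list \<Rightarrow> 'a::unital_cstar_algebra) \<Rightarrow> bool" where
  "inductive_limit A \<phi> \<Phi> \<longleftrightarrow>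
     (\<forall>n. unital_star_hom_on (A n) (\<Phi> n)) \<and>
     (\<forall>n. \<forall>a\<in>A n. \<Phi> (Suc n) (\<phi> n a) = \<Phi> n a) \<and>
     (\<forall>n. \<forall>a\<in>A n. (\<lambda>m. ms_norm (connect \<phi> n m a)) \<longlonglongrightarrow> norm (\<Phi> n a)) \<and>
     closure (\<Union>n. \<Phi> n ` A n) = UNIV"


section \<open>The particular system\<close>

definition kdim :: "nat \<Rightarrow> nat" where
  "kdim j = (if j = 0 then 1 else 2 ^ (j - 1))"

definition A_alg :: "nat \<Rightarrow> complex mat list set" where
  "A_alg n = mat_sum (map kdim [0..<Suc n])"

definition \<phi>_map :: "nat \<Rightarrow> complex mat list \<Rightarrow> complex mat list" where
  "\<phi>_map n as = as @ [diag_block_mat as]"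

definition surj_star_hom_mat ::
  "nat \<Rightarrow> ('a::unital_cstar_algebra \<Rightarrow> complex mat) \<Rightarrow> bool" where
  "surj_star_hom_mat d p \<longleftrightarrow>
     range p = carrier_mat d d \<and>
     (\<forall>x y. p (x + y) = p x + p y) \<and>
     (\<forall>c x. p (c *\<^sub>C x) = c \<cdot>\<^sub>m p x) \<and>
     (\<forall>x y. p (x * y) = p x * p y) \<and>
     (\<forall>x. p (adj x) = mat_adjoint (p x))"

definition \<pi>_map ::
  "(nat \<Rightarrow> complex mat list \<Rightarrow> 'a::unital_cstar_algebra) \<Rightarrow> nat \<Rightarrow> 'a \<Rightarrow> complex mat" where
  "\<pi>_map \<Phi> j = (THE p. surj_star_hom_mat (kdim j) p \<and>
     (\<forall>n\<ge>j. \<forall>a\<in>A_alg n. p (\<Phi> n a) = a ! j))"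

definition \<tau>_tr ::
  "(nat \<Rightarrow> complex mat list \<Rightarrow> 'a::unital_cstar_algebra) \<Rightarrow> nat \<Rightarrow> 'a \<Rightarrow> complex" where
  "\<tau>_tr \<Phi> j x = mat_trace (\<pi>_map \<Phi> j x) / of_nat (kdim j)"

text \<open>The trace \<open>\<tau>\<^sub>j\<^sup>(\<^sup>n\<^sup>)\<close> on \<open>A_alg n\<close>, for \<open>j \<le> n\<close>.\<close>

definition \<tau>_fin :: "nat \<Rightarrow> complex mat list \<Rightarrow> complex" where
  "\<tau>_fin j as = mat_trace (as ! j) / of_nat (kdim j)"


section \<open>Operators on Hilbert spaces\<close>

text \<open>The GNS space depends on the functional, so Hilbert spaces are given by explicit
  carriers. Operators are extensional functions on the carrier. The inner product is linear
  in its first argument.\<close>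

record 'h hspace =
  hcarrier :: "'h set"
  hzero :: 'h
  hadd :: "'h \<Rightarrow> 'h \<Rightarrow> 'h"
  hscale :: "complex \<Rightarrow> 'h \<Rightarrow> 'h"
  hinner :: "'h \<Rightarrow> 'h \<Rightarrow> complex"

definition hnorm :: "'h hspace \<Rightarrow> 'h \<Rightarrow> real" where
  "hnorm H x = sqrt (Re (hinner H x x))"

definition bounded_ops :: "'h hspace \<Rightarrow> ('h \<Rightarrow> 'h) set" where
  "bounded_ops H = {T \<in> hcarrier H \<rightarrow>\<^sub>E hcarrier H.
     (\<forall>x\<in>hcarrier H. \<forall>y\<in>hcarrier H. T (hadd H x y) = hadd H (T x) (T y)) \<and>
     (\<forall>c. \<forall>x\<in>hcarrier H. T (hscale H c x) = hscale H c (T x)) \<and>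
     (\<exists>K. \<forall>x\<in>hcarrier H. hnorm H (T x) \<le> K * hnorm H x)}"

abbreviation op_comp :: "'h hspace \<Rightarrow> ('h \<Rightarrow> 'h) \<Rightarrow> ('h \<Rightarrow> 'h) \<Rightarrow> 'h \<Rightarrow> 'h" where
  "op_comp H S T \<equiv> compose (hcarrier H) S T"

definition op_zero :: "'h hspace \<Rightarrow> 'h \<Rightarrow> 'h" where
  "op_zero H = (\<lambda>x\<in>hcarrier H. hzero H)"

definition op_id :: "'h hspace \<Rightarrow> 'h \<Rightarrow> 'h" where
  "op_id H = (\<lambda>x\<in>hcarrier H. x)"

definition op_add :: "'h hspace \<Rightarrow> ('h \<Rightarrow> 'h) \<Rightarrow> ('h \<Rightarrow> 'h) \<Rightarrow> 'h \<Rightarrow> 'h" where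
  "op_add H S T = (\<lambda>x\<in>hcarrier H. hadd H (S x) (T x))"

definition op_scale :: "'h hspace \<Rightarrow> complex \<Rightarrow> ('h \<Rightarrow> 'h) \<Rightarrow> 'h \<Rightarrow> 'h" where
  "op_scale H c T = (\<lambda>x\<in>hcarrier H. hscale H c (T x))"

definition is_adjoint :: "'h hspace \<Rightarrow> ('h \<Rightarrow> 'h) \<Rightarrow> ('h \<Rightarrow> 'h) \<Rightarrow> bool" where
  "is_adjoint H T S \<longleftrightarrow>
     (\<forall>x\<in>hcarrier H. \<forall>y\<in>hcarrier H. hinner H (T x) y = hinner H x (S y))"

definition commutant :: "'h hspace \<Rightarrow> ('h \<Rightarrow> 'h) set \<Rightarrow> ('h \<Rightarrow> 'h) set" where
  "commutant H \<S> = {T \<in> bounded_ops H. \<forall>S\<in>\<S>. op_comp H T S = op_comp H S T}"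


section \<open>Types of factors\<close>

text \<open>Throughout, \<open>M\<close> is a von Neumann algebra on \<open>H\<close>.\<close>

definition projections :: "'h hspace \<Rightarrow> ('h \<Rightarrow> 'h) set \<Rightarrow> ('h \<Rightarrow> 'h) set" where
  "projections H M = {P \<in> M. op_comp H P P = P \<and> is_adjoint H P P}"

text \<open>Murray--von Neumann equivalence: \<open>V\<^sup>*V = P\<close> and \<open>VV\<^sup>* = Q\<close> for some \<open>V \<in> M\<close>.\<close>

definition mvn_equiv ::
  "'h hspace \<Rightarrow> ('h \<Rightarrow> 'h) set \<Rightarrow> ('h \<Rightarrow> 'h) \<Rightarrow> ('h \<Rightarrow> 'h) \<Rightarrow> bool" where
  "mvn_equiv H M P Q \<longleftrightarrow>
     (\<exists>V\<in>M. \<exists>W\<in>M. is_adjoint H V W \<and> op_comp H W V = P \<and> op_comp H V W = Q)"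

definition finite_projection :: "'h hspace \<Rightarrow> ('h \<Rightarrow> 'h) set \<Rightarrow> ('h \<Rightarrow> 'h) \<Rightarrow> bool" where
  "finite_projection H M P \<longleftrightarrow> P \<in> projections H M \<and>
     (\<forall>Q\<in>projections H M. op_comp H P Q = Q \<and> mvn_equiv H M P Q \<longrightarrow> Q = P)"

text \<open>\<open>P\<close> is abelian if the corner \<open>PMP\<close> is commutative.\<close>

definition abelian_projection :: "'h hspace \<Rightarrow> ('h \<Rightarrow> 'h) set \<Rightarrow> ('h \<Rightarrow> 'h) \<Rightarrow> bool" where
  "abelian_projection H M P \<longleftrightarrow> P \<in> projections H M \<and>
     (\<forall>S\<in>M. \<forall>T\<in>M.
        let S' = op_comp H P (op_comp H S P); T' = op_comp H P (op_comp H T P)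
        in op_comp H S' T' = op_comp H T' S')"

definition is_factor :: "'h hspace \<Rightarrow> ('h \<Rightarrow> 'h) set \<Rightarrow> bool" where
  "is_factor H M \<longleftrightarrow> op_id H \<noteq> op_zero H \<and>
     M \<inter> commutant H M = range (\<lambda>c. op_scale H c (op_id H))"

definition factor_type_I :: "'h hspace \<Rightarrow> ('h \<Rightarrow> 'h) set \<Rightarrow> nat \<Rightarrow> bool" where
  "factor_type_I H M n \<longleftrightarrow> is_factor H M \<and>
     (\<exists>Ps. length Ps = n \<and>
        (\<forall>P\<in>set Ps. abelian_projection H M P) \<and>
        (\<forall>i<n. \<forall>j<n. i \<noteq> j \<longrightarrow> op_comp H (Ps ! i) (Ps ! j) = op_zero H) \<and>
        (\<forall>i<n. \<forall>j<n. mvn_equiv H M (Ps ! i) (Ps ! j)) \<and>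
        foldr (op_add H) Ps (op_zero H) = op_id H)"

definition factor_type_II1 :: "'h hspace \<Rightarrow> ('h \<Rightarrow> 'h) set \<Rightarrow> bool" where
  "factor_type_II1 H M \<longleftrightarrow> is_factor H M \<and> finite_projection H M (op_id H) \<and>
     (\<forall>P. abelian_projection H M P \<longrightarrow> P = op_zero H)"


section \<open>The GNS representation\<close>

text \<open>The GNS space of \<open>\<tau>\<close> is the completion of the algebra in the seminorm
  \<open>\<tau>(a\<^sup>*a)\<^bsup>1/2\<^esup>\<close>: Cauchy sequences modulo null sequences. The quotient by the left
  kernel and the completion are performed in one step.\<close>

definition gns_seminorm :: "('a::unital_cstar_algebra \<Rightarrow> complex) \<Rightarrow> 'a \<Rightarrow> real" where
  "gns_seminorm \<tau> a = sqrt (Re (\<tau> (adj a * a)))"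

definition gns_Cauchy :: "('a::unital_cstar_algebra \<Rightarrow> complex) \<Rightarrow> (nat \<Rightarrow> 'a) set" where
  "gns_Cauchy \<tau> =
     {x. \<forall>e>0. \<exists>N. \<forall>m\<ge>N. \<forall>n\<ge>N. gns_seminorm \<tau> (x m - x n) < e}"

definition gns_class ::
  "('a::unital_cstar_algebra \<Rightarrow> complex) \<Rightarrow> (nat \<Rightarrow> 'a) \<Rightarrow> (nat \<Rightarrow> 'a) set" where
  "gns_class \<tau> x = {y \<in> gns_Cauchy \<tau>. (\<lambda>n. gns_seminorm \<tau> (x n - y n)) \<longlonglongrightarrow> 0}"

definition gns_pick :: "(nat \<Rightarrow> 'a) set \<Rightarrow> nat \<Rightarrow> 'a" where
  "gns_pick X = (SOME x. x \<in> X)"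

definition gns_space ::
  "('a::unital_cstar_algebra \<Rightarrow> complex) \<Rightarrow> (nat \<Rightarrow> 'a) set hspace" where
  "gns_space \<tau> =
     \<lparr> hcarrier = gns_class \<tau> ` gns_Cauchy \<tau>,
       hzero = gns_class \<tau> (\<lambda>_. 0),
       hadd = (\<lambda>X Y. gns_class \<tau> (\<lambda>n. gns_pick X n + gns_pick Y n)),
       hscale = (\<lambda>c X. gns_class \<tau> (\<lambda>n. c *\<^sub>C gns_pick X n)),
       hinner = (\<lambda>X Y. lim (\<lambda>n. \<tau> (adj (gns_pick Y n) * gns_pick X n))) \<rparr>"

definition gns_rep ::
  "('a::unital_cstar_algebra \<Rightarrow> complex) \<Rightarrow> 'a \<Rightarrow> (nat \<Rightarrow> 'a) set \<Rightarrow> (nat \<Rightarrow> 'a) set" where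
  "gns_rep \<tau> a =
     (\<lambda>X\<in>hcarrier (gns_space \<tau>). gns_class \<tau> (\<lambda>n. a * gns_pick X n))"

definition gns_vN ::
  "('a::unital_cstar_algebra \<Rightarrow> complex) \<Rightarrow> ((nat \<Rightarrow> 'a) set \<Rightarrow> (nat \<Rightarrow> 'a) set) set" where
  "gns_vN \<tau> = commutant (gns_space \<tau>) (commutant (gns_space \<tau>) (range (gns_rep \<tau>)))"

definition trace_type_I :: "('a::unital_cstar_algebra \<Rightarrow> complex) \<Rightarrow> nat \<Rightarrow> bool" where
  "trace_type_I \<tau> n \<longleftrightarrow> factor_type_I (gns_space \<tau>) (gns_vN \<tau>) n"

definition trace_type_II1 :: "('a::unital_cstar_algebra \<Rightarrow> complex) \<Rightarrow> bool" where
  "trace_type_II1 \<tau> \<longleftrightarrow> factor_type_II1 (gns_space \<tau>) (gns_vN \<tau>)"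

end

(*
  A trace functional psi on the limit is determined by its values on minimal projections:
  psi(Phi_n(a)) = sum_j d(n,j) Tr(a_j).  Compatibility with the connecting maps says
  d(n,j) = d(n+1,j) + d(n+1,n+1), so d(n,j) - d(n+1,j) does not depend on j.  If d(n,j) -> w_j
  and m_j = k_j w_j, summing over j gives
      d(n,j) = w_j + 2^(-n) (psi(1) - m_0 - ... - m_n),
  that is, psi = sum_j m_j tau_j + (psi(1) - sum_j m_j) tau_inf.  For states this identifies the
  trace simplex with the probability measures on the one-point compactification of the naturals.

  The same formula, applied to a |-> <a T xi, xi> for T in the centre of the double commutant M,
  shows that M is a factor; only boundedness of this functional in the trace norm is needed, which
  forces its masses m_j to vanish (for tau_inf).  The factor of tau_inf is finite because
  ||V xi|| = ||V^* xi|| for V in M.  It has no abelian projection P: for a partial isometry u far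
  out in the system, which commutes with a given finite stage, PuPu*P xi and Pu*PuP xi are close
  to P xi multiplied on the right by u u* and by u* u, which are orthogonal of trace 1/4.
*)

theory Submission
  imports Defs
begin

section \<open>Elementary C*-algebra\<close>

text \<open>Of the double commutant M only three things enter: its elements are bounded, it contains
  the left multiplications, and it commutes with the right multiplications, which are bounded
  because tau is a trace. Hence T (a xi) is T xi multiplied on the right by a, and each question
  about M becomes one about the vector T xi, represented by a Cauchy sequence in the algebra.
  Positivity is available only for elements of the form \<open>adj x * x\<close>. Two facts usually
  drawn from the order or from functional calculus are therefore proved by hand: left multiplication
  by b is bounded by norm b in the trace seminorm, and a star homomorphism onto a matrix algebra is
  continuous. The limit itself is described only by norms at finite stages and by density, so pi_j
  is assembled from its matrix entries, each extended by continuity. The two maps between traces and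
  measures are explicit and inverse to each other; both are shown continuous directly, since the
  n-th approximation to a mass has error at most k_j / 2^n for all traces at once.\<close>

lemma scaleC_one [simp]: "1 *\<^sub>C x = (x::'a::unital_cstar_algebra)"
  using scaleC_of_real[of 1 x] by simp

lemma scaleC_zero_left [simp]: "0 *\<^sub>C x = (0::'a::unital_cstar_algebra)"
  using scaleC_of_real[of 0 x] by simp

lemma scaleC_zero_right [simp]: "c *\<^sub>C 0 = (0::'a::unital_cstar_algebra)"
  using scaleC_add_right[of c 0 "0::'a"] by simp

lemma scaleC_minus_one: "(-1) *\<^sub>C x = - (x::'a::unital_cstar_algebra)"
  using scaleC_of_real[of "-1" x] by simp

lemma scaleC_minus_right: "c *\<^sub>C (- x) = - (c *\<^sub>C (x::'a::unital_cstar_algebra))"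
  by (metis scaleC_minus_one scaleC_scaleC mult.commute)

lemma scaleC_diff_right: "c *\<^sub>C (x - y) = c *\<^sub>C x - c *\<^sub>C (y::'a::unital_cstar_algebra)"
  using scaleC_add_right[of c x "-y"] by (simp add: scaleC_minus_right)

lemma adj_zero [simp]: "adj 0 = (0::'a::unital_cstar_algebra)"
  using adj_add[of 0 "0::'a"] by simp

lemma adj_one [simp]: "adj 1 = (1::'a::unital_cstar_algebra)"
  by (metis adj_adj adj_mult mult_1_left mult_1_right)

lemma adj_minus: "adj (- x) = - adj (x::'a::unital_cstar_algebra)"
  using adj_scaleC[of "-1" x] by (simp add: scaleC_minus_one)

lemma adj_diff: "adj (x - y) = adj x - adj (y::'a::unital_cstar_algebra)"
  using adj_add[of x "-y"] by (simp add: adj_minus)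

lemma adj_scaleR: "adj (r *\<^sub>R x) = r *\<^sub>R adj (x::'a::unital_cstar_algebra)"
  using adj_scaleC[of "complex_of_real r" x] by (simp add: scaleC_of_real)

lemma norm_adj [simp]: "norm (adj x) = norm (x::'a::unital_cstar_algebra)"
proof -
  have *: "norm x \<le> norm (adj x)" for x :: 'a
  proof (cases "norm x = 0")
    case False
    have "norm x * norm x \<le> norm (adj x) * norm x"
      using norm_mult_ineq[of "adj x" x] by (simp add: cstar_identity power2_eq_square)
    then show ?thesis using False by simp
  qed simp
  show ?thesis using *[of x] *[of "adj x"] by (simp add: adj_adj)
qed

lemma bounded_linear_adj: "bounded_linear (adj :: 'a::unital_cstar_algebra \<Rightarrow> 'a)"
  by (rule bounded_linear_intro[of _ 1]) (auto simp: adj_add adj_scaleR)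

lemma scaleR_scaleC: "r *\<^sub>R (c *\<^sub>C x) = c *\<^sub>C (r *\<^sub>R (x::'a::unital_cstar_algebra))"
  by (metis scaleC_of_real scaleC_scaleC mult.commute)

lemma bounded_linear_scaleC: "bounded_linear (\<lambda>x::'a::unital_cstar_algebra. c *\<^sub>C x)"
  by (rule bounded_linear_intro[of _ "cmod c"])
     (auto simp: scaleC_add_right norm_scaleC scaleR_scaleC)

lemmas continuous_on_adj [continuous_intros] =
  bounded_linear.continuous_on[OF bounded_linear_adj]
lemmas continuous_on_scaleC [continuous_intros] =
  bounded_linear.continuous_on[OF bounded_linear_scaleC]

text \<open>The C*-identity gives norm f = (norm f)^2 for a self-adjoint idempotent f, so norm f <=
  1; applied once more to \<open>adj u\<close> it turns the norm of \<open>u * adj u\<close> into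
  the square of norm u.\<close>

lemma norm_partial_isometry_le_1:
  fixes u :: "'a::unital_cstar_algebra"
  assumes "(u * adj u) * (u * adj u) = u * adj u"
  shows "norm u \<le> 1"
proof -
  let ?f = "u * adj u"
  have "adj ?f = ?f" by (simp add: adj_mult adj_adj)
  then have "norm ?f = (norm ?f)\<^sup>2" using cstar_identity[of ?f] assms by simp
  then have "norm ?f \<le> 1"
    by (metis power2_eq_square mult_cancel_left2 norm_zero not_one_le_zero order_refl zero_le_one)
  moreover have "norm ?f = (norm u)\<^sup>2" using cstar_identity[of "adj u"] by (simp add: adj_adj)
  ultimately show ?thesis by (simp add: power2_le_iff_abs_le abs_square_le_1)
qed

lemma nonneg_Reals_complexD: "z \<in> \<real>\<^sub>\<ge>\<^sub>0 \<Longrightarrow> 0 \<le> Re z \<and> z = complex_of_real (Re z)"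
  by (auto simp: complex_nonneg_Reals_iff complex_eq_iff)

section \<open>States\<close>

locale state =
  fixes \<tau> :: "'a::unital_cstar_algebra \<Rightarrow> complex"
  assumes is_state: "is_state \<tau>"
begin

lemma bl: "bounded_linear \<tau>" and scaleC: "\<tau> (c *\<^sub>C x) = c * \<tau> x"
  and pos: "\<tau> (adj x * x) \<in> \<real>\<^sub>\<ge>\<^sub>0" and unit [simp]: "\<tau> 1 = 1"
  using is_state by (auto simp: is_state_def)

sublocale bounded_linear \<tau> by (rule bl)

lemma pos_Re: "0 \<le> Re (\<tau> (adj x * x))" and pos_real: "\<tau> (adj x * x) = complex_of_real (Re (\<tau> (adj x * x)))"
  using nonneg_Reals_complexD[OF pos[of x]] by auto

text \<open>Polarization: the form is real on the diagonal, and comparing imaginary parts at x + y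
  and at x + i y gives the symmetry.\<close>

lemma adj_mult_cnj: "\<tau> (adj x * y) = cnj (\<tau> (adj y * x))"
proof -
  let ?f = "\<lambda>z. \<tau> (adj z * z)"
  have im: "Im (?f z) = 0" for z using pos_real[of z] by (metis Im_complex_of_real)
  have a: "?f (x + y) = ?f x + ?f y + (\<tau> (adj x * y) + \<tau> (adj y * x))"
    by (simp add: adj_add algebra_simps add)
  have b: "?f (x + \<i> *\<^sub>C y) = ?f x + ?f y + \<i> * (\<tau> (adj x * y) - \<tau> (adj y * x))"
    by (simp add: adj_add algebra_simps add adj_scaleC mult_scaleC_left mult_scaleC_right scaleC_scaleC scaleC)
  have "Im (\<tau> (adj x * y) + \<tau> (adj y * x)) = 0"
    using arg_cong[OF a, of Im] by (simp add: im)
  moreover have "Re (\<tau> (adj x * y) - \<tau> (adj y * x)) = 0"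
    using arg_cong[OF b, of Im] by (simp add: im)
  ultimately show ?thesis by (simp add: complex_eq_iff)
qed

lemma adj_cnj: "\<tau> (adj x) = cnj (\<tau> x)"
  using adj_mult_cnj[of x 1] by simp

abbreviation q :: "'a \<Rightarrow> real" where "q \<equiv> gns_seminorm \<tau>"

lemma q_nonneg [simp]: "0 \<le> q x" and q_square: "(q x)\<^sup>2 = Re (\<tau> (adj x * x))"
  and q_square_complex: "complex_of_real ((q x)\<^sup>2) = \<tau> (adj x * x)"
  using pos_Re[of x] pos_real[of x] by (auto simp: gns_seminorm_def)

lemma q_scaleC: "q (c *\<^sub>C x) = cmod c * q x"
proof -
  have "(q (c *\<^sub>C x))\<^sup>2 = (cmod c * q x)\<^sup>2"
  proof -
    have "complex_of_real ((q (c *\<^sub>C x))\<^sup>2) = (c * cnj c) * complex_of_real ((q x)\<^sup>2)"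
      unfolding q_square_complex
      by (simp add: adj_scaleC mult_scaleC_left mult_scaleC_right scaleC_scaleC scaleC mult_ac)
    also have "\<dots> = complex_of_real ((cmod c * q x)\<^sup>2)"
      by (simp add: complex_norm_square[symmetric] power_mult_distrib)
    finally show ?thesis using of_real_eq_iff by blast
  qed
  then show ?thesis by (simp add: power2_eq_iff_nonneg)
qed

lemma q_zero [simp]: "q 0 = 0" by (simp add: gns_seminorm_def zero)
lemma q_one [simp]: "q 1 = 1" by (simp add: gns_seminorm_def)

lemma q_minus [simp]: "q (- x) = q x"
  using q_scaleC[of "-1" x] by (simp add: scaleC_minus_one)

lemma q_minus_commute: "q (x - y) = q (y - x)"
  using q_minus[of "x - y"] by simp

text \<open>With \<open>z = \<tau> (y\<^sup>* x)\<close>, evaluate \<open>q (x - t z y)\<^sup>2 \<ge> 0\<close> at \<open>t = 1 / q(y)\<^sup>2\<close>, or at a large \<open>t\<close>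
  if \<open>q y = 0\<close>.\<close>

lemma Cauchy_Schwarz: "cmod (\<tau> (adj y * x)) \<le> q x * q y"
proof -
  let ?z = "\<tau> (adj y * x)"
  have key: "2 * t * (cmod ?z)\<^sup>2 \<le> (q x)\<^sup>2 + t\<^sup>2 * (cmod ?z)\<^sup>2 * (q y)\<^sup>2" for t :: real
  proof -
    let ?c = "complex_of_real t * ?z"
    have "\<tau> (adj (x - ?c *\<^sub>C y) * (x - ?c *\<^sub>C y))
        = \<tau> (adj x * x) - ?c * \<tau> (adj x * y) - cnj ?c * ?z + cnj ?c * ?c * \<tau> (adj y * y)"
      by (simp add: adj_diff adj_scaleC algebra_simps diff add mult_scaleC_left mult_scaleC_right
          scaleC_scaleC scaleC)
    also have "\<dots> = complex_of_real ((q x)\<^sup>2 - 2 * t * (cmod ?z)\<^sup>2 + t\<^sup>2 * (cmod ?z)\<^sup>2 * (q y)\<^sup>2)"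
    proof -
      have zz: "?z * cnj ?z = complex_of_real (cmod ?z) * complex_of_real (cmod ?z)"
        by (metis complex_norm_square of_real_mult power2_eq_square)
      have "cnj ?c * ?c = complex_of_real (t\<^sup>2 * (cmod ?z)\<^sup>2)"
        using zz by (simp add: power2_eq_square mult_ac)
      moreover have "?c * \<tau> (adj x * y) = complex_of_real (t * (cmod ?z)\<^sup>2)"
        unfolding adj_mult_cnj[of x y] using zz by (simp add: power2_eq_square mult_ac)
      moreover have "cnj ?c * ?z = complex_of_real (t * (cmod ?z)\<^sup>2)"
        using zz by (simp add: power2_eq_square mult_ac)
      ultimately show ?thesis
        by (simp only: q_square_complex[symmetric] of_real_diff[symmetric] of_real_add[symmetric]
            of_real_mult[symmetric]) (simp add: algebra_simps)
    qed
    finally have "Re (\<tau> (adj (x - ?c *\<^sub>C y) * (x - ?c *\<^sub>C y)))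
       = (q x)\<^sup>2 - 2 * t * (cmod ?z)\<^sup>2 + t\<^sup>2 * (cmod ?z)\<^sup>2 * (q y)\<^sup>2"
      by (metis Re_complex_of_real)
    then show ?thesis using pos_Re[of "x - ?c *\<^sub>C y"] by linarith
  qed
  have "(cmod ?z)\<^sup>2 \<le> (q x * q y)\<^sup>2"
  proof (cases "q y = 0")
    case True
    have "?z = 0"
    proof (rule ccontr)
      assume "?z \<noteq> 0"
      then have p: "(cmod ?z)\<^sup>2 > 0" by simp
      let ?t = "((q x)\<^sup>2 + 1) / (cmod ?z)\<^sup>2"
      have "2 * ?t * (cmod ?z)\<^sup>2 = 2 * ((q x)\<^sup>2 + 1)" using p by simp
      then have "2 * ((q x)\<^sup>2 + 1) \<le> (q x)\<^sup>2" using key[of ?t] True by simp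
      moreover have "0 \<le> (q x)\<^sup>2" by simp
      ultimately show False by argo
    qed
    then show ?thesis by simp
  next
    case False
    then have p: "(q y)\<^sup>2 > 0" by simp
    have "(1 / b)\<^sup>2 * c * b = c / b" "2 * (1 / b) * c = 2 * (c / b)" if "b > 0" for b c :: real
      using that by (simp_all add: power2_eq_square)
    then have "2 * ((cmod ?z)\<^sup>2 / (q y)\<^sup>2) \<le> (q x)\<^sup>2 + (cmod ?z)\<^sup>2 / (q y)\<^sup>2"
      using key[of "1 / (q y)\<^sup>2"] p by metis
    then have "(cmod ?z)\<^sup>2 / (q y)\<^sup>2 \<le> (q x)\<^sup>2" by argo
    then show ?thesis using p by (simp add: pos_divide_le_eq power_mult_distrib)
  qed
  then show ?thesis by (simp add: power2_le_iff_abs_le)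
qed

lemma q_triangle: "q (x + y) \<le> q x + q y"
proof -
  have "(q (x + y))\<^sup>2 = (q x)\<^sup>2 + (q y)\<^sup>2 + 2 * Re (\<tau> (adj y * x))"
    using adj_mult_cnj[of x y] by (simp add: q_square adj_add algebra_simps add)
  also have "\<dots> \<le> (q x)\<^sup>2 + (q y)\<^sup>2 + 2 * (q x * q y)"
    using Cauchy_Schwarz[of y x] complex_Re_le_cmod[of "\<tau> (adj y * x)"] by linarith
  also have "\<dots> = (q x + q y)\<^sup>2" by (simp add: power2_sum)
  finally show ?thesis by (rule power2_le_imp_le) simp
qed

lemma q_triangle_diff: "q (x - z) \<le> q (x - y) + q (y - z)"
  using q_triangle[of "x - y" "y - z"] by simp

lemma q_diff_le: "\<bar>q x - q y\<bar> \<le> q (x - y)"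
  using q_triangle[of "x - y" y] q_triangle[of "y - x" x] q_minus_commute[of x y] by simp

text \<open>Iterating Cauchy--Schwarz gives
  \<open>g(h)\<^sup>2\<^sup>^\<^sup>n \<le> g(1)\<^sup>2\<^sup>^\<^sup>n\<^sup>-\<^sup>1 g(h\<^sup>2\<^sup>^\<^sup>n)\<close> for \<open>g(h) = \<tau>(x\<^sup>* h x)\<close>, \<open>h = b\<^sup>* b\<close>,
  and the right-hand side is at most a constant times \<open>\<parallel>h\<parallel>\<^sup>2\<^sup>^\<^sup>n\<close>.\<close>

lemma q_mult_left: "q (b * x) \<le> norm b * q x"
proof -
  let ?g = "\<lambda>h. cmod (\<tau> (adj x * (h * x)))"
  let ?h = "adj b * b"
  obtain K where K: "\<And>z. cmod (\<tau> z) \<le> norm z * K" "K > 0"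
    using pos_bounded by blast
  have sa: "adj (?h ^ m) = ?h ^ m" for m
  proof (induction m)
    case (Suc m)
    have "adj (?h ^ Suc m) = adj (?h ^ m) * ?h"
      by (simp add: adj_mult adj_adj)
    then show ?case using Suc by (simp add: power_commutes)
  qed simp
  have step: "(?g (?h ^ m))\<^sup>2 \<le> ?g 1 * ?g (?h ^ (2 * m))" for m
  proof -
    have e: "adj (?h ^ m * x) * (?h ^ m * x) = adj x * (?h ^ (2 * m) * x)"
      by (simp add: adj_mult sa mult.assoc mult_2 power_add)
    have n1: "(q x)\<^sup>2 = ?g 1" by (metis q_square_complex mult_1_left norm_of_real abs_power2 abs_of_nonneg zero_le_power2)
    have n2: "(q (?h ^ m * x))\<^sup>2 = ?g (?h ^ (2 * m))"
      by (metis e q_square_complex norm_of_real abs_of_nonneg zero_le_power2)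
    have "(?g (?h ^ m))\<^sup>2 \<le> (q (?h ^ m * x) * q x)\<^sup>2"
      using Cauchy_Schwarz[of x "?h ^ m * x"] by (intro power_mono) auto
    then show ?thesis by (simp only: power_mult_distrib n1 n2 mult.commute)
  qed
  \<comment> \<open>The factor \<open>?g 1\<close> on both sides replaces the exponent 2^n - 1, so
    that \<open>?g 1 = 0\<close> makes the inequality trivial and otherwise the factor
    cancels.\<close>
  have iter: "?g ?h ^ (2 ^ n) * ?g 1 \<le> ?g 1 ^ (2 ^ n) * ?g (?h ^ (2 ^ n))" for n
  proof (induction n)
    case (Suc n)
    show ?case
    proof (cases "?g 1 = 0")
      case False
      then have p: "?g 1 > 0" by simp
      have "(?g ?h ^ (2 ^ n) * ?g 1)\<^sup>2 \<le> (?g 1 ^ (2 ^ n) * ?g (?h ^ (2 ^ n)))\<^sup>2"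
        using Suc by (intro power_mono) auto
      also have "\<dots> = (?g 1 ^ (2 ^ n))\<^sup>2 * (?g (?h ^ (2 ^ n)))\<^sup>2" by (simp add: power_mult_distrib)
      also have "\<dots> \<le> (?g 1 ^ (2 ^ n))\<^sup>2 * (?g 1 * ?g (?h ^ (2 * 2 ^ n)))"
        by (intro mult_left_mono step) auto
      finally have "(?g ?h ^ (2 ^ n))\<^sup>2 * ?g 1 * ?g 1 \<le> (?g 1 ^ (2 ^ n))\<^sup>2 * ?g (?h ^ (2 * 2 ^ n)) * ?g 1"
        by (simp only: power_mult_distrib power2_eq_square[of "?g 1"] mult_ac)
      then have "(?g ?h ^ (2 ^ n))\<^sup>2 * ?g 1 \<le> (?g 1 ^ (2 ^ n))\<^sup>2 * ?g (?h ^ (2 * 2 ^ n))"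
        using p by (rule mult_right_le_imp_le)
      then show ?thesis by (simp only: power_mult[symmetric] power_Suc mult.commute[of "2 ^ n" 2])
    qed (simp add: zero_power)
  qed simp
  have bound: "?g (?h ^ m) \<le> (K * (norm x)\<^sup>2) * norm ?h ^ m" for m
  proof -
    have "?g (?h ^ m) \<le> norm (adj x * (?h ^ m * x)) * K" by (rule K)
    also have "\<dots> \<le> (norm x * (norm ?h ^ m * norm x)) * K"
    proof (intro mult_right_mono)
      have "norm (adj x * (?h ^ m * x)) \<le> norm (adj x) * (norm (?h ^ m) * norm x)"
        by (meson norm_mult_ineq mult_left_mono norm_ge_zero order_trans)
      also have "\<dots> \<le> norm x * (norm ?h ^ m * norm x)"
        by (auto intro!: mult_left_mono mult_right_mono norm_power_ineq)
      finally show "norm (adj x * (?h ^ m * x)) \<le> norm x * (norm ?h ^ m * norm x)" .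
    qed (use K in auto)
    finally show ?thesis by (simp add: power2_eq_square mult_ac)
  qed
  have main: "?g ?h \<le> norm ?h * ?g 1"
  proof (rule ccontr)
    assume a: "\<not> ?g ?h \<le> norm ?h * ?g 1"
    have g1: "?g 1 > 0"
    proof (rule ccontr)
      assume "\<not> ?g 1 > 0"
      then have z: "?g 1 = 0" by simp
      have "?g (?h ^ 1) = 0" using step[of 1] z by simp
      then show False using a z by simp
    qed
    define s where "s = norm ?h * ?g 1"
    have s0: "s \<ge> 0" by (simp add: s_def)
    define C where "C = K * (norm x)\<^sup>2"
    have le: "?g ?h ^ (2 ^ n) * ?g 1 \<le> C * s ^ (2 ^ n)" for n
    proof -
      have "?g ?h ^ (2 ^ n) * ?g 1 \<le> ?g 1 ^ (2 ^ n) * (C * norm ?h ^ (2 ^ n))"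
        unfolding C_def by (rule order_trans[OF iter mult_left_mono[OF bound]]) simp
      then show ?thesis by (simp add: s_def power_mult_distrib mult_ac)
    qed
    have gs: "?g ?h > s" using a by (simp add: s_def)
    have spos: "s > 0"
    proof (rule ccontr)
      assume "\<not> s > 0"
      then have "s = 0" using s0 by simp
      then have "?g ?h ^ 1 * ?g 1 \<le> 0" using le[of 0] by simp
      then show False using g1 gs \<open>s = 0\<close> by (simp add: mult_le_0_iff)
    qed
    \<comment> \<open>Instead of taking 2^n-th roots: if the claim failed, this ratio would exceed 1
      although its powers \<open>\<rho> ^ (2 ^ n)\<close> stay bounded.\<close>
    define \<rho> where "\<rho> = ?g ?h / s"
    have \<rho>: "\<rho> > 1" using gs spos by (simp add: \<rho>_def)
    have r: "\<rho> ^ (2 ^ n) \<le> C / ?g 1" for n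
      using le[of n] spos g1 by (simp add: \<rho>_def power_divide field_simps)
    obtain m where m: "C / ?g 1 < \<rho> ^ m" using real_arch_pow[OF \<rho>] by blast
    have "\<rho> ^ m \<le> \<rho> ^ (2 ^ m)" using \<rho> by (intro power_increasing) (auto simp: less_imp_le)
    then show False using r[of m] m by simp
  qed
  have n1: "(q x)\<^sup>2 = ?g 1"
    by (metis q_square_complex mult_1_left norm_of_real abs_of_nonneg zero_le_power2)
  have n2: "(q (b * x))\<^sup>2 = ?g ?h"
    by (metis q_square_complex adj_mult mult.assoc norm_of_real abs_of_nonneg zero_le_power2)
  have "(q (b * x))\<^sup>2 \<le> (norm b * q x)\<^sup>2"
    using main by (simp add: n1 n2 power_mult_distrib cstar_identity)
  then show ?thesis by (rule power2_le_imp_le) simp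
qed

lemma q_le_norm: "q x \<le> norm x"
  using q_mult_left[of x 1] by simp

lemma cmod_le_q: "cmod (\<tau> x) \<le> q x"
  using Cauchy_Schwarz[of 1 x] by simp

lemma cmod_le_norm: "cmod (\<tau> x) \<le> norm x"
  using cmod_le_q[of x] q_le_norm[of x] by linarith

end

section \<open>The GNS space of a tracial state\<close>

locale tracial_state = state +
  assumes commute: "\<tau> (x * y) = \<tau> (y * x)"
begin

lemma q_adj: "q (adj x) = q x"
  by (simp add: gns_seminorm_def adj_adj commute)

lemma q_mult_right: "q (x * b) \<le> norm b * q x"
  using q_mult_left[of "adj b" "adj x"] q_adj[of "x * b"] by (simp add: adj_mult q_adj)

abbreviation cl :: "(nat \<Rightarrow> 'a) \<Rightarrow> (nat \<Rightarrow> 'a) set" where "cl \<equiv> gns_class \<tau>"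
abbreviation Cau :: "(nat \<Rightarrow> 'a) set" where "Cau \<equiv> gns_Cauchy \<tau>"
abbreviation H :: "(nat \<Rightarrow> 'a) set hspace" where "H \<equiv> gns_space \<tau>"
abbreviation hdist :: "(nat \<Rightarrow> 'a) set \<Rightarrow> (nat \<Rightarrow> 'a) set \<Rightarrow> real" where
  "hdist X Y \<equiv> hnorm H (hadd H X (hscale H (- 1) Y))"
abbreviation v :: "'a \<Rightarrow> (nat \<Rightarrow> 'a) set" where "v a \<equiv> cl (\<lambda>_. a)"

section \<open>Cauchy sequences for the trace seminorm\<close>

lemma CauD: "x \<in> Cau \<Longrightarrow> e > 0 \<Longrightarrow> \<exists>N. \<forall>m\<ge>N. \<forall>n\<ge>N. q (x m - x n) < e"
  by (auto simp: gns_Cauchy_def)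

lemma Cau_const [simp]: "(\<lambda>_. a) \<in> Cau"
  by (auto simp: gns_Cauchy_def)

lemma Cau_le:
  assumes "x \<in> Cau" and "\<And>m n. q (y m - y n) \<le> K * q (x m - x n)"
  shows "y \<in> Cau"
  unfolding gns_Cauchy_def mem_Collect_eq
proof (intro allI impI)
  fix e :: real assume e: "e > 0"
  \<comment> \<open>\<open>K\<close> carries no sign condition; the maximum with 1 can safely be
    divided by.\<close>
  define K' where "K' = max K 1"
  have K': "K' > 0" "K \<le> K'" by (auto simp: K'_def)
  obtain N where N: "\<forall>m\<ge>N. \<forall>n\<ge>N. q (x m - x n) < e / K'"
    using CauD[OF assms(1), of "e / K'"] e K' by auto
  have "q (y m - y n) < e" if "m \<ge> N" "n \<ge> N" for m n
  proof -
    have "q (y m - y n) \<le> K' * q (x m - x n)"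
      using assms(2)[of m n] mult_right_mono[OF K'(2) q_nonneg[of "x m - x n"]] by linarith
    moreover have "q (x m - x n) < e / K'" using N that by blast
    ultimately show ?thesis using K' by (simp add: field_simps)
  qed
  then show "\<exists>N. \<forall>m\<ge>N. \<forall>n\<ge>N. q (y m - y n) < e" by blast
qed

lemma Cau_add [simp]:
  assumes "x \<in> Cau" "y \<in> Cau" shows "(\<lambda>n. x n + y n) \<in> Cau"
  unfolding gns_Cauchy_def mem_Collect_eq
proof (intro allI impI)
  fix e :: real assume e: "e > 0"
  obtain N1 where N1: "\<forall>m\<ge>N1. \<forall>n\<ge>N1. q (x m - x n) < e / 2"
    using CauD[OF assms(1), of "e / 2"] e by auto
  obtain N2 where N2: "\<forall>m\<ge>N2. \<forall>n\<ge>N2. q (y m - y n) < e / 2"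
    using CauD[OF assms(2), of "e / 2"] e by auto
  have "q (x m + y m - (x n + y n)) < e" if "m \<ge> max N1 N2" "n \<ge> max N1 N2" for m n
  proof -
    have "q (x m + y m - (x n + y n)) \<le> q (x m - x n) + q (y m - y n)"
      using q_triangle[of "x m - x n" "y m - y n"] by (simp add: algebra_simps)
    moreover have "q (x m - x n) < e / 2" "q (y m - y n) < e / 2"
      using N1 N2 that by auto
    ultimately show ?thesis by linarith
  qed
  then show "\<exists>N. \<forall>m\<ge>N. \<forall>n\<ge>N. q (x m + y m - (x n + y n)) < e" by blast
qed

lemma Cau_scaleC [simp]: "x \<in> Cau \<Longrightarrow> (\<lambda>n. c *\<^sub>C x n) \<in> Cau"
  by (rule Cau_le[where K = "cmod c"]) (auto simp: scaleC_diff_right[symmetric] q_scaleC)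

lemma Cau_minus [simp]: "x \<in> Cau \<Longrightarrow> (\<lambda>n. - x n) \<in> Cau"
  using Cau_scaleC[of x "-1"] by (simp add: scaleC_minus_one)

lemma Cau_diff [simp]: "x \<in> Cau \<Longrightarrow> y \<in> Cau \<Longrightarrow> (\<lambda>n. x n - y n) \<in> Cau"
  using Cau_add[of x "\<lambda>n. - y n"] by simp

lemma Cau_mult_left [simp]: "x \<in> Cau \<Longrightarrow> (\<lambda>n. a * x n) \<in> Cau"
  by (rule Cau_le[where K = "norm a"]) (auto simp: right_diff_distrib[symmetric] q_mult_left)

lemma Cau_mult_right [simp]: "x \<in> Cau \<Longrightarrow> (\<lambda>n. x n * a) \<in> Cau"
  by (rule Cau_le[where K = "norm a"]) (auto simp: left_diff_distrib[symmetric] q_mult_right)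

lemma Cau_adj [simp]: "x \<in> Cau \<Longrightarrow> (\<lambda>n. adj (x n)) \<in> Cau"
  by (rule Cau_le[where K = 1]) (auto simp: adj_diff[symmetric] q_adj)

lemma convergent_q: assumes "x \<in> Cau" shows "convergent (\<lambda>n. q (x n))"
proof -
  have "Cauchy (\<lambda>n. q (x n))"
  proof (rule CauchyI)
    fix e :: real assume "e > 0"
    then obtain N where N: "\<forall>m\<ge>N. \<forall>n\<ge>N. q (x m - x n) < e" using CauD[OF assms] by blast
    have "norm (q (x m) - q (x n)) < e" if "m \<ge> N" "n \<ge> N" for m n
      using N that q_diff_le[of "x m" "x n"] by (auto intro: order_le_less_trans)
    then show "\<exists>M. \<forall>m\<ge>M. \<forall>n\<ge>M. norm (q (x m) - q (x n)) < e" by blast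
  qed
  then show ?thesis by (rule Cauchy_convergent)
qed

section \<open>Inner product, norm and distance on classes of Cauchy sequences\<close>

lemma ip_diff_bound:
  "cmod (\<tau> (adj y * x) - \<tau> (adj y' * x')) \<le> q (x - x') * q y + q x' * q (y - y')"
proof -
  have "\<tau> (adj y * x) - \<tau> (adj y' * x') = \<tau> (adj y * (x - x')) + \<tau> (adj (y - y') * x')"
    by (simp add: adj_diff algebra_simps diff add)
  also have "cmod \<dots> \<le> q (x - x') * q y + q x' * q (y - y')"
    by (rule norm_triangle_le) (intro add_mono Cauchy_Schwarz)
  finally show ?thesis .
qed

lemma ip_convergent:
  assumes "x \<in> Cau" "y \<in> Cau" shows "convergent (\<lambda>n. \<tau> (adj (y n) * x n))"
proof -
  obtain B where B: "\<And>n. q (x n) \<le> B"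
    using convergent_imp_Bseq[OF convergent_q[OF assms(1)]] by (auto simp: Bseq_def)
  obtain C where C: "\<And>n. q (y n) \<le> C"
    using convergent_imp_Bseq[OF convergent_q[OF assms(2)]] by (auto simp: Bseq_def)
  define K where "K = \<bar>B\<bar> + \<bar>C\<bar> + 1"
  have K: "K > 0" "q (x n) \<le> K" "q (y n) \<le> K" for n
    using B[of n] C[of n] by (auto simp: K_def)
  have "Cauchy (\<lambda>n. \<tau> (adj (y n) * x n))"
  proof (rule CauchyI)
    fix e :: real assume e: "e > 0"
    obtain N1 where N1: "\<forall>m\<ge>N1. \<forall>n\<ge>N1. q (x m - x n) < e / (2 * K)"
      using CauD[OF assms(1), of "e / (2 * K)"] e K(1) by auto
    obtain N2 where N2: "\<forall>m\<ge>N2. \<forall>n\<ge>N2. q (y m - y n) < e / (2 * K)"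
      using CauD[OF assms(2), of "e / (2 * K)"] e K(1) by auto
    have "norm (\<tau> (adj (y m) * x m) - \<tau> (adj (y n) * x n)) < e"
      if "m \<ge> max N1 N2" "n \<ge> max N1 N2" for m n
    proof -
      have a: "q (x m - x n) < e / (2 * K)" "q (y m - y n) < e / (2 * K)" using N1 N2 that by auto
      have "q (x m - x n) * q (y m) \<le> q (x m - x n) * K" using K by (intro mult_left_mono) auto
      also have "\<dots> < e / (2 * K) * K" using a K by (intro mult_strict_right_mono) auto
      finally have 1: "q (x m - x n) * q (y m) < e / 2" using K by simp
      have "q (x n) * q (y m - y n) \<le> K * q (y m - y n)" using K by (intro mult_right_mono) auto
      also have "\<dots> < K * (e / (2 * K))" using a K by (intro mult_strict_left_mono) auto
      finally have 2: "q (x n) * q (y m - y n) < e / 2" using K by simp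
      show ?thesis using ip_diff_bound[of "y m" "x m" "y n" "x n"] 1 2 by linarith
    qed
    then show "\<exists>M. \<forall>m\<ge>M. \<forall>n\<ge>M. norm (\<tau> (adj (y m) * x m) - \<tau> (adj (y n) * x n)) < e" by blast
  qed
  then show ?thesis by (rule Cauchy_convergent)
qed

lemma q_tendsto_0_trans:
  assumes "(\<lambda>n. q (x n - y n)) \<longlonglongrightarrow> 0" "(\<lambda>n. q (y n - z n)) \<longlonglongrightarrow> 0"
  shows "(\<lambda>n. q (x n - z n)) \<longlonglongrightarrow> 0"
proof (rule tendsto_sandwich[OF _ _ tendsto_const])
  show "(\<lambda>n. q (x n - y n) + q (y n - z n)) \<longlonglongrightarrow> 0" using tendsto_add[OF assms] by simp
qed (auto intro!: always_eventually q_triangle_diff)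

lemma cl_eq_iff:
  assumes "x \<in> Cau" "y \<in> Cau"
  shows "cl x = cl y \<longleftrightarrow> (\<lambda>n. q (x n - y n)) \<longlonglongrightarrow> 0"
proof
  assume "cl x = cl y"
  moreover have "y \<in> cl y" using assms by (simp add: gns_class_def)
  ultimately have "y \<in> cl x" by simp
  then show "(\<lambda>n. q (x n - y n)) \<longlonglongrightarrow> 0" by (simp add: gns_class_def)
next
  assume a: "(\<lambda>n. q (x n - y n)) \<longlonglongrightarrow> 0"
  then have b: "(\<lambda>n. q (y n - x n)) \<longlonglongrightarrow> 0" by (simp add: q_minus_commute)
  show "cl x = cl y"
    unfolding gns_class_def using q_tendsto_0_trans[OF a] q_tendsto_0_trans[OF b] by blast
qed

lemma cl_carrier [simp]: "x \<in> Cau \<Longrightarrow> cl x \<in> hcarrier H"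
  by (simp add: gns_space_def)

lemma carrierE:
  assumes "X \<in> hcarrier H" obtains x where "x \<in> Cau" "X = cl x"
  using assms by (auto simp: gns_space_def)

text \<open>The operations of \<open>gns_space\<close> act on representatives chosen by
  \<open>gns_pick\<close>. A chosen representative differs from any given one by a null sequence,
  which makes the operations independent of the choice.\<close>

lemma pick_cl:
  assumes "x \<in> Cau"
  shows "gns_pick (cl x) \<in> Cau" "(\<lambda>n. q (x n - gns_pick (cl x) n)) \<longlonglongrightarrow> 0"
proof -
  have "x \<in> cl x" using assms by (simp add: gns_class_def)
  then have "gns_pick (cl x) \<in> cl x" unfolding gns_pick_def by (rule someI[of "\<lambda>z. z \<in> cl x"])
  then show "gns_pick (cl x) \<in> Cau" "(\<lambda>n. q (x n - gns_pick (cl x) n)) \<longlonglongrightarrow> 0"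
    by (auto simp: gns_class_def)
qed

lemma ip_diff_tendsto:
  assumes "x' \<in> Cau" "y \<in> Cau"
    and "(\<lambda>n. q (x n - x' n)) \<longlonglongrightarrow> 0" "(\<lambda>n. q (y n - y' n)) \<longlonglongrightarrow> 0"
  shows "(\<lambda>n. \<tau> (adj (y n) * x n) - \<tau> (adj (y' n) * x' n)) \<longlonglongrightarrow> 0"
proof (rule Lim_null_comparison)
  obtain B C where "(\<lambda>n. q (x' n)) \<longlonglongrightarrow> B" "(\<lambda>n. q (y n)) \<longlonglongrightarrow> C"
    using convergent_q assms unfolding convergent_def by blast
  then show "(\<lambda>n. q (x n - x' n) * q (y n) + q (x' n) * q (y n - y' n)) \<longlonglongrightarrow> 0"
    using tendsto_add[OF tendsto_mult[OF assms(3)] tendsto_mult[OF _ assms(4)]] by simp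
qed (auto intro!: always_eventually ip_diff_bound)

text \<open>Allows inner products to be computed from any convenient representatives. The terms for
  the given and for the picked representatives differ by a null sequence, by Cauchy-Schwarz.\<close>

lemma inner_tendsto:
  assumes "x \<in> Cau" "y \<in> Cau"
  shows "(\<lambda>n. \<tau> (adj (y n) * x n)) \<longlonglongrightarrow> hinner H (cl x) (cl y)"
proof -
  let ?x = "gns_pick (cl x)" and ?y = "gns_pick (cl y)"
  have "(\<lambda>n. \<tau> (adj (?y n) * ?x n)) \<longlonglongrightarrow> hinner H (cl x) (cl y)"
    using ip_convergent[OF pick_cl(1)[OF assms(1)] pick_cl(1)[OF assms(2)]]
    by (simp add: gns_space_def convergent_LIMSEQ_iff)
  moreover have "(\<lambda>n. \<tau> (adj (y n) * x n) - \<tau> (adj (?y n) * ?x n)) \<longlonglongrightarrow> 0"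
    using assms by (intro ip_diff_tendsto pick_cl)
  ultimately show ?thesis using tendsto_add by force
qed

lemma hadd_cl [simp]:
  assumes "x \<in> Cau" "y \<in> Cau" shows "hadd H (cl x) (cl y) = cl (\<lambda>n. x n + y n)"
proof -
  let ?x = "gns_pick (cl x)" and ?y = "gns_pick (cl y)"
  have "(\<lambda>n. q ((?x n + ?y n) - (x n + y n))) \<longlonglongrightarrow> 0"
  proof (rule tendsto_sandwich[OF _ _ tendsto_const])
    show "(\<lambda>n. q (x n - ?x n) + q (y n - ?y n)) \<longlonglongrightarrow> 0"
      using tendsto_add[OF pick_cl(2) pick_cl(2)] assms by force
    have "q ((?x n + ?y n) - (x n + y n)) \<le> q (x n - ?x n) + q (y n - ?y n)" for n
      using q_triangle[of "x n - ?x n" "y n - ?y n"] q_minus_commute[of "x n + y n" "?x n + ?y n"]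
      by (simp add: algebra_simps)
    then show "\<forall>\<^sub>F n in sequentially. q ((?x n + ?y n) - (x n + y n)) \<le> q (x n - ?x n) + q (y n - ?y n)"
      by simp
  qed simp
  then show ?thesis using assms pick_cl by (simp add: gns_space_def cl_eq_iff)
qed

lemma hscale_cl [simp]:
  assumes "x \<in> Cau" shows "hscale H c (cl x) = cl (\<lambda>n. c *\<^sub>C x n)"
proof -
  have "(\<lambda>n. q (c *\<^sub>C gns_pick (cl x) n - c *\<^sub>C x n)) \<longlonglongrightarrow> 0"
    using tendsto_mult_left[OF pick_cl(2)[OF assms], of "cmod c"]
    by (simp add: scaleC_diff_right[symmetric] q_scaleC q_minus_commute)
  then show ?thesis using assms pick_cl by (simp add: gns_space_def cl_eq_iff)
qed

lemma hzero_eq: "hzero H = v 0"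
  by (simp add: gns_space_def)

lemma hnorm_tendsto:
  assumes "x \<in> Cau" shows "(\<lambda>n. q (x n)) \<longlonglongrightarrow> hnorm H (cl x)"
  unfolding hnorm_def gns_seminorm_def by (intro tendsto_intros inner_tendsto assms)

lemma hdist_tendsto:
  assumes "x \<in> Cau" "y \<in> Cau" shows "(\<lambda>n. q (x n - y n)) \<longlonglongrightarrow> hdist (cl x) (cl y)"
  using hnorm_tendsto[of "\<lambda>n. x n - y n"] assms by (simp add: scaleC_minus_one)

lemma inner_v: "x \<in> Cau \<Longrightarrow> (\<lambda>n. \<tau> (adj a * x n)) \<longlonglongrightarrow> hinner H (cl x) (v a)"
  using inner_tendsto[of x "\<lambda>_. a"] by simp

lemma inner_v_v: "hinner H (v a) (v b) = \<tau> (adj b * a)"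
  using inner_tendsto[of "\<lambda>_. a" "\<lambda>_. b"] by (simp add: LIMSEQ_const_iff)

lemma inner_cnj:
  assumes "X \<in> hcarrier H" "Y \<in> hcarrier H" shows "hinner H X Y = cnj (hinner H Y X)"
proof -
  obtain x y where xy: "x \<in> Cau" "X = cl x" "y \<in> Cau" "Y = cl y"
    using assms by (metis carrierE)
  have "(\<lambda>n. cnj (\<tau> (adj (x n) * y n))) \<longlonglongrightarrow> cnj (hinner H Y X)"
    using inner_tendsto[of y x] xy by (intro tendsto_intros) auto
  moreover have "(\<lambda>n. cnj (\<tau> (adj (x n) * y n))) \<longlonglongrightarrow> hinner H X Y"
    using inner_tendsto[of x y] xy by (simp add: adj_mult_cnj[symmetric])
  ultimately show ?thesis using LIMSEQ_unique by blast
qed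

lemma hscale_closed: "X \<in> hcarrier H \<Longrightarrow> hscale H c X \<in> hcarrier H"
  by (elim carrierE) simp

lemma hadd_closed: "X \<in> hcarrier H \<Longrightarrow> Y \<in> hcarrier H \<Longrightarrow> hadd H X Y \<in> hcarrier H"
  by (elim carrierE) simp

lemma hnorm_nonneg: "X \<in> hcarrier H \<Longrightarrow> 0 \<le> hnorm H X"
proof (elim carrierE)
  fix x assume "x \<in> Cau" "X = cl x"
  then show "0 \<le> hnorm H X" by (simp add: LIMSEQ_le_const[OF hnorm_tendsto])
qed

lemma hdist_nonneg: "X \<in> hcarrier H \<Longrightarrow> Y \<in> hcarrier H \<Longrightarrow> 0 \<le> hdist X Y"
  by (intro hnorm_nonneg hadd_closed hscale_closed)

lemma hdist_sym: "X \<in> hcarrier H \<Longrightarrow> Y \<in> hcarrier H \<Longrightarrow> hdist X Y = hdist Y X"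
proof (elim carrierE)
  fix x y assume "x \<in> Cau" "y \<in> Cau" "X = cl x" "Y = cl y"
  then show "hdist X Y = hdist Y X"
    using hdist_tendsto[of x y] hdist_tendsto[of y x] LIMSEQ_unique by (simp only: q_minus_commute) blast
qed

lemma hdist_triangle:
  "X \<in> hcarrier H \<Longrightarrow> Y \<in> hcarrier H \<Longrightarrow> Z \<in> hcarrier H \<Longrightarrow> hdist X Z \<le> hdist X Y + hdist Y Z"
proof (elim carrierE)
  fix x y z assume xyz: "x \<in> Cau" "y \<in> Cau" "z \<in> Cau" "X = cl x" "Y = cl y" "Z = cl z"
  show "hdist X Z \<le> hdist X Y + hdist Y Z"
    unfolding xyz(4-6)
    by (rule LIMSEQ_le[OF hdist_tendsto tendsto_add[OF hdist_tendsto hdist_tendsto]])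
       (use xyz q_triangle_diff in auto)
qed

lemma hnorm_v: "hnorm H (v a) = q a"
  using hnorm_tendsto[of "\<lambda>_. a"] by (simp add: LIMSEQ_const_iff)

lemma hdist_zero: "X \<in> hcarrier H \<Longrightarrow> hdist X (hzero H) = hnorm H X"
  by (elim carrierE) (simp add: hzero_eq)

lemma hdist_eq_0: "X \<in> hcarrier H \<Longrightarrow> Y \<in> hcarrier H \<Longrightarrow> hdist X Y = 0 \<longleftrightarrow> X = Y"
proof (elim carrierE)
  fix x y assume "x \<in> Cau" "y \<in> Cau" "X = cl x" "Y = cl y"
  then show "hdist X Y = 0 \<longleftrightarrow> X = Y"
    using hdist_tendsto[of x y] cl_eq_iff[of x y] LIMSEQ_unique by auto
qed

lemma inner_diff_bound:
  assumes "X \<in> hcarrier H" "Y \<in> hcarrier H"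
  shows "cmod (hinner H X (v a) - hinner H Y (v a)) \<le> hdist X Y * q a"
proof -
  obtain x y where xy: "x \<in> Cau" "X = cl x" "y \<in> Cau" "Y = cl y"
    using assms by (metis carrierE)
  have "cmod (\<tau> (adj a * x n) - \<tau> (adj a * y n)) \<le> q (x n - y n) * q a" for n
    using Cauchy_Schwarz[of a "x n - y n"] by (simp add: algebra_simps diff)
  then show ?thesis unfolding xy
    using xy by (intro LIMSEQ_le[OF tendsto_norm[OF tendsto_diff[OF inner_v inner_v]]
        tendsto_mult_right[OF hdist_tendsto]]) auto
qed

lemma v_dense:
  assumes "X \<in> hcarrier H" "e > 0" shows "\<exists>a. hdist X (v a) < e"
proof -
  obtain x where x: "x \<in> Cau" "X = cl x" using assms carrierE by blast
  obtain N where N: "\<forall>m\<ge>N. \<forall>n\<ge>N. q (x m - x n) < e / 2"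
    using CauD[OF x(1), of "e / 2"] assms by auto
  have "hdist X (v (x N)) \<le> e / 2"
    unfolding x(2) by (rule LIMSEQ_le_const2[OF hdist_tendsto]) (use x N in \<open>auto intro!: exI[of _ N] less_imp_le\<close>)
  then show ?thesis using assms by (intro exI[of _ "x N"]) simp
qed

text \<open>A vector orthogonal to the dense set of all \<open>v a\<close> is zero. For the
  difference z, the square of \<open>q (z n)\<close> splits into the pairings of \<open>z n\<close>
  with \<open>z n - z N\<close> and with \<open>z N\<close>: the first is small once
  \<open>N\<close> is large because z is Cauchy, the second tends to 0 as n grows by orthogonality
  to \<open>v (z N)\<close>.\<close>

lemma vector_eqI:
  assumes "X \<in> hcarrier H" "Y \<in> hcarrier H"
    and "\<And>a. hinner H X (v a) = hinner H Y (v a)"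
  shows "X = Y"
proof -
  obtain x y where xy: "x \<in> Cau" "X = cl x" "y \<in> Cau" "Y = cl y"
    using assms by (metis carrierE)
  define z where "z n = x n - y n" for n
  have z: "z \<in> Cau" unfolding z_def using xy by simp
  have z0: "(\<lambda>n. \<tau> (adj a * z n)) \<longlonglongrightarrow> 0" for a
    using tendsto_diff[OF inner_v[of x a] inner_v[of y a]] assms(3)[of a] xy
    by (simp add: z_def algebra_simps diff)
  have "(\<lambda>n. (q (z n))\<^sup>2) \<longlonglongrightarrow> 0"
  proof (rule LIMSEQ_I)
    fix e :: real assume e: "e > 0"
    obtain B where B: "B > 0" "\<And>n. q (z n) \<le> B"
      using convergent_imp_Bseq[OF convergent_q[OF z]] by (auto simp: Bseq_def)
    obtain N where N: "\<forall>m\<ge>N. \<forall>n\<ge>N. q (z m - z n) < e / (2 * B)"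
      using CauD[OF z, of "e / (2 * B)"] e B by auto
    obtain N' where N': "\<forall>n\<ge>N'. cmod (\<tau> (adj (z N) * z n)) < e / 2"
      using LIMSEQ_D[OF z0[of "z N"], of "e / 2"] e by auto
    have "norm ((q (z n))\<^sup>2 - 0) < e" if n: "n \<ge> max N N'" for n
    proof -
      have "complex_of_real ((q (z n))\<^sup>2) = \<tau> (adj (z n - z N) * z n) + \<tau> (adj (z N) * z n)"
        unfolding q_square_complex by (simp add: adj_diff algebra_simps diff)
      then have "norm ((q (z n))\<^sup>2) \<le> cmod (\<tau> (adj (z n - z N) * z n)) + cmod (\<tau> (adj (z N) * z n))"
        by (metis norm_of_real norm_triangle_ineq real_norm_def)
      also have "cmod (\<tau> (adj (z n - z N) * z n)) \<le> q (z n) * q (z n - z N)" by (rule Cauchy_Schwarz)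
      also have "\<dots> \<le> B * q (z n - z N)" using B by (intro mult_right_mono) auto
      also have "\<dots> < B * (e / (2 * B))" using B N n by (intro mult_strict_left_mono) auto
      also have "B * (e / (2 * B)) = e / 2" using B by simp
      finally show ?thesis using N' n by (auto simp: )
    qed
    then show "\<exists>no. \<forall>n\<ge>no. norm ((q (z n))\<^sup>2 - 0) < e" by blast
  qed
  then have "(\<lambda>n. sqrt ((q (z n))\<^sup>2)) \<longlonglongrightarrow> sqrt 0" by (intro tendsto_intros)
  then have "(\<lambda>n. q (z n)) \<longlonglongrightarrow> 0" by simp
  then show ?thesis using xy by (simp add: cl_eq_iff z_def)
qed

subsection \<open>Operators induced by maps of the algebra\<close>

text \<open>Acts termwise on the picked representative, exactly as \<open>gns_rep\<close> does, so
  that left and right multiplication are treated together.\<close>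

definition op_of :: "('a \<Rightarrow> 'a) \<Rightarrow> (nat \<Rightarrow> 'a) set \<Rightarrow> (nat \<Rightarrow> 'a) set" where
  "op_of F = (\<lambda>X\<in>hcarrier H. cl (\<lambda>n. F (gns_pick X n)))"

text \<open>Right multiplication is bounded in the seminorm because \<open>\<tau>\<close> is a trace
  (\<open>q_mult_right\<close>).\<close>

definition Rop :: "'a \<Rightarrow> (nat \<Rightarrow> 'a) set \<Rightarrow> (nat \<Rightarrow> 'a) set" where
  "Rop a = op_of (\<lambda>x. x * a)"

abbreviation Lop :: "'a \<Rightarrow> (nat \<Rightarrow> 'a) set \<Rightarrow> (nat \<Rightarrow> 'a) set" where
  "Lop \<equiv> gns_rep \<tau>"

lemma Lop_eq: "Lop a = op_of (\<lambda>x. a * x)"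
  by (simp add: op_of_def gns_rep_def)

lemma op_of_cl:
  assumes F: "\<And>x y. F (x - y) = F x - F y" "\<And>x. q (F x) \<le> K * q x" and x: "x \<in> Cau"
  shows "op_of F (cl x) = cl (\<lambda>n. F (x n))" "(\<lambda>n. F (x n)) \<in> Cau"
proof -
  have C: "(\<lambda>n. F (y n)) \<in> Cau" if "y \<in> Cau" for y
    by (rule Cau_le[OF that, of _ K]) (metis F)
  show "(\<lambda>n. F (x n)) \<in> Cau" using C x by blast
  have "(\<lambda>n. q (F (x n) - F (gns_pick (cl x) n))) \<longlonglongrightarrow> 0"
  proof (rule tendsto_sandwich[OF _ _ tendsto_const])
    show "(\<lambda>n. K * q (x n - gns_pick (cl x) n)) \<longlonglongrightarrow> 0"
      using tendsto_mult_left[OF pick_cl(2)[OF x], of K] by simp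
    show "\<forall>\<^sub>F n in sequentially. q (F (x n) - F (gns_pick (cl x) n)) \<le> K * q (x n - gns_pick (cl x) n)"
      using F by (metis (mono_tags, lifting) always_eventually)
  qed simp
  then show "op_of F (cl x) = cl (\<lambda>n. F (x n))"
    using x C pick_cl[OF x] by (simp add: op_of_def cl_eq_iff q_minus_commute)
qed

lemma op_of_bounded_ops:
  assumes F: "\<And>x y. F (x - y) = F x - F y" "\<And>x y. F (x + y) = F x + F y"
    "\<And>c x. F (c *\<^sub>C x) = c *\<^sub>C F x" "\<And>x. q (F x) \<le> K * q x"
  shows "op_of F \<in> bounded_ops H"
proof -
  note cl = op_of_cl[OF F(1) F(4)]
  have "op_of F \<in> hcarrier H \<rightarrow>\<^sub>E hcarrier H"
  proof (rule PiE_I)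
    show "op_of F X \<in> hcarrier H" if "X \<in> hcarrier H" for X
      using that by (elim carrierE) (simp add: cl)
  qed (simp add: op_of_def)
  moreover have "op_of F (hadd H X Y) = hadd H (op_of F X) (op_of F Y)"
    if "X \<in> hcarrier H" "Y \<in> hcarrier H" for X Y
    using that by (elim carrierE) (simp add: cl F)
  moreover have "op_of F (hscale H c X) = hscale H c (op_of F X)"
    if "X \<in> hcarrier H" for c X
    using that by (elim carrierE) (simp add: cl F)
  moreover have "hnorm H (op_of F X) \<le> K * hnorm H X" if "X \<in> hcarrier H" for X
    using that
  proof (elim carrierE)
    fix x assume x: "x \<in> Cau" "X = cl x"
    show ?thesis unfolding x(2) cl[OF x(1)]
      by (rule LIMSEQ_le[OF hnorm_tendsto tendsto_mult_left[OF hnorm_tendsto]]) (use x cl F in auto)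
  qed
  ultimately show ?thesis unfolding bounded_ops_def
    by (intro CollectI conjI ballI allI exI[of _ K])
qed

lemma Lop_cl [simp]: "x \<in> Cau \<Longrightarrow> Lop a (cl x) = cl (\<lambda>n. a * x n)"
  unfolding Lop_eq by (rule op_of_cl[where K = "norm a"]) (auto simp: right_diff_distrib q_mult_left)

lemma Rop_cl [simp]: "x \<in> Cau \<Longrightarrow> Rop a (cl x) = cl (\<lambda>n. x n * a)"
  unfolding Rop_def by (rule op_of_cl[where K = "norm a"]) (auto simp: left_diff_distrib q_mult_right)

lemma Lop_bounded: "Lop a \<in> bounded_ops H"
  unfolding Lop_eq by (rule op_of_bounded_ops[where K = "norm a"])
    (auto simp: algebra_simps q_mult_left mult_scaleC_right)

lemma Rop_bounded: "Rop a \<in> bounded_ops H"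
  unfolding Rop_def by (rule op_of_bounded_ops[where K = "norm a"])
    (auto simp: algebra_simps q_mult_right mult_scaleC_left)

section \<open>Bounded operators and their values on the dense vectors\<close>

lemma bounded_op_closed: "T \<in> bounded_ops H \<Longrightarrow> X \<in> hcarrier H \<Longrightarrow> T X \<in> hcarrier H"
  by (auto simp: bounded_ops_def)

lemma bounded_op_eqI:
  assumes "S \<in> bounded_ops H" "T \<in> bounded_ops H" "\<And>X. X \<in> hcarrier H \<Longrightarrow> S X = T X"
  shows "S = T"
  using assms PiE_ext[of S "hcarrier H" "\<lambda>_. hcarrier H" T] by (auto simp: bounded_ops_def)

lemma bounded_op_lipschitz:
  assumes "T \<in> bounded_ops H"
  obtains K where "K \<ge> 0" "\<And>X Y. X \<in> hcarrier H \<Longrightarrow> Y \<in> hcarrier H \<Longrightarrow> hdist (T X) (T Y) \<le> K * hdist X Y"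
proof -
  obtain K where K: "\<And>X. X \<in> hcarrier H \<Longrightarrow> hnorm H (T X) \<le> K * hnorm H X"
    using assms unfolding bounded_ops_def by blast
  \<comment> \<open>\<open>bounded_ops\<close> puts no sign condition on its constant, hence the
    absolute value.\<close>
  have "hdist (T X) (T Y) \<le> \<bar>K\<bar> * hdist X Y" if XY: "X \<in> hcarrier H" "Y \<in> hcarrier H" for X Y
  proof -
    have "hadd H (T X) (hscale H (- 1) (T Y)) = T (hadd H X (hscale H (- 1) Y))"
      using assms XY hscale_closed by (auto simp: bounded_ops_def)
    then have "hdist (T X) (T Y) \<le> K * hdist X Y"
      using K XY hscale_closed hadd_closed by metis
    also have "\<dots> \<le> \<bar>K\<bar> * hdist X Y" using hdist_nonneg[OF XY] by (intro mult_right_mono) auto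
    finally show ?thesis .
  qed
  then show ?thesis using that[of "\<bar>K\<bar>"] by simp
qed

lemma bounded_op_eq_on_v:
  assumes S: "S \<in> bounded_ops H" and T: "T \<in> bounded_ops H" and eq: "\<And>a. S (v a) = T (v a)"
  shows "S = T"
proof (rule bounded_op_eqI[OF S T])
  fix X assume X: "X \<in> hcarrier H"
  obtain K where K: "K \<ge> 0" "\<And>X Y. X \<in> hcarrier H \<Longrightarrow> Y \<in> hcarrier H \<Longrightarrow> hdist (S X) (S Y) \<le> K * hdist X Y"
    using bounded_op_lipschitz[OF S] by metis
  obtain K' where K': "K' \<ge> 0" "\<And>X Y. X \<in> hcarrier H \<Longrightarrow> Y \<in> hcarrier H \<Longrightarrow> hdist (T X) (T Y) \<le> K' * hdist X Y"
    using bounded_op_lipschitz[OF T] by metis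
  have "hdist (S X) (T X) \<le> 0 + e" if e: "e > 0" for e
  proof -
    \<comment> \<open>Both operators move X and \<open>v a\<close> apart by at most a Lipschitz
      factor; the summand 1 keeps the denominator positive when both factors vanish.\<close>
    obtain a where a: "hdist X (v a) < e / (K + K' + 1)"
      using v_dense[OF X, of "e / (K + K' + 1)"] e K(1) K'(1) by auto
    have c: "S X \<in> hcarrier H" "T X \<in> hcarrier H" "T (v a) \<in> hcarrier H" "v a \<in> hcarrier H"
      using bounded_op_closed[OF S] bounded_op_closed[OF T] X by auto
    have "hdist (S X) (T X) \<le> hdist (S X) (S (v a)) + hdist (T (v a)) (T X)"
      using hdist_triangle[OF c(1) c(3) c(2)] eq by simp
    also have "\<dots> \<le> K * hdist X (v a) + K' * hdist X (v a)"
      using K(2)[OF X c(4)] K'(2)[OF c(4) X] hdist_sym[OF c(4) X] by (intro add_mono) auto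
    also have "\<dots> \<le> (K + K' + 1) * hdist X (v a)"
      using hdist_nonneg[OF X c(4)] by (simp add: algebra_simps)
    also have "\<dots> \<le> e" using a K(1) K'(1) by (simp add: field_simps)
    finally show ?thesis by simp
  qed
  then have "hdist (S X) (T X) \<le> 0" by (rule field_le_epsilon)
  moreover have "S X \<in> hcarrier H" "T X \<in> hcarrier H"
    using bounded_op_closed[OF S X] bounded_op_closed[OF T X] by auto
  ultimately show "S X = T X" using hdist_nonneg hdist_eq_0 by (metis order_antisym)
qed

lemma op_comp_bounded:
  assumes S: "S \<in> bounded_ops H" and T: "T \<in> bounded_ops H"
  shows "op_comp H S T \<in> bounded_ops H"
proof -
  obtain K where K: "\<And>X. X \<in> hcarrier H \<Longrightarrow> hnorm H (S X) \<le> K * hnorm H X"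
    using S unfolding bounded_ops_def by blast
  obtain K' where K': "\<And>X. X \<in> hcarrier H \<Longrightarrow> hnorm H (T X) \<le> K' * hnorm H X"
    using T unfolding bounded_ops_def by blast
  have "hnorm H (op_comp H S T X) \<le> (\<bar>K\<bar> * \<bar>K'\<bar>) * hnorm H X" if X: "X \<in> hcarrier H" for X
  proof -
    have TX: "T X \<in> hcarrier H" using bounded_op_closed[OF T X] .
    have "hnorm H (S (T X)) \<le> K * hnorm H (T X)" by (rule K[OF TX])
    also have "\<dots> \<le> \<bar>K\<bar> * hnorm H (T X)" using hnorm_nonneg[OF TX] by (intro mult_right_mono) auto
    also have "\<dots> \<le> \<bar>K\<bar> * (K' * hnorm H X)" using K'[OF X] by (intro mult_left_mono) auto
    also have "\<dots> \<le> \<bar>K\<bar> * (\<bar>K'\<bar> * hnorm H X)" using hnorm_nonneg[OF X] by (intro mult_left_mono mult_right_mono) auto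
    finally show ?thesis using X by (simp add: compose_def mult.assoc)
  qed
  moreover have "op_comp H S T \<in> hcarrier H \<rightarrow>\<^sub>E hcarrier H"
    using bounded_op_closed[OF S] bounded_op_closed[OF T] by (auto simp: compose_def)
  ultimately show ?thesis
    using S T bounded_op_closed[OF T] hadd_closed hscale_closed
    by (auto simp: bounded_ops_def compose_def)
qed

lemma op_comp_apply: "X \<in> hcarrier H \<Longrightarrow> op_comp H S T X = S (T X)"
  by (simp add: compose_def)

text \<open>Associativity, (b x) a = b (x a). These are the elements of the commutant against which
  the double commutant is tested.\<close>

lemma Rop_commutant: "Rop a \<in> commutant H (range Lop)"
proof -
  have "op_comp H (Rop a) (Lop b) = op_comp H (Lop b) (Rop a)" for b
  proof (rule bounded_op_eqI)
    show "op_comp H (Rop a) (Lop b) X = op_comp H (Lop b) (Rop a) X" if "X \<in> hcarrier H" for X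
      using that by (elim carrierE) (simp add: op_comp_apply mult.assoc)
  qed (intro op_comp_bounded Rop_bounded Lop_bounded)+
  then show ?thesis by (auto simp: commutant_def Rop_bounded)
qed

section \<open>The double commutant and the cyclic vector\<close>

abbreviation M :: "((nat \<Rightarrow> 'a) set \<Rightarrow> (nat \<Rightarrow> 'a) set) set" where "M \<equiv> gns_vN \<tau>"

lemma M_bounded: "T \<in> M \<Longrightarrow> T \<in> bounded_ops H"
  by (simp add: gns_vN_def commutant_def)

lemma Lop_M: "Lop a \<in> M"
  by (auto simp: gns_vN_def commutant_def Lop_bounded)

lemma M_Rop:
  assumes "T \<in> M" "X \<in> hcarrier H" shows "T (Rop a X) = Rop a (T X)"
proof -
  have "op_comp H T (Rop a) = op_comp H (Rop a) T"
    using assms Rop_commutant by (auto simp: gns_vN_def commutant_def[of "gns_space \<tau>" "commutant _ _"])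
  then show ?thesis using assms by (metis op_comp_apply)
qed

text \<open>Since \<open>v a\<close> is the right translate of the cyclic vector \<open>v 1\<close>
  by a, an element of the double commutant can be recovered from its value at
  \<open>v 1\<close>.\<close>

lemma M_v: "T \<in> M \<Longrightarrow> T (v a) = Rop a (T (v 1))"
  using M_Rop[of T "v 1" a] by simp

lemma op_id_eq: "op_id H = Lop 1"
proof (rule extensionalityI[where A = "hcarrier H"])
  show "op_id H X = Lop 1 X" if "X \<in> hcarrier H" for X
    using that by (elim carrierE) (simp add: op_id_def)
qed (simp_all add: op_id_def gns_rep_def)

lemma op_zero_eq: "op_zero H = Lop 0"
proof (rule extensionalityI[where A = "hcarrier H"])
  show "op_zero H X = Lop 0 X" if "X \<in> hcarrier H" for X
    using that by (elim carrierE) (simp add: op_zero_def hzero_eq)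
qed (simp_all add: op_zero_def gns_rep_def)

lemma v_eq_iff: "v a = v b \<longleftrightarrow> q (a - b) = 0"
  by (simp add: cl_eq_iff LIMSEQ_const_iff)

end

section \<open>Type criteria for the trace representation\<close>

context tracial_state
begin

section \<open>Left multiplications as operators\<close>

lemma op_comp_Lop: "op_comp H (Lop a) (Lop b) = Lop (a * b)"
proof (rule bounded_op_eq_on_v)
  show "op_comp H (Lop a) (Lop b) (v c) = Lop (a * b) (v c)" for c
    by (simp add: op_comp_apply mult.assoc)
qed (intro op_comp_bounded Lop_bounded)+

lemma op_add_Lop: "op_add H (Lop a) (Lop b) = Lop (a + b)"
proof (rule extensionalityI[where A = "hcarrier H"])
  show "op_add H (Lop a) (Lop b) X = Lop (a + b) X" if "X \<in> hcarrier H" for X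
    using that by (elim carrierE) (simp add: op_add_def distrib_right)
qed (simp_all add: op_add_def gns_rep_def)

lemma op_scale_id: "op_scale H c (op_id H) = Lop (c *\<^sub>C 1)"
proof (rule extensionalityI[where A = "hcarrier H"])
  show "op_scale H c (op_id H) X = Lop (c *\<^sub>C 1) X" if "X \<in> hcarrier H" for X
    using that by (elim carrierE) (simp add: op_scale_def op_id_def mult_scaleC_left)
qed (simp_all add: op_scale_def gns_rep_def)

lemma Lop_scale: "X \<in> hcarrier H \<Longrightarrow> Lop (c *\<^sub>C 1) X = hscale H c X"
  by (elim carrierE) (simp add: mult_scaleC_left)

text \<open>The null space of the trace seminorm is stable under right multiplication, so left
  multiplications by equivalent elements agree on every \<open>v c\<close>.\<close>

lemma Lop_cong:
  assumes "q (a - b) = 0" shows "Lop a = Lop b"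
proof (rule bounded_op_eq_on_v)
  fix c
  have "q (a * c - b * c) \<le> norm c * q (a - b)"
    using q_mult_right[of "a - b" c] by (simp add: left_diff_distrib)
  then have "q (a * c - b * c) = 0" using assms q_nonneg[of "a * c - b * c"] by simp
  then show "Lop a (v c) = Lop b (v c)" by (simp add: v_eq_iff)
qed (rule Lop_bounded)+

lemma Lop_adjoint: "is_adjoint H (Lop a) (Lop (adj a))"
  unfolding is_adjoint_def
proof (intro ballI)
  fix X Y assume "X \<in> hcarrier H" "Y \<in> hcarrier H"
  then obtain x y where xy: "x \<in> Cau" "X = cl x" "y \<in> Cau" "Y = cl y" by (metis carrierE)
  have "(\<lambda>n. \<tau> (adj (y n) * (a * x n))) \<longlonglongrightarrow> hinner H (Lop a X) Y"
    using inner_tendsto[of "\<lambda>n. a * x n" y] xy by simp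
  moreover have "(\<lambda>n. \<tau> (adj (y n) * (a * x n))) \<longlonglongrightarrow> hinner H X (Lop (adj a) Y)"
    using inner_tendsto[of x "\<lambda>n. adj a * y n"] xy by (simp add: adj_mult adj_adj mult.assoc)
  ultimately show "hinner H (Lop a X) Y = hinner H X (Lop (adj a) Y)" by (rule LIMSEQ_unique)
qed

lemma op_id_neq_zero: "op_id H \<noteq> op_zero H"
proof
  assume "op_id H = op_zero H"
  then have "Lop 1 (v 1) = Lop 0 (v 1)" by (simp add: op_id_eq op_zero_eq)
  then show False by (simp add: v_eq_iff)
qed

text \<open>If \<open>T\<close> is central in the von Neumann algebra then \<open>a \<mapsto> \<langle>a T\<xi>, \<xi>\<rangle>\<close> is a trace functional,
  so uniqueness of such functionals forces \<open>T\<xi>\<close>, hence \<open>T\<close>, to be scalar.\<close>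

lemma is_factorI:
  assumes uniq: "\<And>\<psi>::'a \<Rightarrow> complex. bounded_linear \<psi> \<Longrightarrow> (\<And>c x. \<psi> (c *\<^sub>C x) = c * \<psi> x) \<Longrightarrow>
      (\<And>x y. \<psi> (x * y) = \<psi> (y * x)) \<Longrightarrow> \<exists>C. \<forall>x. cmod (\<psi> x) \<le> C * q x \<Longrightarrow>
      \<exists>c. \<forall>x. \<psi> x = c * \<tau> x"
  shows "is_factor H M"
  unfolding is_factor_def
proof (intro conjI op_id_neq_zero equalityI subsetI)
  fix T assume "T \<in> range (\<lambda>c. op_scale H c (op_id H))"
  then obtain c where T: "T = Lop (c *\<^sub>C 1)" by (auto simp: op_scale_id)
  have "op_comp H T S = op_comp H S T" if S: "S \<in> M" for S
  proof (rule bounded_op_eqI)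
    have Sb: "S \<in> bounded_ops H" using M_bounded[OF S] .
    fix X assume X: "X \<in> hcarrier H"
    have "S (hscale H c X) = hscale H c (S X)" using Sb X by (simp add: bounded_ops_def)
    then show "op_comp H T S X = op_comp H S T X"
      using X bounded_op_closed[OF Sb X] by (simp add: op_comp_apply T Lop_scale)
  qed (use M_bounded[OF S] T Lop_bounded in \<open>auto intro!: op_comp_bounded\<close>)
  then show "T \<in> M \<inter> commutant H M"
    by (auto simp: commutant_def T Lop_M Lop_bounded)
next
  fix T assume "T \<in> M \<inter> commutant H M"
  then have TM: "T \<in> M" and TC: "T \<in> commutant H M" by auto
  have Tb: "T \<in> bounded_ops H" using M_bounded[OF TM] .
  obtain x where x: "x \<in> Cau" "T (v 1) = cl x"
    using bounded_op_closed[OF Tb, of "v 1"] by (auto elim: carrierE)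
  \<comment> \<open>Two expressions for T (v a): \<open>T\<close> commutes with left multiplication
    by a because it lies in the commutant of \<open>M\<close>, and with right multiplication by a
    because it lies in \<open>M\<close>.\<close>
  have central: "cl (\<lambda>n. a * x n) = cl (\<lambda>n. x n * a)" for a
  proof -
    have "op_comp H T (Lop a) = op_comp H (Lop a) T"
      using TC Lop_M by (auto simp: commutant_def)
    then have "T (Lop a (v 1)) = Lop a (T (v 1))" by (metis op_comp_apply cl_carrier Cau_const)
    then show ?thesis using M_v[OF TM, of a] x by simp
  qed
  \<comment> \<open>This is the pairing of a T xi with xi, with a moved to the other side of the
    inner product.\<close>
  define \<psi> where "\<psi> a = hinner H (cl x) (v (adj a))" for a
  have lim: "(\<lambda>n. \<tau> (a * x n)) \<longlonglongrightarrow> \<psi> a" for a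
    using inner_v[OF x(1), of "adj a"] by (simp add: \<psi>_def adj_adj)
  have add\<psi>: "\<psi> (a + b) = \<psi> a + \<psi> b" for a b
    using LIMSEQ_unique[OF lim[of "a + b"]] tendsto_add[OF lim[of a] lim[of b]]
    by (simp add: distrib_right add)
  have scale\<psi>: "\<psi> (c *\<^sub>C a) = c * \<psi> a" for a c
    using LIMSEQ_unique[OF lim[of "c *\<^sub>C a"]] tendsto_mult_left[OF lim[of a], of c]
    by (simp add: mult_scaleC_left scaleC)
  have tr\<psi>: "\<psi> (a * b) = \<psi> (b * a)" for a b
  proof -
    have "(\<lambda>n. \<tau> (b * (a * x n))) \<longlonglongrightarrow> hinner H (cl (\<lambda>n. a * x n)) (v (adj b))"
      using inner_v[of "\<lambda>n. a * x n" "adj b"] x by (simp add: adj_adj)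
    then have "\<psi> (b * a) = hinner H (cl (\<lambda>n. a * x n)) (v (adj b))"
      using LIMSEQ_unique[OF lim[of "b * a"]] by (simp add: mult.assoc)
    moreover have "(\<lambda>n. \<tau> (b * (x n * a))) \<longlonglongrightarrow> hinner H (cl (\<lambda>n. x n * a)) (v (adj b))"
      using inner_v[of "\<lambda>n. x n * a" "adj b"] x by (simp add: adj_adj)
    moreover have "\<tau> (b * (x n * a)) = \<tau> (a * b * x n)" for n
      using commute[of "b * x n" a] by (simp add: mult.assoc)
    ultimately show ?thesis
      using LIMSEQ_unique[OF lim[of "a * b"]] central by simp
  qed
  \<comment> \<open>The norm of T xi, written as a distance to 0 so that
    \<open>inner_diff_bound\<close> applies.\<close>
  define C where "C = hdist (cl x) (v 0)"
  have C: "C \<ge> 0" unfolding C_def using x by (intro hdist_nonneg) auto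
  have bd: "cmod (\<psi> a) \<le> C * q a" for a
    using inner_diff_bound[of "cl x" "v 0" "adj a"] x(1)
    by (simp add: \<psi>_def C_def inner_v_v zero q_adj)
  have "bounded_linear \<psi>"
  proof (rule bounded_linear_intro)
    show "\<psi> (r *\<^sub>R a) = r *\<^sub>R \<psi> a" for r a
      using scale\<psi>[of "complex_of_real r" a] by (simp add: scaleC_of_real scaleR_conv_of_real)
    show "norm (\<psi> a) \<le> norm a * C" for a
      using bd[of a] mult_left_mono[OF q_le_norm[of a] C] by (simp add: mult.commute)
  qed (rule add\<psi>)
  then obtain c where c: "\<And>a. \<psi> a = c * \<tau> a"
    using uniq[of \<psi>] scale\<psi> tr\<psi> bd by blast
  have x1: "cl x = v (c *\<^sub>C 1)"
  proof (rule vector_eqI)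
    show "hinner H (cl x) (v a) = hinner H (v (c *\<^sub>C 1)) (v a)" for a
      using c[of "adj a"] by (simp add: \<psi>_def adj_adj inner_v_v mult_scaleC_right scaleC)
  qed (use x in auto)
  have "T = Lop (c *\<^sub>C 1)"
  proof (rule bounded_op_eq_on_v[OF Tb Lop_bounded])
    show "T (v a) = Lop (c *\<^sub>C 1) (v a)" for a
      using M_v[OF TM, of a] x x1 by (simp add: mult_scaleC_left)
  qed
  then show "T \<in> range (\<lambda>c. op_scale H c (op_id H))" by (auto simp: op_scale_id)
qed

text \<open>Hence \<open>\<parallel>V\<xi>\<parallel> = \<parallel>W\<xi>\<parallel>\<close>, which is the trace property on \<open>M\<close>.\<close>

lemma adjoint_vector:
  assumes "V \<in> M" "W \<in> M" "is_adjoint H V W" "x \<in> Cau" "V (v 1) = cl x"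
  shows "W (v 1) = cl (\<lambda>n. adj (x n))"
proof (rule vector_eqI)
  show W1: "W (v 1) \<in> hcarrier H" using bounded_op_closed[OF M_bounded[OF assms(2)]] by simp
  fix a
  have "hinner H (V (v a)) (v 1) = hinner H (v a) (W (v 1))"
    using assms(3) by (simp add: is_adjoint_def)
  then have "hinner H (W (v 1)) (v a) = cnj (hinner H (V (v a)) (v 1))"
    using inner_cnj[OF W1, of "v a"] by simp
  also have "V (v a) = cl (\<lambda>n. x n * a)" using M_v[OF assms(1)] assms(4,5) by simp
  finally have eq: "hinner H (W (v 1)) (v a) = cnj (hinner H (cl (\<lambda>n. x n * a)) (v 1))" .
  have "(\<lambda>n. cnj (\<tau> (adj 1 * (x n * a)))) \<longlonglongrightarrow> cnj (hinner H (cl (\<lambda>n. x n * a)) (v 1))"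
    using assms(4) by (intro tendsto_cnj inner_v) auto
  moreover have "cnj (\<tau> (adj 1 * (x n * a))) = \<tau> (adj a * adj (x n))" for n
    by (simp add: adj_cnj[symmetric] adj_mult)
  ultimately show "hinner H (W (v 1)) (v a) = hinner H (cl (\<lambda>n. adj (x n))) (v a)"
    unfolding eq using inner_v[of "\<lambda>n. adj (x n)" a] assms(4) LIMSEQ_unique by auto
qed (use assms in auto)

lemma op_id_projection: "op_id H \<in> projections H M"
  using Lop_adjoint[of 1] by (simp add: projections_def op_id_eq Lop_M op_comp_Lop)

text \<open>If W V = 1 and V W = Q, then the pairing of Q xi with xi is the squared norm of W xi,
  which equals that of V xi, namely 1. So the projection Q fixes the unit vector xi, hence all right
  translates of xi, and these are dense.\<close>

lemma finite_projection_id: "finite_projection H M (op_id H)"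
  unfolding finite_projection_def
proof (intro conjI ballI impI op_id_projection)
  fix Q assume Q: "Q \<in> projections H M"
  assume "op_comp H (op_id H) Q = Q \<and> mvn_equiv H M (op_id H) Q"
  then obtain V W where VW: "V \<in> M" "W \<in> M" "is_adjoint H V W" "op_comp H W V = op_id H"
    "op_comp H V W = Q" by (auto simp: mvn_equiv_def)
  have QM: "Q \<in> M" "op_comp H Q Q = Q" "is_adjoint H Q Q" using Q by (auto simp: projections_def)
  have Vc: "V (v 1) \<in> hcarrier H" and Wc: "W (v 1) \<in> hcarrier H" and Qc: "Q (v 1) \<in> hcarrier H"
    using bounded_op_closed[OF M_bounded] VW QM by auto
  obtain x where x: "x \<in> Cau" "V (v 1) = cl x" using Vc carrierE by blast
  have W1: "W (v 1) = cl (\<lambda>n. adj (x n))" by (rule adjoint_vector[OF VW(1-3) x])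
  have "hinner H (V (v 1)) (V (v 1)) = hinner H (v 1) (W (V (v 1)))"
    using VW(3) Vc by (simp add: is_adjoint_def)
  also have "W (V (v 1)) = v 1"
    using fun_cong[OF VW(4), of "v 1"] by (simp add: op_comp_apply op_id_def)
  finally have V1: "hinner H (V (v 1)) (V (v 1)) = 1" by (simp add: inner_v_v)
  have "hinner H (Q (v 1)) (v 1) = hinner H (V (W (v 1))) (v 1)"
    using fun_cong[OF VW(5), of "v 1"] by (simp add: op_comp_apply)
  also have "\<dots> = hinner H (W (v 1)) (W (v 1))"
    using VW(3) Wc by (simp add: is_adjoint_def)
  also have "\<dots> = hinner H (V (v 1)) (V (v 1))"
    unfolding W1 x(2)
    using inner_tendsto[of x x] inner_tendsto[of "\<lambda>n. adj (x n)" "\<lambda>n. adj (x n)"] x(1)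
    by (simp add: adj_adj commute[of "x _"]) (metis LIMSEQ_unique)
  finally have Q1: "hinner H (Q (v 1)) (v 1) = 1" by (simp add: V1)
  have "Q (Q (v 1)) = Q (v 1)"
    using fun_cong[OF QM(2), of "v 1"] by (simp add: op_comp_apply)
  then have QQ: "hinner H (Q (v 1)) (Q (v 1)) = 1"
    using QM(3) Qc Q1 by (simp add: is_adjoint_def)
  obtain z where z: "z \<in> Cau" "Q (v 1) = cl z" using Qc carrierE by blast
  have a: "(\<lambda>n. \<tau> (z n)) \<longlonglongrightarrow> 1" using inner_v[OF z(1), of 1] Q1 z by simp
  have b: "(\<lambda>n. \<tau> (adj (z n) * z n)) \<longlonglongrightarrow> 1" using inner_tendsto[OF z(1) z(1)] QQ z by simp
  \<comment> \<open>The squared distance of Q xi from xi, expanded: each of the four terms has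
    modulus tending to 1, and the signs cancel.\<close>
  have "(\<lambda>n. \<tau> (adj (z n) * z n) - cnj (\<tau> (z n)) - \<tau> (z n) + 1) \<longlonglongrightarrow> 1 - cnj 1 - 1 + 1"
    by (intro tendsto_intros a b)
  moreover have "\<tau> (adj (z n) * z n) - cnj (\<tau> (z n)) - \<tau> (z n) + 1
      = \<tau> (adj (z n - 1) * (z n - 1))" for n
    by (simp add: adj_diff algebra_simps diff add adj_cnj)
  ultimately have "(\<lambda>n. \<tau> (adj (z n - 1) * (z n - 1))) \<longlonglongrightarrow> 0" by simp
  then have "(\<lambda>n. sqrt (Re (\<tau> (adj (z n - 1) * (z n - 1))))) \<longlonglongrightarrow> sqrt (Re 0)"
    by (intro tendsto_intros)
  then have "Q (v 1) = v 1" using z by (simp add: cl_eq_iff gns_seminorm_def)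
  then have Qv: "Q (v a) = Lop 1 (v a)" for a using M_v[OF QM(1), of a] by simp
  show "Q = op_id H"
    unfolding op_id_eq by (rule bounded_op_eq_on_v[OF M_bounded[OF QM(1)] Lop_bounded Qv])
qed

section \<open>Absence of abelian projections\<close>

lemma hdist_Lop: "X \<in> hcarrier H \<Longrightarrow> Y \<in> hcarrier H \<Longrightarrow> hdist (Lop a X) (Lop a Y) \<le> norm a * hdist X Y"
  and hdist_Rop: "X \<in> hcarrier H \<Longrightarrow> Y \<in> hcarrier H \<Longrightarrow> hdist (Rop a X) (Rop a Y) \<le> norm a * hdist X Y"
proof -
  assume "X \<in> hcarrier H" "Y \<in> hcarrier H"
  then obtain x y where xy: "x \<in> Cau" "X = cl x" "y \<in> Cau" "Y = cl y" by (metis carrierE)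
  have lim: "(\<lambda>n. norm a * q (x n - y n)) \<longlonglongrightarrow> norm a * hdist X Y"
    using tendsto_mult_left[OF hdist_tendsto[of x y]] xy by simp
  have "(\<lambda>n. q (a * x n - a * y n)) \<longlonglongrightarrow> hdist (Lop a X) (Lop a Y)"
    using hdist_tendsto[of "\<lambda>n. a * x n" "\<lambda>n. a * y n"] xy by simp
  then show "hdist (Lop a X) (Lop a Y) \<le> norm a * hdist X Y"
    by (rule LIMSEQ_le[OF _ lim]) (auto simp: right_diff_distrib[symmetric] q_mult_left)
  have "(\<lambda>n. q (x n * a - y n * a)) \<longlonglongrightarrow> hdist (Rop a X) (Rop a Y)"
    using hdist_tendsto[of "\<lambda>n. x n * a" "\<lambda>n. y n * a"] xy by simp
  then show "hdist (Rop a X) (Rop a Y) \<le> norm a * hdist X Y"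
    by (rule LIMSEQ_le[OF _ lim]) (auto simp: left_diff_distrib[symmetric] q_mult_right)
qed

lemma Rop_Rop: "X \<in> hcarrier H \<Longrightarrow> Rop a (Rop b X) = Rop (b * a) X"
  by (elim carrierE) (simp add: mult.assoc)

lemma Lop_Rop: "X \<in> hcarrier H \<Longrightarrow> Lop a (Rop b X) = Rop b (Lop a X)"
  by (elim carrierE) (simp add: mult.assoc)

lemma Lop_closed: "X \<in> hcarrier H \<Longrightarrow> Lop a X \<in> hcarrier H"
  and Rop_closed: "X \<in> hcarrier H \<Longrightarrow> Rop a X \<in> hcarrier H"
  using bounded_op_closed[OF Lop_bounded] bounded_op_closed[OF Rop_bounded] by auto

lemma hdist_v: "hdist (v a) (v b) = q (a - b)"
  using hdist_tendsto[of "\<lambda>_. a" "\<lambda>_. b"] by (simp add: LIMSEQ_const_iff)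

text \<open>Since \<open>P\<xi>\<close> is close to \<open>b\<xi>\<close>, left multiplication by \<open>w\<close> may be replaced on it by right
  multiplication, which commutes with \<open>P\<close>.\<close>

lemma compressed_product_close:
  assumes P: "P \<in> M" "op_comp H P P = P"
    and K: "K \<ge> 0" "\<And>X Y. X \<in> hcarrier H \<Longrightarrow> Y \<in> hcarrier H \<Longrightarrow> hdist (P X) (P Y) \<le> K * hdist X Y"
    and w: "norm w1 \<le> 1" "norm w2 \<le> 1" "w1 * b = b * w1" "w2 * b = b * w2"
    and b: "hdist (P (v 1)) (v b) < e"
  shows "hdist (P (Lop w1 (P (Lop w2 (P (v 1)))))) (Rop (w1 * w2) (P (v 1))) \<le> (K * K + K) * (2 * e)"
proof -
  define \<eta> where "\<eta> = P (v 1)"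
  note Pc = bounded_op_closed[OF M_bounded[OF P(1)]]
  have \<eta>: "\<eta> \<in> hcarrier H" unfolding \<eta>_def by (rule Pc) simp
  have P\<eta>: "P \<eta> = \<eta>" unfolding \<eta>_def using fun_cong[OF P(2), of "v 1"] by (simp add: op_comp_apply)
  \<comment> \<open>\<open>P\<close> commutes with right multiplications and fixes
    \<open>\<eta>\<close>, so it fixes every right translate of \<open>\<eta>\<close>.\<close>
  have PR: "P (Rop a \<eta>) = Rop a \<eta>" for a using M_Rop[OF P(1) \<eta>] P\<eta> by simp
  have comm: "hdist (Lop w \<eta>) (Rop w \<eta>) \<le> 2 * e" if "norm w \<le> 1" "w * b = b * w" for w
  proof -
    have vb: "Lop w (v b) = Rop w (v b)" using that by simp
    have "hdist (Lop w \<eta>) (Rop w \<eta>) \<le> hdist (Lop w \<eta>) (Lop w (v b)) + hdist (Rop w (v b)) (Rop w \<eta>)"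
      using hdist_triangle[of "Lop w \<eta>" "Lop w (v b)" "Rop w \<eta>"] \<eta> Lop_closed Rop_closed vb by simp
    also have "hdist (Lop w \<eta>) (Lop w (v b)) \<le> norm w * hdist \<eta> (v b)"
      by (rule hdist_Lop) (use \<eta> in auto)
    also have "\<dots> \<le> 1 * hdist \<eta> (v b)"
      by (intro mult_right_mono that hdist_nonneg \<eta> cl_carrier Cau_const)
    also have "hdist (Rop w (v b)) (Rop w \<eta>) \<le> norm w * hdist (v b) \<eta>"
      by (rule hdist_Rop) (use \<eta> in auto)
    also have "\<dots> \<le> 1 * hdist (v b) \<eta>"
      by (intro mult_right_mono that hdist_nonneg \<eta> cl_carrier Cau_const)
    also have "hdist (v b) \<eta> = hdist \<eta> (v b)" using \<eta> by (intro hdist_sym) auto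
    finally show ?thesis using b by (simp add: \<eta>_def)
  qed
  have c1: "Lop w2 \<eta> \<in> hcarrier H" "Rop w2 \<eta> \<in> hcarrier H" "Lop w1 \<eta> \<in> hcarrier H" "Rop w1 \<eta> \<in> hcarrier H"
    using \<eta> Lop_closed Rop_closed by auto
  note c = c1 Pc[OF c1(1)] Pc[OF c1(2)] Pc[OF c1(3)] Pc[OF c1(4)]
  have e0: "0 \<le> 2 * e" using b hdist_nonneg[OF \<eta>, of "v b"] by (simp add: \<eta>_def)
  \<comment> \<open>Replacing the inner left multiplication costs K * K, since the error passes
    through \<open>P\<close> twice; replacing the outer one, in \<open>3\<close>, costs K.\<close>
  have 1: "hdist (P (Lop w1 (P (Lop w2 \<eta>)))) (P (Lop w1 (P (Rop w2 \<eta>)))) \<le> K * K * (2 * e)"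
  proof -
    have "hdist (P (Lop w1 (P (Lop w2 \<eta>)))) (P (Lop w1 (P (Rop w2 \<eta>))))
        \<le> K * hdist (Lop w1 (P (Lop w2 \<eta>))) (Lop w1 (P (Rop w2 \<eta>)))"
      by (rule K) (intro Lop_closed c)+
    also have "\<dots> \<le> K * (norm w1 * hdist (P (Lop w2 \<eta>)) (P (Rop w2 \<eta>)))"
      by (intro mult_left_mono hdist_Lop c K)
    also have "\<dots> \<le> K * (1 * (K * hdist (Lop w2 \<eta>) (Rop w2 \<eta>)))"
      by (intro mult_left_mono mult_mono K c w hdist_nonneg) auto
    also have "\<dots> \<le> K * (1 * (K * (2 * e)))"
      by (intro mult_left_mono comm K w) auto
    finally show ?thesis by simp
  qed
  have 2: "P (Lop w1 (P (Rop w2 \<eta>))) = Rop w2 (P (Lop w1 \<eta>))"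
    using PR M_Rop[OF P(1) c(3)] Lop_Rop[OF \<eta>] by simp
  have 3: "hdist (Rop w2 (P (Lop w1 \<eta>))) (Rop (w1 * w2) \<eta>) \<le> K * (2 * e)"
  proof -
    have "hdist (Rop w2 (P (Lop w1 \<eta>))) (Rop (w1 * w2) \<eta>)
       = hdist (Rop w2 (P (Lop w1 \<eta>))) (Rop w2 (P (Rop w1 \<eta>)))"
      using PR Rop_Rop[OF \<eta>] by simp
    also have "\<dots> \<le> norm w2 * hdist (P (Lop w1 \<eta>)) (P (Rop w1 \<eta>))" by (intro hdist_Rop c)
    also have "\<dots> \<le> 1 * (K * hdist (Lop w1 \<eta>) (Rop w1 \<eta>))"
      by (intro mult_mono K c w hdist_nonneg) auto
    also have "\<dots> \<le> 1 * (K * (2 * e))" by (intro mult_left_mono comm K w) auto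
    finally show ?thesis by simp
  qed
  have "hdist (P (Lop w1 (P (Lop w2 \<eta>)))) (Rop (w1 * w2) \<eta>)
     \<le> hdist (P (Lop w1 (P (Lop w2 \<eta>)))) (P (Lop w1 (P (Rop w2 \<eta>))))
      + hdist (P (Lop w1 (P (Rop w2 \<eta>)))) (Rop (w1 * w2) \<eta>)"
    by (rule hdist_triangle) (intro Pc Lop_closed Rop_closed c \<eta>)+
  then show ?thesis using 1 2 3 by (simp add: \<eta>_def algebra_simps)
qed

text \<open>Put \<open>\<eta>\<close> = P xi, f = \<open>u * adj u\<close> and g =
  \<open>adj u * u\<close>, so that g f = 0. Commutativity of the corner makes the right translates
  of \<open>\<eta>\<close> by f and by g nearly equal; a further right multiplication by f shows
  that the translate by f is nearly zero. But \<open>\<eta>\<close> is close to \<open>v b\<close>,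
  and b f has half the seminorm of b because f has relative trace 1/4. So \<open>\<eta>\<close> is
  arbitrarily small.\<close>

lemma abelian_projection_eq_zero:
  assumes central: "\<And>x e. e > 0 \<Longrightarrow> \<exists>b u. q (x - b) < e \<and> u * u = 0 \<and>
      (u * adj u) * (u * adj u) = u * adj u \<and> u * b = b * u \<and> adj u * b = b * adj u \<and>
      \<tau> (adj b * b * (u * adj u)) = \<tau> (adj b * b) / 4"
    and "abelian_projection H M P"
  shows "P = op_zero H"
proof -
  have P: "P \<in> M" "op_comp H P P = P"
    using assms(2) by (auto simp: abelian_projection_def projections_def)
  have ab: "op_comp H (op_comp H P (op_comp H S P)) (op_comp H P (op_comp H T P))
      = op_comp H (op_comp H P (op_comp H T P)) (op_comp H P (op_comp H S P))"
    if "S \<in> M" "T \<in> M" for S T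
    using assms(2) that by (auto simp: abelian_projection_def Let_def)
  have Pb: "P \<in> bounded_ops H" using M_bounded[OF P(1)] .
  note Pc = bounded_op_closed[OF Pb]
  obtain K where K: "K \<ge> 0" "\<And>X Y. X \<in> hcarrier H \<Longrightarrow> Y \<in> hcarrier H \<Longrightarrow> hdist (P X) (P Y) \<le> K * hdist X Y"
    using bounded_op_lipschitz[OF Pb] by metis
  define \<eta> where "\<eta> = P (v 1)"
  have \<eta>: "\<eta> \<in> hcarrier H" unfolding \<eta>_def by (rule Pc) simp
  have PP: "P (P X) = P X" if "X \<in> hcarrier H" for X
    using fun_cong[OF P(2), of X] that by (simp add: op_comp_apply)
  define D where "D = K * K + K"
  have D: "D \<ge> 0" using K by (simp add: D_def)
  \<comment> \<open>Each compressed product is off by 2 D e, so the two translates differ by at most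
    4 D e; passing from b f back to b doubles this to 8 D e. The 3 collects the distances between
    \<open>\<eta>\<close> and \<open>v b\<close>, one of them doubled as well.\<close>
  have small: "hnorm H \<eta> \<le> (3 + 8 * D) * e" if e: "e > 0" for e
  proof -
    obtain a where a: "hdist \<eta> (v a) < e / 2" using v_dense[OF \<eta>, of "e / 2"] e by auto
    obtain b u where bu: "q (a - b) < e / 2" "u * u = 0" "(u * adj u) * (u * adj u) = u * adj u"
      "u * b = b * u" "adj u * b = b * adj u" "\<tau> (adj b * b * (u * adj u)) = \<tau> (adj b * b) / 4"
      using central[of "e / 2" a] e by auto
    have \<eta>b: "hdist \<eta> (v b) < e"
      using hdist_triangle[OF \<eta>, of "v a" "v b"] a bu(1) hdist_v[of a b]
      by (simp del: hscale_cl hadd_cl)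
    have nu: "norm u \<le> 1" "norm (adj u) \<le> 1" using norm_partial_isometry_le_1[OF bu(3)] by auto
    define f where "f = u * adj u"
    define g where "g = adj u * u"
    have nf: "norm f \<le> 1"
      unfolding f_def using norm_mult_ineq[of u "adj u"] nu mult_mono[OF nu] by simp
    have ff: "f * f = f" using bu(3) by (simp add: f_def)
    have gf: "g * f = 0"
    proof -
      have "g * f = adj u * (u * u) * adj u" unfolding f_def g_def by (simp only: mult.assoc)
      then show ?thesis by (simp add: bu(2))
    qed
    have af: "adj f = f" by (simp add: f_def adj_mult adj_adj)
    let ?A = "P (Lop u (P (Lop (adj u) \<eta>)))"
    let ?B = "P (Lop (adj u) (P (Lop u \<eta>)))"
    have AB: "?A = ?B"
    proof -
      have c: "Lop w \<eta> \<in> hcarrier H" for w by (rule Lop_closed[OF \<eta>])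
      have cc: "P X \<in> hcarrier H" "Lop w (P X) \<in> hcarrier H" if "X \<in> hcarrier H" for X w
        using Pc that Lop_closed by auto
      show ?thesis
        using fun_cong[OF ab[OF Lop_M Lop_M, of u "adj u"], of "v 1"] c cc
        by (simp add: compose_def \<eta>_def[symmetric] PP)
    qed
    have Ac: "?A \<in> hcarrier H" by (intro Pc Lop_closed \<eta>)
    have 1: "hdist ?A (Rop f \<eta>) \<le> D * (2 * e)"
      unfolding f_def D_def \<eta>_def
      by (rule compressed_product_close[OF P K(1) K(2) nu bu(4,5)]) (use \<eta>b in \<open>simp_all add: \<eta>_def\<close>)
    have 2: "hdist ?A (Rop g \<eta>) \<le> D * (2 * e)"
      unfolding AB unfolding g_def D_def \<eta>_def
      by (rule compressed_product_close[OF P K(1) K(2) nu(2,1) bu(5,4)]) (use \<eta>b in \<open>simp_all add: \<eta>_def\<close>)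
    have c: "Rop f \<eta> \<in> hcarrier H" "Rop g \<eta> \<in> hcarrier H" using Rop_closed[OF \<eta>] by auto
    have fg: "hdist (Rop f \<eta>) (Rop g \<eta>) \<le> 4 * D * e"
      using hdist_triangle[OF c(1) Ac c(2)] hdist_sym[OF c(1) Ac] 1 2 by simp
    have "Rop f (Rop f \<eta>) = Rop f \<eta>" "Rop f (Rop g \<eta>) = hzero H"
    proof -
      show "Rop f (Rop f \<eta>) = Rop f \<eta>" using Rop_Rop[OF \<eta>] ff by simp
      have "Rop 0 \<eta> = hzero H" using \<eta> by (elim carrierE) (simp add: hzero_eq)
      then show "Rop f (Rop g \<eta>) = hzero H" using Rop_Rop[OF \<eta>] gf by simp
    qed
    then have "hnorm H (Rop f \<eta>) \<le> norm f * hdist (Rop f \<eta>) (Rop g \<eta>)"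
      using hdist_Rop[OF c, of f] hdist_zero[OF c(1)] by simp
    also have "\<dots> \<le> 1 * hdist (Rop f \<eta>) (Rop g \<eta>)"
      using nf hdist_nonneg[OF c] by (intro mult_right_mono) auto
    finally have Rf: "hnorm H (Rop f \<eta>) \<le> 4 * D * e" using fg by simp
    have qb: "q (b * f) = q b / 2"
    proof -
      have "\<tau> (adj (b * f) * (b * f)) = \<tau> (adj b * b * f)"
        using commute[of f "adj b * b * f"] ff by (simp add: adj_mult af mult.assoc)
      then have "\<tau> (adj (b * f) * (b * f)) = \<tau> (adj b * b) / 4" using bu(6) by (simp add: f_def)
      then have "Re (\<tau> (adj (b * f) * (b * f))) = Re (\<tau> (adj b * b)) / 4"
        by (simp only: Re_divide_numeral)
      then have "(q (b * f))\<^sup>2 = (q b / 2)\<^sup>2"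
        unfolding q_square power_divide by (simp add: q_square)
      then show ?thesis by (simp add: power2_eq_iff_nonneg)
    qed
    have z: "hzero H \<in> hcarrier H" by (simp add: hzero_eq)
    have "q b / 2 = hdist (v (b * f)) (hzero H)" using hdist_v[of "b * f" 0] qb by (simp only: hzero_eq diff_0_right)
    also have "\<dots> \<le> hdist (v (b * f)) (Rop f \<eta>) + hdist (Rop f \<eta>) (hzero H)"
      by (rule hdist_triangle) (use c z in auto)
    also have "hdist (v (b * f)) (Rop f \<eta>) \<le> norm f * hdist (v b) \<eta>"
      using hdist_Rop[of "v b" \<eta> f] \<eta> by simp
    also have "\<dots> \<le> 1 * hdist (v b) \<eta>"
      by (intro mult_right_mono nf hdist_nonneg \<eta> cl_carrier Cau_const)
    also have "hdist (Rop f \<eta>) (hzero H) = hnorm H (Rop f \<eta>)" by (rule hdist_zero[OF c(1)])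
    also have "hdist (v b) \<eta> = hdist \<eta> (v b)" using \<eta> by (intro hdist_sym) auto
    finally have "q b \<le> 2 * e + 8 * D * e" using \<eta>b Rf by simp
    moreover have "hnorm H \<eta> \<le> hdist \<eta> (v b) + q b"
      using hdist_triangle[OF \<eta>, of "v b" "hzero H"] z hdist_zero[OF \<eta>] hdist_zero[of "v b"] hnorm_v[of b]
      by (simp del: hscale_cl hadd_cl)
    ultimately show ?thesis using \<eta>b by (simp add: algebra_simps)
  qed
  have "hnorm H \<eta> \<le> 0 + e" if "e > 0" for e
    using small[of "e / (3 + 8 * D)"] that D by simp
  then have "hnorm H \<eta> \<le> 0" by (rule field_le_epsilon)
  then have "hdist \<eta> (hzero H) = 0" using hnorm_nonneg[OF \<eta>] hdist_zero[OF \<eta>] by simp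
  then have "\<eta> = v 0" using hdist_eq_0[OF \<eta>, of "hzero H"] by (simp add: hzero_eq)
  then have Pv: "P (v a) = Lop 0 (v a)" for a using M_v[OF P(1), of a] by (simp add: \<eta>_def)
  show ?thesis
    unfolding op_zero_eq by (rule bounded_op_eq_on_v[OF Pb Lop_bounded Pv])
qed

section \<open>Type I from matrix units\<close>

lemma foldr_op_add_Lop:
  "foldr (op_add H) (map (\<lambda>r. Lop (f r)) xs) (op_zero H) = Lop (sum_list (map f xs))"
  by (induction xs) (auto simp: op_zero_eq op_add_Lop)

text \<open>By \<open>complete\<close> the GNS space consists of the vectors \<open>v a\<close>
  alone, so each element of \<open>M\<close> is a left multiplication, and the corner at
  \<open>u r r\<close> is scalar. The relations \<open>one\<close> and \<open>corner\<close> are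
  stated modulo null elements because the matrix units add up to 1 only in the quotient by the
  kernel of the trace.\<close>

lemma factor_type_I_matrix_units:
  fixes u :: "nat \<Rightarrow> nat \<Rightarrow> 'a"
  assumes fac: "is_factor H M"
    and complete: "\<And>x. x \<in> Cau \<Longrightarrow> \<exists>a. cl x = v a"
    and mult: "\<And>r s s' t. r < n \<Longrightarrow> s < n \<Longrightarrow> s' < n \<Longrightarrow> t < n \<Longrightarrow>
        u r s * u s' t = (if s = s' then u r t else 0)"
    and adju: "\<And>r s. r < n \<Longrightarrow> s < n \<Longrightarrow> adj (u r s) = u s r"
    and one: "q ((\<Sum>r<n. u r r) - 1) = 0"
    and corner: "\<And>r a. r < n \<Longrightarrow> \<exists>c. q (u r r * (a * u r r) - c *\<^sub>C u r r) = 0"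
  shows "factor_type_I H M n"
proof -
  have M_Lop: "\<exists>a. T = Lop a" if T: "T \<in> M" for T
  proof -
    have "T (v 1) \<in> hcarrier H" using bounded_op_closed[OF M_bounded[OF T]] by simp
    then obtain a where a: "T (v 1) = v a" using complete by (metis carrierE)
    have "T = Lop a"
    proof (rule bounded_op_eq_on_v[OF M_bounded[OF T] Lop_bounded])
      show "T (v b) = Lop a (v b)" for b using M_v[OF T, of b] a by simp
    qed
    then show ?thesis ..
  qed
  have proj: "Lop (u r r) \<in> projections H M" if "r < n" for r
    using Lop_adjoint[of "u r r"] mult[of r r r r] adju[of r r] that
    by (simp add: projections_def Lop_M op_comp_Lop)
  have abel: "abelian_projection H M (Lop (u r r))" if r: "r < n" for r
    unfolding abelian_projection_def
  proof (intro conjI proj r ballI)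
    fix S T assume "S \<in> M" "T \<in> M"
    then obtain a b where ab: "S = Lop a" "T = Lop b" using M_Lop by blast
    obtain c where "q (u r r * (a * u r r) - c *\<^sub>C u r r) = 0" using corner[OF r] by blast
    then have c: "Lop (u r r * (a * u r r)) = Lop (c *\<^sub>C u r r)" by (rule Lop_cong)
    obtain d where "q (u r r * (b * u r r) - d *\<^sub>C u r r) = 0" using corner[OF r] by blast
    then have d: "Lop (u r r * (b * u r r)) = Lop (d *\<^sub>C u r r)" by (rule Lop_cong)
    show "let S' = op_comp H (Lop (u r r)) (op_comp H S (Lop (u r r)));
            T' = op_comp H (Lop (u r r)) (op_comp H T (Lop (u r r)))
        in op_comp H S' T' = op_comp H T' S'"
      unfolding Let_def ab op_comp_Lop c d
      by (simp add: mult_scaleC_left mult_scaleC_right scaleC_scaleC mult.commute[of c d])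
  qed
  have mvn: "mvn_equiv H M (Lop (u i i)) (Lop (u j j))" if "i < n" "j < n" for i j
    unfolding mvn_equiv_def
  proof (intro bexI conjI)
    show "is_adjoint H (Lop (u j i)) (Lop (u i j))"
      using Lop_adjoint[of "u j i"] adju that by simp
    show "op_comp H (Lop (u i j)) (Lop (u j i)) = Lop (u i i)"
      "op_comp H (Lop (u j i)) (Lop (u i j)) = Lop (u j j)"
      using mult that by (simp_all add: op_comp_Lop)
  qed (rule Lop_M)+
  let ?Ps = "map (\<lambda>r. Lop (u r r)) [0..<n]"
  have "foldr (op_add H) ?Ps (op_zero H) = Lop (\<Sum>r<n. u r r)"
    by (simp only: foldr_op_add_Lop interv_sum_list_conv_sum_set_nat set_upt atLeast0LessThan)
  also have "\<dots> = op_id H" unfolding op_id_eq by (rule Lop_cong[OF one])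
  finally have sum: "foldr (op_add H) ?Ps (op_zero H) = op_id H" .
  show ?thesis unfolding factor_type_I_def
  proof (intro conjI fac exI[of _ ?Ps])
    show "\<forall>i<n. \<forall>j<n. i \<noteq> j \<longrightarrow> op_comp H (?Ps ! i) (?Ps ! j) = op_zero H"
      using mult by (simp add: op_comp_Lop op_zero_eq)
  qed (use abel mvn sum in auto)
qed

text \<open>Type I writes the identity as a sum of abelian projections; in type II_1 these all
  vanish, whereas the identity does not, the trace being 1 at 1.\<close>

lemma factor_type_I_not_II1:
  assumes "factor_type_I H M n" shows "\<not> factor_type_II1 H M"
proof
  assume II: "factor_type_II1 H M"
  obtain Ps where Ps: "\<forall>P\<in>set Ps. abelian_projection H M P" "foldr (op_add H) Ps (op_zero H) = op_id H"
    using assms by (auto simp: factor_type_I_def)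
  have "\<forall>P\<in>set Ps. P = op_zero H" using Ps II by (auto simp: factor_type_II1_def)
  then have "foldr (op_add H) Ps (op_zero H) = op_zero H"
    by (induction Ps) (auto simp: op_zero_eq op_add_Lop)
  then show False using Ps op_id_neq_zero by simp
qed

end

section \<open>Matrices\<close>

lemma mat_adjoint_carrier [simp]: "A \<in> carrier_mat n m \<Longrightarrow> mat_adjoint A \<in> carrier_mat m n"
  by (auto simp: mat_adjoint_def)

lemma mat_adjoint_index [simp]:
  "i < dim_col A \<Longrightarrow> j < dim_row A \<Longrightarrow> mat_adjoint A $$ (i, j) = cnj (A $$ (j, i))"
  by (simp add: mat_adjoint_def mat_of_rows_def conjugate_complex_def)

lemma mat_adjoint_dim [simp]: "dim_row (mat_adjoint A) = dim_col A" "dim_col (mat_adjoint A) = dim_row A"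
  by (auto simp: mat_adjoint_def)

lemma mat_trace_smult: "A \<in> carrier_mat n n \<Longrightarrow> mat_trace (c \<cdot>\<^sub>m A) = c * mat_trace A"
  by (auto simp: mat_trace_def sum_distrib_left)

lemma mat_mult_index:
  "A \<in> carrier_mat n m \<Longrightarrow> B \<in> carrier_mat m l \<Longrightarrow> i < n \<Longrightarrow> j < l \<Longrightarrow>
    (A * B) $$ (i, j) = (\<Sum>k<m. A $$ (i, k) * B $$ (k, j))"
  by (auto simp: scalar_prod_def atLeast0LessThan)

lemma mat_trace_comm:
  assumes "A \<in> carrier_mat n n" "B \<in> carrier_mat n n" shows "mat_trace (A * B) = mat_trace (B * A)"
proof -
  have "mat_trace (A * B) = (\<Sum>i<n. \<Sum>k<n. A $$ (i, k) * B $$ (k, i))"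
    using assms by (auto simp: mat_trace_def mat_mult_index[OF assms] simp del: index_mult_mat(1))
  also have "\<dots> = (\<Sum>k<n. \<Sum>i<n. B $$ (k, i) * A $$ (i, k))"
    by (subst sum.swap) (simp add: mult.commute)
  also have "\<dots> = mat_trace (B * A)"
    using assms by (auto simp: mat_trace_def mat_mult_index[OF assms(2,1)] simp del: index_mult_mat(1))
  finally show ?thesis .
qed

lemma mat_trace_one: "mat_trace (1\<^sub>m n) = of_nat n"
  by (simp add: mat_trace_def)

text \<open>The squared Hilbert-Schmidt norm. It gives positivity of the matrix trace and control of
  single entries.\<close>

lemma mat_trace_adjoint_mult:
  assumes "A \<in> carrier_mat n n"
  shows "mat_trace (mat_adjoint A * A) = complex_of_real (\<Sum>i<n. \<Sum>k<n. (cmod (A $$ (k, i)))\<^sup>2)"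
proof -
  have "mat_trace (mat_adjoint A * A) = (\<Sum>i<n. \<Sum>k<n. cnj (A $$ (k, i)) * A $$ (k, i))"
    using assms mat_mult_index[OF mat_adjoint_carrier[OF assms] assms]
    by (auto simp: mat_trace_def simp del: index_mult_mat(1))
  also have "\<dots> = (\<Sum>i<n. \<Sum>k<n. complex_of_real ((cmod (A $$ (k, i)))\<^sup>2))"
    by (intro sum.cong refl) (simp only: complex_norm_square mult.commute)
  finally show ?thesis by simp
qed

lemma entry_square_le_sum:
  fixes A :: "complex mat"
  assumes "r < n" "s < n"
  shows "(cmod (A $$ (r, s)))\<^sup>2 \<le> (\<Sum>i<n. \<Sum>k<n. (cmod (A $$ (k, i)))\<^sup>2)"
proof -
  have "(cmod (A $$ (r, s)))\<^sup>2 \<le> (\<Sum>k<n. (cmod (A $$ (k, s)))\<^sup>2)"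
    using assms member_le_sum[of r "{..<n}" "\<lambda>k. (cmod (A $$ (k, s)))\<^sup>2"] by simp
  also have "\<dots> \<le> (\<Sum>i<n. \<Sum>k<n. (cmod (A $$ (k, i)))\<^sup>2)"
    using assms member_le_sum[of s "{..<n}" "\<lambda>i. \<Sum>k<n. (cmod (A $$ (k, i)))\<^sup>2"]
    by (simp add: sum_nonneg)
  finally show ?thesis .
qed

lemma sum_add_lessThan: "(\<Sum>i<m + n. f i) = (\<Sum>i<m. f i) + (\<Sum>i<(n::nat). f (m + i))"
  for f :: "nat \<Rightarrow> 'a::comm_monoid_add"
  by (induction n) (auto simp: add.assoc)

lemma mat_trace_four_block:
  assumes "square_mat A" "square_mat D"
  shows "mat_trace (four_block_mat A B C D) = mat_trace A + mat_trace D"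
  using assms by (simp add: mat_trace_def sum_add_lessThan)

lemma mat_trace_diag_block:
  "\<forall>A\<in>set As. square_mat A \<Longrightarrow> mat_trace (diag_block_mat As) = sum_list (map mat_trace As)"
proof (induction As)
  case (Cons A As)
  then have "square_mat (diag_block_mat As)" by (intro diag_block_mat_square) auto
  then show ?case using Cons by (simp add: Let_def mat_trace_four_block)
qed (simp add: mat_trace_def)

section \<open>Matrix units\<close>

definition emat :: "nat \<Rightarrow> nat \<Rightarrow> nat \<Rightarrow> complex mat" where
  "emat n r s = mat n n (\<lambda>p. if p = (r, s) then 1 else 0)"

lemma emat_carrier [simp]: "emat n r s \<in> carrier_mat n n"
  and emat_index [simp]: "i < n \<Longrightarrow> j < n \<Longrightarrow> emat n r s $$ (i, j) = (if i = r \<and> j = s then 1 else 0)"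
  and emat_dim [simp]: "dim_row (emat n r s) = n" "dim_col (emat n r s) = n"
  by (auto simp: emat_def)

lemma emat_mult:
  assumes "r < n" "s < n" "s' < n" "t < n"
  shows "emat n r s * emat n s' t = (if s = s' then emat n r t else 0\<^sub>m n n)"
proof (rule eq_matI)
  fix i j assume "i < dim_row (if s = s' then emat n r t else 0\<^sub>m n n)"
    "j < dim_col (if s = s' then emat n r t else 0\<^sub>m n n)"
  then have ij: "i < n" "j < n" by (auto split: if_splits)
  have "(emat n r s * emat n s' t) $$ (i, j) = (\<Sum>k<n. emat n r s $$ (i, k) * emat n s' t $$ (k, j))"
    by (rule mat_mult_index[OF emat_carrier emat_carrier ij])
  also have "\<dots> = (\<Sum>k<n. (if k = s then (if i = r \<and> k = s' \<and> j = t then 1 else 0) else 0))"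
    using ij by (intro sum.cong refl) auto
  also have "\<dots> = (if i = r \<and> s = s' \<and> j = t then 1 else 0)"
    using assms by (subst sum.delta) auto
  finally show "(emat n r s * emat n s' t) $$ (i, j) = (if s = s' then emat n r t else 0\<^sub>m n n) $$ (i, j)"
    using ij by simp
qed (auto split: if_splits)

lemma emat_adjoint: "mat_adjoint (emat n r s) = emat n s r"
  by (rule eq_matI) auto

lemma emat_corner:
  assumes X: "X \<in> carrier_mat n n" and r: "r < n"
  shows "emat n r r * (X * emat n r r) = (X $$ (r, r)) \<cdot>\<^sub>m emat n r r"
proof (rule eq_matI)
  fix i j assume "i < dim_row ((X $$ (r, r)) \<cdot>\<^sub>m emat n r r)" "j < dim_col ((X $$ (r, r)) \<cdot>\<^sub>m emat n r r)"
  then have ij: "i < n" "j < n" by auto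
  have XE: "(X * emat n r r) $$ (k, j) = (if j = r then X $$ (k, r) else 0)" if "k < n" for k
  proof -
    have "(X * emat n r r) $$ (k, j) = (\<Sum>l<n. X $$ (k, l) * emat n r r $$ (l, j))"
      by (rule mat_mult_index[OF X emat_carrier that ij(2)])
    also have "\<dots> = (\<Sum>l<n. if l = r then (if j = r then X $$ (k, l) else 0) else 0)"
      using ij by (intro sum.cong refl) auto
    finally have "(X * emat n r r) $$ (k, j) = \<dots>" .
    then show ?thesis using r by (simp add: sum.delta)
  qed
  have "(emat n r r * (X * emat n r r)) $$ (i, j)
      = (\<Sum>k<n. emat n r r $$ (i, k) * (X * emat n r r) $$ (k, j))"
    by (rule mat_mult_index[OF emat_carrier mult_carrier_mat[OF X emat_carrier] ij])
  also have "\<dots> = (\<Sum>k<n. if k = r then (if i = r \<and> j = r then X $$ (k, r) else 0) else 0)"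
    using ij XE by (intro sum.cong refl) auto
  also have "\<dots> = (if i = r \<and> j = r then X $$ (r, r) else 0)"
    using r by (subst sum.delta) auto
  finally show "(emat n r r * (X * emat n r r)) $$ (i, j) = ((X $$ (r, r)) \<cdot>\<^sub>m emat n r r) $$ (i, j)"
    using ij by simp
qed (use assms in auto)

section \<open>The operator norm dominates the entries\<close>

lemma vec_l2norm_eq: "vec_l2norm w = sqrt (\<Sum>i<dim_vec w. (cmod (vec_index w i))\<^sup>2)"
proof -
  have "Re (w \<bullet>c w) = (\<Sum>i<dim_vec w. (cmod (vec_index w i))\<^sup>2)"
    by (simp add: scalar_prod_def atLeast0LessThan conjugate_complex_def cmod_power2)
       (simp add: power2_eq_square)
  then show ?thesis by (simp add: vec_l2norm_def)
qed

lemma vec_l2norm_ge: "i < dim_vec w \<Longrightarrow> cmod (vec_index w i) \<le> vec_l2norm w"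
  unfolding vec_l2norm_eq
  by (rule real_le_rsqrt) (rule member_le_sum[of i "{..<dim_vec w}" "\<lambda>i. (cmod (vec_index w i))\<^sup>2"], auto)

lemma entry_le_opnorm:
  assumes A: "A \<in> carrier_mat n m" and rs: "r < n" "s < m"
  shows "cmod (A $$ (r, s)) \<le> mat_opnorm A"
proof -
  let ?S = "{vec_l2norm (A *\<^sub>v v) | v. v \<in> carrier_vec (dim_col A) \<and> vec_l2norm v \<le> 1}"
  \<comment> \<open>A real \<open>Sup\<close> bounds its elements only if the set is bounded.
    Coordinates of a vector in the unit ball have modulus at most 1, so row sums give a crude
    bound.\<close>
  have bdd: "bdd_above ?S"
  proof (rule bdd_aboveI)
    fix z assume "z \<in> ?S"
    then obtain v where v: "z = vec_l2norm (A *\<^sub>v v)" "v \<in> carrier_vec m" "vec_l2norm v \<le> 1"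
      using A by auto
    have vi: "cmod (vec_index v j) \<le> 1" if "j < m" for j
      using vec_l2norm_ge[of j v] v that by auto
    have "cmod (vec_index (A *\<^sub>v v) i) \<le> (\<Sum>j<m. cmod (A $$ (i, j)))" if i: "i < n" for i
    proof -
      have "vec_index (A *\<^sub>v v) i = (\<Sum>j<m. A $$ (i, j) * vec_index v j)"
        using A v i by (auto simp: scalar_prod_def atLeast0LessThan)
      also have "cmod \<dots> \<le> (\<Sum>j<m. cmod (A $$ (i, j) * vec_index v j))" by (rule norm_sum)
      also have "\<dots> \<le> (\<Sum>j<m. cmod (A $$ (i, j)))"
        using vi by (intro sum_mono) (auto simp: norm_mult intro!: mult_left_le)
      finally show ?thesis .
    qed
    then show "z \<le> sqrt (\<Sum>i<n. (\<Sum>j<m. cmod (A $$ (i, j)))\<^sup>2)"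
      unfolding v(1) vec_l2norm_eq using A by (intro real_sqrt_le_mono) (auto intro!: sum_mono power_mono)
  qed
  have u: "vec_l2norm (unit_vec m s) \<le> 1"
  proof -
    have "(\<Sum>i<m. (cmod (vec_index (unit_vec m s) i))\<^sup>2) = (\<Sum>i<m. if i = s then 1 else 0)"
      using rs by (intro sum.cong) auto
    also have "\<dots> = 1" using rs by simp
    finally show ?thesis by (simp add: vec_l2norm_eq)
  qed
  have "cmod (A $$ (r, s)) = cmod (vec_index (A *\<^sub>v unit_vec m s) r)"
    using A rs scalar_prod_right_unit[of s m "row A r"] by simp
  also have "\<dots> \<le> vec_l2norm (A *\<^sub>v unit_vec m s)" using A rs by (intro vec_l2norm_ge) auto
  also have "\<dots> \<le> mat_opnorm A"
    unfolding mat_opnorm_def using u A by (intro cSup_upper[OF _ bdd]) (auto intro!: exI[of _ "unit_vec m s"])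
  finally show ?thesis .
qed

lemma entry_le_ms_norm:
  assumes "j < length as" "as ! j \<in> carrier_mat n m" "r < n" "s < m"
  shows "cmod (as ! j $$ (r, s)) \<le> ms_norm as"
proof -
  have "mat_opnorm (as ! j) \<le> ms_norm as"
    unfolding ms_norm_def using assms(1) by (intro Max_ge) auto
  then show ?thesis using entry_le_opnorm[OF assms(2-4)] by linarith
qed

section \<open>Automatic continuity of representations on matrices\<close>

text \<open>Neumann series: l - h = l (1 - z) with z = h / l of norm below 1, and the partial sums
  of the z^n (1 - z) telescope to 1.\<close>

lemma left_inverse_resolvent:
  fixes h :: "'a::unital_cstar_algebra"
  assumes "norm h < cmod l"
  shows "\<exists>y. y * (l *\<^sub>C 1 - h) = 1"
proof -
  have l: "l \<noteq> 0" using assms by (metis norm_not_less_zero norm_zero)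
  define z where "z = inverse l *\<^sub>C h"
  have "norm z = norm h / cmod l"
    by (simp add: z_def norm_scaleC norm_inverse divide_inverse mult.commute)
  then have nz: "norm z < 1" using assms l by (simp add: divide_less_eq)
  have sm: "summable (\<lambda>n. z ^ n)"
    by (rule summable_comparison_test[OF _ summable_geometric[of "norm z"]]) (use nz norm_power_ineq in auto)
  have "(\<lambda>n. z ^ n - z ^ Suc n) sums (z ^ 0 - 0)"
    by (rule telescope_sums'[OF summable_LIMSEQ_zero[OF sm]])
  then have "(\<lambda>n. z ^ n * (1 - z)) sums 1" by (simp add: right_diff_distrib power_commutes)
  moreover have "(\<lambda>n. z ^ n * (1 - z)) sums ((\<Sum>n. z ^ n) * (1 - z))"
    using sums_mult2[OF summable_sums[OF sm]] .
  ultimately have S: "(\<Sum>n. z ^ n) * (1 - z) = 1" by (rule sums_unique2[symmetric])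
  have "l *\<^sub>C 1 - h = l *\<^sub>C (1 - z)"
    using l by (simp add: z_def scaleC_diff_right scaleC_scaleC)
  then have "(inverse l *\<^sub>C (\<Sum>n. z ^ n)) * (l *\<^sub>C 1 - h) = 1"
    using S l by (simp add: mult_scaleC_left mult_scaleC_right scaleC_scaleC)
  then show ?thesis by blast
qed

lemma smult_mat_mult_vec:
  fixes A :: "complex mat"
  assumes "A \<in> carrier_mat n m" "w \<in> carrier_vec m"
  shows "(c \<cdot>\<^sub>m A) *\<^sub>v w = c \<cdot>\<^sub>v (A *\<^sub>v w)"
  using assms by (intro eq_vecI) (auto simp: scalar_prod_def sum_distrib_left mult.assoc)

text \<open>Surjectivity supplies unitality: for a preimage y of the identity matrix, p y = p 1 * p
  y.\<close>

lemma surj_star_hom_mat_one: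
  assumes "surj_star_hom_mat d p" shows "p 1 = 1\<^sub>m d"
proof -
  have "1\<^sub>m d \<in> range p" using assms by (simp add: surj_star_hom_mat_def)
  then obtain y where y: "p y = 1\<^sub>m d" by auto
  have c: "p 1 \<in> carrier_mat d d" using assms by (auto simp: surj_star_hom_mat_def)
  have "p (1 * y) = p 1 * p y" using assms unfolding surj_star_hom_mat_def by blast
  then show ?thesis using y c by simp
qed

text \<open>The spectrum of \<open>p (x\<^sup>* x)\<close> lies in that of \<open>x\<^sup>* x\<close>; its trace is the sum of at most \<open>d\<close>
  eigenvalues and also the sum of the squared moduli of the entries of \<open>p x\<close>.\<close>

lemma surj_star_hom_mat_bound:
  fixes p :: "'a::unital_cstar_algebra \<Rightarrow> complex mat"
  assumes p: "surj_star_hom_mat d p"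
  shows "(\<Sum>i<d. \<Sum>k<d. (cmod (p x $$ (k, i)))\<^sup>2) \<le> real d * (norm x)\<^sup>2"
proof -
  have pc: "p y \<in> carrier_mat d d" for y using p by (auto simp: surj_star_hom_mat_def)
  have padd: "p (y + z) = p y + p z" and pscale: "p (c *\<^sub>C y) = c \<cdot>\<^sub>m p y"
    and pmult: "p (y * z) = p y * p z" and padj: "p (adj y) = mat_adjoint (p y)" for y z c
    using p by (auto simp: surj_star_hom_mat_def)
  define h where "h = adj x * x"
  \<comment> \<open>For larger l the element l - h has a left inverse y, and an eigenvector would be
    annihilated by the image of l - h, which has the left inverse \<open>p y\<close>.\<close>
  have eig: "cmod l \<le> norm h" if l: "eigenvalue (p h) l" for l
  proof (rule ccontr)
    assume "\<not> cmod l \<le> norm h"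
    then obtain y where y: "y * (l *\<^sub>C 1 - h) = 1" using left_inverse_resolvent[of h l] by auto
    obtain w where w: "w \<in> carrier_vec d" "w \<noteq> 0\<^sub>v d" "p h *\<^sub>v w = l \<cdot>\<^sub>v w"
      using l pc[of h] by (auto simp: eigenvalue_def eigenvector_def)
    \<comment> \<open>Rewritten as a sum, the form in which additivity and homogeneity of
      \<open>p\<close> apply.\<close>
    have "y * (l *\<^sub>C 1 + (-1) *\<^sub>C h) = 1" using y by (simp add: scaleC_minus_one)
    then have e: "p y * (l \<cdot>\<^sub>m 1\<^sub>m d + (-1) \<cdot>\<^sub>m p h) = 1\<^sub>m d"
      using pmult[of y "l *\<^sub>C 1 + (-1) *\<^sub>C h"]
      by (simp add: padd pscale surj_star_hom_mat_one[OF p])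
    have "(l \<cdot>\<^sub>m 1\<^sub>m d + (-1) \<cdot>\<^sub>m p h) *\<^sub>v w = 0\<^sub>v d"
    proof -
      have "(l \<cdot>\<^sub>m 1\<^sub>m d + (-1) \<cdot>\<^sub>m p h) *\<^sub>v w = (l \<cdot>\<^sub>m 1\<^sub>m d) *\<^sub>v w + ((-1) \<cdot>\<^sub>m p h) *\<^sub>v w"
        using w pc by (intro add_mult_distrib_mat_vec[of _ d d]) auto
      also have "\<dots> = l \<cdot>\<^sub>v (1\<^sub>m d *\<^sub>v w) + (-1) \<cdot>\<^sub>v (p h *\<^sub>v w)"
        using w pc smult_mat_mult_vec[of "1\<^sub>m d" d d w l] smult_mat_mult_vec[of "p h" d d w "-1"]
        by simp
      also have "\<dots> = 0\<^sub>v d" using w by (intro eq_vecI) auto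
      finally show ?thesis .
    qed
    then have "p y *\<^sub>v ((l \<cdot>\<^sub>m 1\<^sub>m d + (-1) \<cdot>\<^sub>m p h) *\<^sub>v w) = 0\<^sub>v d"
      using pc[of y] by auto
    moreover have "(p y * (l \<cdot>\<^sub>m 1\<^sub>m d + (-1) \<cdot>\<^sub>m p h)) *\<^sub>v w
        = p y *\<^sub>v ((l \<cdot>\<^sub>m 1\<^sub>m d + (-1) \<cdot>\<^sub>m p h) *\<^sub>v w)"
      using pc w by (intro assoc_mult_mat_vec[of _ d d _ d]) auto
    ultimately have "w = 0\<^sub>v d" using e w by simp
    then show False using w by simp
  qed
  \<comment> \<open>Over the complex numbers the characteristic polynomial splits, and Schur
    triangularization identifies the trace with the sum of its roots.\<close>
  obtain es where es: "char_poly (p h) = (\<Prod>a\<leftarrow>es. [:- a, 1:])" "length es = d"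
    using char_poly_factorized[OF pc[of h]] by auto
  obtain B P Q where BPQ: "schur_decomposition (p h) es = (B, P, Q)" by (metis prod_cases3)
  have sw: "similar_mat_wit (p h) B P Q" and dB: "diag_mat B = es"
    using schur_decomposition[OF pc es(1) BPQ] by auto
  note S = similar_mat_witD2[OF pc sw]
  have "mat_trace (p h) = mat_trace (P * B * Q)" using S by simp
  also have "\<dots> = mat_trace (Q * (P * B))" using S by (intro mat_trace_comm[of _ d]) auto
  also have "Q * (P * B) = B" using S assoc_mult_mat[of Q d d P d B d] by simp
  also have "mat_trace B = sum_list es"
    using S dB[symmetric] by (simp add: mat_trace_def diag_mat_def interv_sum_list_conv_sum_set_nat atLeast0LessThan)
  finally have tr: "mat_trace (p h) = sum_list es" .
  have "cmod l \<le> norm h" if "l \<in> set es" for l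
  proof -
    have "poly (char_poly (p h)) l = 0"
      unfolding es(1) using that by (simp add: poly_prod_list prod_list_zero_iff image_iff)
    then show ?thesis using eig eigenvalue_root_char_poly[OF pc[of h]] by blast
  qed
  then have sl: "cmod (sum_list xs) \<le> real (length xs) * norm h" if "set xs \<subseteq> set es" for xs
    using that
  proof (induction xs)
    case (Cons a xs)
    then have "cmod a \<le> norm h" "cmod (sum_list xs) \<le> real (length xs) * norm h" by auto
    then show ?case using norm_triangle_ineq[of a "sum_list xs"] by (simp add: algebra_simps)
  qed simp
  have "cmod (mat_trace (p h)) \<le> real d * norm h" using sl[of es] tr es(2) by simp
  moreover have "mat_trace (p h) = complex_of_real (\<Sum>i<d. \<Sum>k<d. (cmod (p x $$ (k, i)))\<^sup>2)"
    unfolding h_def pmult padj by (rule mat_trace_adjoint_mult[OF pc])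
  moreover have "norm h = (norm x)\<^sup>2" by (simp add: h_def cstar_identity)
  ultimately have "\<bar>\<Sum>i<d. \<Sum>k<d. (cmod (p x $$ (k, i)))\<^sup>2\<bar> \<le> real d * (norm x)\<^sup>2"
    by (simp only: norm_of_real)
  then show ?thesis by (rule order_trans[OF abs_ge_self])
qed

text \<open>One entry is dominated by the Hilbert-Schmidt norm. This continuity yields the
  uniqueness of the quotient maps and the boundedness of the traces pulled back along them.\<close>

lemma surj_star_hom_mat_entry:
  fixes p :: "'a::unital_cstar_algebra \<Rightarrow> complex mat"
  assumes p: "surj_star_hom_mat d p" and rs: "r < d" "s < d"
  shows "bounded_linear (\<lambda>x. p x $$ (r, s))"
proof (rule bounded_linear_intro)
  have pc: "p y \<in> carrier_mat d d" for y using p by (auto simp: surj_star_hom_mat_def)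
  have padd: "p (y + z) = p y + p z" and pscale: "p (c *\<^sub>C y) = c \<cdot>\<^sub>m p y" for y z c
    using p by (auto simp: surj_star_hom_mat_def)
  show "p (x + y) $$ (r, s) = p x $$ (r, s) + p y $$ (r, s)" for x y
    using pc rs by (simp add: padd carrier_matD[OF pc])
  show "p (c *\<^sub>R x) $$ (r, s) = c *\<^sub>R p x $$ (r, s)" for c x
    using pscale[of "complex_of_real c" x] rs
    by (simp add: scaleC_of_real carrier_matD[OF pc] scaleR_conv_of_real)
  show "norm (p x $$ (r, s)) \<le> norm x * sqrt (real d)" for x
  proof -
    have "(cmod (p x $$ (r, s)))\<^sup>2 \<le> (\<Sum>i<d. \<Sum>k<d. (cmod (p x $$ (k, i)))\<^sup>2)"
      by (rule entry_square_le_sum[OF rs])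
    also have "\<dots> \<le> real d * (norm x)\<^sup>2" by (rule surj_star_hom_mat_bound[OF p])
    also have "\<dots> = (norm x * sqrt (real d))\<^sup>2" by (simp add: power_mult_distrib)
    finally show ?thesis by (rule power2_le_imp_le) simp
  qed
qed

section \<open>The inductive system\<close>

lemma kdim_pos [simp]: "0 < kdim j" and kdim_0 [simp]: "kdim 0 = 1" and kdim_Suc [simp]: "kdim (Suc n) = 2 ^ n"
  by (auto simp: kdim_def)

text \<open>The source of all factors 2^n: diag(a_0, ..., a_n) has size 1 + 1 + 2 + ... + 2^(n-1),
  which is the size of the next summand.\<close>

lemma sum_kdim: "(\<Sum>j\<le>n. kdim j) = 2 ^ n"
  by (induction n) auto

section \<open>Componentwise arithmetic in the finite stages\<close>

lemma A_alg_iff: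
  "as \<in> A_alg n \<longleftrightarrow> length as = Suc n \<and> (\<forall>j\<le>n. as ! j \<in> carrier_mat (kdim j) (kdim j))"
  unfolding A_alg_def mat_sum_def mem_Collect_eq list_all2_conv_all_nth
  by (auto simp del: upt_Suc simp: less_Suc_eq_le)

lemma A_alg_length: "as \<in> A_alg n \<Longrightarrow> length as = Suc n"
  and A_alg_nth: "as \<in> A_alg n \<Longrightarrow> j \<le> n \<Longrightarrow> as ! j \<in> carrier_mat (kdim j) (kdim j)"
  by (auto simp: A_alg_iff)

lemma A_alg_dims: "as \<in> A_alg n \<Longrightarrow> j \<le> n \<Longrightarrow> dim_row (as ! j) = kdim j"
    "as \<in> A_alg n \<Longrightarrow> j \<le> n \<Longrightarrow> dim_col (as ! j) = kdim j"
  using A_alg_nth[of as n j] by auto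

lemma A_alg_eqI:
  assumes "as \<in> A_alg n" "bs \<in> A_alg n" "\<And>j. j \<le> n \<Longrightarrow> as ! j = bs ! j" shows "as = bs"
  using assms by (intro nth_equalityI) (auto simp: A_alg_length)

lemma A_alg_map2:
  assumes "as \<in> A_alg n" "bs \<in> A_alg n"
  shows "j \<le> n \<Longrightarrow> map2 f as bs ! j = f (as ! j) (bs ! j)"
    and "(\<And>j. j \<le> n \<Longrightarrow> f (as ! j) (bs ! j) \<in> carrier_mat (kdim j) (kdim j)) \<Longrightarrow> map2 f as bs \<in> A_alg n"
  using assms by (auto simp: A_alg_iff)

lemma A_alg_map:
  assumes "as \<in> A_alg n"
  shows "j \<le> n \<Longrightarrow> map f as ! j = f (as ! j)"
    and "(\<And>j. j \<le> n \<Longrightarrow> f (as ! j) \<in> carrier_mat (kdim j) (kdim j)) \<Longrightarrow> map f as \<in> A_alg n"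
  using assms by (auto simp: A_alg_iff)

lemma A_alg_add: "as \<in> A_alg n \<Longrightarrow> bs \<in> A_alg n \<Longrightarrow> map2 (+) as bs \<in> A_alg n"
  by (rule A_alg_map2(2)) (auto intro!: add_carrier_mat dest: A_alg_nth)

lemma A_alg_mult: "as \<in> A_alg n \<Longrightarrow> bs \<in> A_alg n \<Longrightarrow> map2 (*) as bs \<in> A_alg n"
  by (rule A_alg_map2(2)) (auto intro!: mult_carrier_mat dest: A_alg_nth)

lemma A_alg_smult: "as \<in> A_alg n \<Longrightarrow> map (\<lambda>a. c \<cdot>\<^sub>m a) as \<in> A_alg n"
  by (rule A_alg_map(2)) (auto dest: A_alg_nth)

lemma A_alg_adjoint: "as \<in> A_alg n \<Longrightarrow> map mat_adjoint as \<in> A_alg n"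
  by (rule A_alg_map(2)) (auto dest: A_alg_nth)

section \<open>Elements supported in one summand\<close>

definition slot :: "nat \<Rightarrow> nat \<Rightarrow> complex mat \<Rightarrow> complex mat list" where
  "slot n j X = map (\<lambda>i. if i = j then X else 0\<^sub>m (kdim i) (kdim i)) [0..<Suc n]"

lemma slot_nth: "i \<le> n \<Longrightarrow> slot n j X ! i = (if i = j then X else 0\<^sub>m (kdim i) (kdim i))"
  by (auto simp: slot_def simp del: upt_Suc)

lemma slot_A_alg: "X \<in> carrier_mat (kdim j) (kdim j) \<Longrightarrow> slot n j X \<in> A_alg n"
  by (auto simp: A_alg_iff slot_nth) (simp add: slot_def)

lemma slot_mult:
  assumes "X \<in> carrier_mat (kdim j) (kdim j)" "as \<in> A_alg n" "j \<le> n"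
  shows "map2 (*) (slot n j X) as = slot n j (X * as ! j)" "map2 (*) as (slot n j X) = slot n j (as ! j * X)"
proof -
  have c: "X * as ! j \<in> carrier_mat (kdim j) (kdim j)" "as ! j * X \<in> carrier_mat (kdim j) (kdim j)"
    using assms A_alg_nth by (auto intro!: mult_carrier_mat)
  have z: "0\<^sub>m (kdim i) (kdim i) * as ! i = 0\<^sub>m (kdim i) (kdim i)"
    "as ! i * 0\<^sub>m (kdim i) (kdim i) = 0\<^sub>m (kdim i) (kdim i)" if "i \<le> n" for i
    using left_mult_zero_mat[OF A_alg_nth[OF assms(2) that]] right_mult_zero_mat[OF A_alg_nth[OF assms(2) that]]
    by auto
  show "map2 (*) (slot n j X) as = slot n j (X * as ! j)"
    using assms c z
    by (intro A_alg_eqI[OF A_alg_mult slot_A_alg]) (auto simp: slot_A_alg A_alg_map2(1)[OF slot_A_alg] slot_nth)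
  show "map2 (*) as (slot n j X) = slot n j (as ! j * X)"
    using assms c z
    by (intro A_alg_eqI[OF A_alg_mult slot_A_alg]) (auto simp: slot_A_alg A_alg_map2(1)[OF _ slot_A_alg] slot_nth)
qed

lemma slot_adjoint:
  assumes "X \<in> carrier_mat (kdim j) (kdim j)"
  shows "map mat_adjoint (slot n j X) = slot n j (mat_adjoint X)"
proof (rule A_alg_eqI[OF A_alg_adjoint slot_A_alg])
  have "mat_adjoint (0\<^sub>m k k :: complex mat) = 0\<^sub>m k k" for k by (rule eq_matI) auto
  then show "map mat_adjoint (slot n j X) ! i = slot n j (mat_adjoint X) ! i" if "i \<le> n" for i
    using assms that by (simp add: A_alg_map(1)[OF slot_A_alg] slot_nth)
qed (use assms in \<open>auto intro: slot_A_alg\<close>)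

lemma A_alg_square: "as \<in> A_alg n \<Longrightarrow> \<forall>A\<in>set as. square_mat A"
  by (auto simp: in_set_conv_nth less_Suc_eq_le A_alg_length A_alg_dims)

section \<open>The connecting maps\<close>

lemma diag_block_carrier:
  assumes "as \<in> A_alg n" shows "diag_block_mat as \<in> carrier_mat (2 ^ n) (2 ^ n)"
proof -
  have "map dim_row as = map kdim [0..<Suc n]" "map dim_col as = map kdim [0..<Suc n]"
    using assms by (auto intro!: nth_equalityI simp: A_alg_iff less_Suc_eq_le simp del: upt_Suc)
  moreover have "sum_list (map kdim [0..<Suc n]) = 2 ^ n"
    by (simp only: interv_sum_list_conv_sum_set_nat set_upt atLeast0LessThan lessThan_Suc_atMost sum_kdim)
  ultimately show ?thesis by (intro carrier_matI) (simp_all only: dim_diag_block_mat)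
qed

lemma \<phi>_map_A_alg: "as \<in> A_alg n \<Longrightarrow> \<phi>_map n as \<in> A_alg (Suc n)"
  using diag_block_carrier[of as n] by (auto simp: A_alg_iff \<phi>_map_def nth_append le_Suc_eq)

lemma \<phi>_map_nth: "as \<in> A_alg n \<Longrightarrow> j \<le> n \<Longrightarrow> \<phi>_map n as ! j = as ! j"
  and \<phi>_map_last: "as \<in> A_alg n \<Longrightarrow> \<phi>_map n as ! Suc n = diag_block_mat as"
  by (auto simp: A_alg_iff \<phi>_map_def nth_append)

lemma mat_trace_diag_block_A_alg:
  "as \<in> A_alg n \<Longrightarrow> mat_trace (diag_block_mat as) = (\<Sum>j\<le>n. mat_trace (as ! j))"
  unfolding mat_trace_diag_block[OF A_alg_square]
  by (simp add: sum_list_sum_nth atLeast0LessThan A_alg_length lessThan_Suc_atMost)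

lemma connect_A_alg:
  assumes "as \<in> A_alg n"
  shows "connect \<phi>_map n m as \<in> A_alg (n + m) \<and> (\<forall>j\<le>n. connect \<phi>_map n m as ! j = as ! j)"
  by (induction m) (use assms in \<open>auto simp: \<phi>_map_A_alg \<phi>_map_nth\<close>)

definition idx :: "nat \<Rightarrow> (nat \<times> nat \<times> nat) set" where
  "idx n = Sigma {..n} (\<lambda>j. {..<kdim j} \<times> {..<kdim j})"

lemma finite_idx [simp]: "finite (idx n)"
  by (simp add: idx_def)

text \<open>Truncation to a set of matrix positions; it lets the expansion into matrix units be
  proved by induction over that set.\<close>

definition restr :: "nat \<Rightarrow> (nat \<times> nat \<times> nat) set \<Rightarrow> complex mat list \<Rightarrow> complex mat list" where
  "restr n S as = map (\<lambda>j. mat (kdim j) (kdim j)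
      (\<lambda>(r, s). if (j, r, s) \<in> S then as ! j $$ (r, s) else 0)) [0..<Suc n]"

lemma restr_nth: "j \<le> n \<Longrightarrow> restr n S as ! j =
    mat (kdim j) (kdim j) (\<lambda>(r, s). if (j, r, s) \<in> S then as ! j $$ (r, s) else 0)"
  by (auto simp: restr_def simp del: upt_Suc)

lemma restr_A_alg: "restr n S as \<in> A_alg n"
  by (auto simp: A_alg_iff restr_nth) (simp add: restr_def)

text \<open>A purely algebraic notion, since it has to cover the functionals in
  \<open>is_factorI\<close>, which come from central operators and need not be positive, along with
  the tracial states.\<close>

definition trace_functional :: "('a::unital_cstar_algebra \<Rightarrow> complex) \<Rightarrow> bool" where
  "trace_functional \<psi> \<longleftrightarrow> (\<forall>x y. \<psi> (x + y) = \<psi> x + \<psi> y) \<and> (\<forall>c x. \<psi> (c *\<^sub>C x) = c * \<psi> x) \<and>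
     (\<forall>x y. \<psi> (x * y) = \<psi> (y * x))"

locale dyadic_limit =
  fixes \<Phi> :: "nat \<Rightarrow> complex mat list \<Rightarrow> 'a::unital_cstar_algebra"
  assumes limit: "inductive_limit A_alg \<phi>_map \<Phi>"
begin

lemma hom: "unital_star_hom_on (A_alg n) (\<Phi> n)"
  and compat: "as \<in> A_alg n \<Longrightarrow> \<Phi> (Suc n) (\<phi>_map n as) = \<Phi> n as"
  and lim_norm: "as \<in> A_alg n \<Longrightarrow> (\<lambda>m. ms_norm (connect \<phi>_map n m as)) \<longlonglongrightarrow> norm (\<Phi> n as)"
  and dense: "closure (\<Union>n. \<Phi> n ` A_alg n) = UNIV"
  using limit by (auto simp: inductive_limit_def)

section \<open>Matrix units in the limit and the values of trace functionals\<close>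

lemma \<Phi>_add: "as \<in> A_alg n \<Longrightarrow> bs \<in> A_alg n \<Longrightarrow> \<Phi> n (map2 (+) as bs) = \<Phi> n as + \<Phi> n bs"
  and \<Phi>_scale: "as \<in> A_alg n \<Longrightarrow> \<Phi> n (map (\<lambda>a. c \<cdot>\<^sub>m a) as) = c *\<^sub>C \<Phi> n as"
  and \<Phi>_mult: "as \<in> A_alg n \<Longrightarrow> bs \<in> A_alg n \<Longrightarrow> \<Phi> n (map2 (*) as bs) = \<Phi> n as * \<Phi> n bs"
  and \<Phi>_adj: "as \<in> A_alg n \<Longrightarrow> \<Phi> n (map mat_adjoint as) = adj (\<Phi> n as)"
  and \<Phi>_one: "as \<in> A_alg n \<Longrightarrow> \<Phi> n (map (\<lambda>a. 1\<^sub>m (dim_row a)) as) = 1"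
  using hom[of n] by (auto simp: unital_star_hom_on_def)

lemma \<Phi>_zero:
  assumes "as \<in> A_alg n" "\<And>j. j \<le> n \<Longrightarrow> as ! j = 0\<^sub>m (kdim j) (kdim j)" shows "\<Phi> n as = 0"
proof -
  have "as = map (\<lambda>a. 0 \<cdot>\<^sub>m a) as"
    using assms by (intro A_alg_eqI[OF _ A_alg_smult]) (auto simp: A_alg_map(1))
  then show ?thesis using \<Phi>_scale[OF assms(1), of 0] by simp
qed

text \<open>For j <= n these are the matrix units of the j-th summand of stage n, seen in the limit.
  The value of a trace functional at the minimal projection \<open>U n j 0 0\<close> is its weight
  on that summand.\<close>

definition U :: "nat \<Rightarrow> nat \<Rightarrow> nat \<Rightarrow> nat \<Rightarrow> 'a" where
  "U n j r s = \<Phi> n (slot n j (emat (kdim j) r s))"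

lemma U_mult:
  assumes "j \<le> n" "j' \<le> n" "r < kdim j" "s < kdim j" "s' < kdim j'" "t < kdim j'"
  shows "U n j r s * U n j' s' t = (if j = j' \<and> s = s' then U n j r t else 0)"
proof -
  have "U n j r s * U n j' s' t
      = \<Phi> n (slot n j (emat (kdim j) r s * slot n j' (emat (kdim j') s' t) ! j))"
    using assms by (simp add: U_def \<Phi>_mult[symmetric] slot_A_alg slot_mult(1))
  also have "\<dots> = (if j = j' \<and> s = s' then U n j r t else 0)"
    using assms by (auto simp: slot_nth emat_mult U_def intro!: \<Phi>_zero slot_A_alg)
  finally show ?thesis .
qed

lemma U_adj: "adj (U n j r s) = U n j s r"
  by (simp add: U_def \<Phi>_adj[symmetric] slot_A_alg slot_adjoint emat_adjoint)

lemma \<Phi>_restr: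
  assumes as: "as \<in> A_alg n" and "finite S" "S \<subseteq> idx n"
  shows "\<Phi> n (restr n S as) = (\<Sum>(j, r, s)\<in>S. (as ! j $$ (r, s)) *\<^sub>C U n j r s)"
  using assms(2,3)
proof (induction S)
  case empty
  have "\<Phi> n (restr n {} as) = 0"
    by (rule \<Phi>_zero[OF restr_A_alg]) (auto simp: restr_nth)
  then show ?case by simp
next
  case (insert t S)
  obtain j r s where t: "t = (j, r, s)" by (cases t)
  have b: "j \<le> n" "r < kdim j" "s < kdim j" using insert.prems by (auto simp: t idx_def)
  have sl: "slot n j (emat (kdim j) r s) \<in> A_alg n" by (simp add: slot_A_alg)
  have "restr n (insert t S) as
      = map2 (+) (map (\<lambda>a. (as ! j $$ (r, s)) \<cdot>\<^sub>m a) (slot n j (emat (kdim j) r s))) (restr n S as)"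
  proof (rule A_alg_eqI[OF restr_A_alg A_alg_add[OF A_alg_smult[OF sl] restr_A_alg]])
    fix i assume i: "i \<le> n"
    show "restr n (insert t S) as ! i
      = map2 (+) (map (\<lambda>a. (as ! j $$ (r, s)) \<cdot>\<^sub>m a) (slot n j (emat (kdim j) r s))) (restr n S as) ! i"
      unfolding A_alg_map2(1)[OF A_alg_smult[OF sl] restr_A_alg i] A_alg_map(1)[OF sl i]
        restr_nth[OF i] slot_nth[OF i]
      using insert.hyps(2) by (intro eq_matI) (auto simp: t)
  qed
  then show ?case
    using insert by (simp add: t \<Phi>_add[OF A_alg_smult[OF sl] restr_A_alg] \<Phi>_scale[OF sl] U_def)
qed

lemma \<Phi>_expand:
  assumes "as \<in> A_alg n"
  shows "\<Phi> n as = (\<Sum>(j, r, s)\<in>idx n. (as ! j $$ (r, s)) *\<^sub>C U n j r s)"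
proof -
  have "restr n (idx n) as = as"
    using A_alg_dims[OF assms]
    by (intro A_alg_eqI[OF restr_A_alg assms] eq_matI) (auto simp: restr_nth idx_def)
  then show ?thesis using \<Phi>_restr[OF assms, of "idx n"] by simp
qed

text \<open>Off-diagonal matrix units are killed, by comparing e_rr e_rs with e_rs e_rr; diagonal
  ones of a summand have equal values, by comparing e_r0 e_0r with e_0r e_r0.\<close>

lemma trace_expand:
  assumes \<psi>: "trace_functional \<psi>" and as: "as \<in> A_alg n"
  shows "\<psi> (\<Phi> n as) = (\<Sum>j\<le>n. \<psi> (U n j 0 0) * mat_trace (as ! j))"
proof -
  have add: "\<psi> (x + y) = \<psi> x + \<psi> y" and scale: "\<psi> (c *\<^sub>C x) = c * \<psi> x" and tr: "\<psi> (x * y) = \<psi> (y * x)"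
    for x y c using \<psi> by (auto simp: trace_functional_def)
  have zero: "\<psi> 0 = 0" using add[of 0 0] by simp
  have sum: "\<psi> (sum f S) = (\<Sum>x\<in>S. \<psi> (f x))" for f :: "nat \<times> nat \<times> nat \<Rightarrow> 'a" and S
    by (induction S rule: infinite_finite_induct) (auto simp: zero add)
  have diag: "\<psi> (U n j r s) = (if r = s then \<psi> (U n j 0 0) else 0)"
    if "j \<le> n" "r < kdim j" "s < kdim j" for j r s
  proof (cases "r = s")
    case True
    then show ?thesis
      using tr[of "U n j r 0" "U n j 0 r"] U_mult[of j n j r 0 0 r] U_mult[of j n j 0 r r 0] that by simp
  next
    case False
    then show ?thesis
      using tr[of "U n j r r" "U n j r s"] U_mult[of j n j r r r s] U_mult[of j n j r s r r] that
      by (simp add: zero)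
  qed
  have "\<psi> (\<Phi> n as) = (\<Sum>(j, r, s)\<in>idx n. as ! j $$ (r, s) * \<psi> (U n j r s))"
    unfolding \<Phi>_expand[OF as] sum by (intro sum.cong) (auto simp: scale)
  also have "\<dots> = (\<Sum>j\<le>n. \<Sum>r<kdim j. \<Sum>s<kdim j. as ! j $$ (r, s) * \<psi> (U n j r s))"
    unfolding idx_def by (subst sum.Sigma[symmetric]) (auto simp: sum.cartesian_product)
  also have "\<dots> = (\<Sum>j\<le>n. \<Sum>r<kdim j. as ! j $$ (r, r) * \<psi> (U n j 0 0))"
  proof (intro sum.cong refl)
    fix j r assume jr: "j \<in> {..n}" "r \<in> {..<kdim j}"
    have "(\<Sum>s<kdim j. as ! j $$ (r, s) * \<psi> (U n j r s))
        = (\<Sum>s<kdim j. if s = r then as ! j $$ (r, s) * \<psi> (U n j 0 0) else 0)"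
    proof (intro sum.cong refl)
      fix s assume "s \<in> {..<kdim j}"
      then show "as ! j $$ (r, s) * \<psi> (U n j r s) = (if s = r then as ! j $$ (r, s) * \<psi> (U n j 0 0) else 0)"
        using jr diag[of j r s] by auto
    qed
    also have "\<dots> = as ! j $$ (r, r) * \<psi> (U n j 0 0)" using jr by simp
    finally show "(\<Sum>s<kdim j. as ! j $$ (r, s) * \<psi> (U n j r s)) = as ! j $$ (r, r) * \<psi> (U n j 0 0)" .
  qed
  also have "\<dots> = (\<Sum>j\<le>n. \<psi> (U n j 0 0) * mat_trace (as ! j))"
    using A_alg_dims[OF as]
    by (intro sum.cong refl) (auto simp: mat_trace_def sum_distrib_left mult.commute)
  finally show ?thesis .
qed

lemma mat_trace_slot:
  "i \<le> n \<Longrightarrow> mat_trace (slot n j X ! i) = (if i = j then mat_trace X else 0)"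
  by (simp add: slot_nth mat_trace_def)

lemma mat_trace_emat: "r < n \<Longrightarrow> mat_trace (emat n r r) = 1"
  by (simp add: mat_trace_def)

text \<open>The connecting map keeps a minimal projection of summand j and adds a copy of it in the
  new summand, again of matrix trace 1 there.\<close>

lemma trace_weight_step:
  assumes \<psi>: "trace_functional \<psi>" and j: "j \<le> n"
  shows "\<psi> (U n j 0 0) = \<psi> (U (Suc n) j 0 0) + \<psi> (U (Suc n) (Suc n) 0 0)"
proof -
  let ?a = "slot n j (emat (kdim j) 0 0)"
  have a: "?a \<in> A_alg n" by (simp add: slot_A_alg)
  have tr: "mat_trace (?a ! i) = (if i = j then 1 else 0)" if "i \<le> n" for i
    using that by (simp add: mat_trace_slot mat_trace_emat)
  have "\<psi> (U n j 0 0) = \<psi> (\<Phi> (Suc n) (\<phi>_map n ?a))"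
    using compat[OF a] by (simp add: U_def)
  also have "\<dots> = (\<Sum>i\<le>Suc n. \<psi> (U (Suc n) i 0 0) * mat_trace (\<phi>_map n ?a ! i))"
    by (rule trace_expand[OF \<psi> \<phi>_map_A_alg[OF a]])
  also have "\<dots> = (\<Sum>i\<le>n. \<psi> (U (Suc n) i 0 0) * mat_trace (?a ! i))
      + \<psi> (U (Suc n) (Suc n) 0 0) * (\<Sum>i\<le>n. mat_trace (?a ! i))"
    by (simp add: \<phi>_map_last[OF a] \<phi>_map_nth[OF a] mat_trace_diag_block_A_alg[OF a])
  also have "(\<Sum>i\<le>n. mat_trace (?a ! i)) = 1" using j by (simp add: tr)
  also have "(\<Sum>i\<le>n. \<psi> (U (Suc n) i 0 0) * mat_trace (?a ! i))
      = (\<Sum>i\<le>n. if i = j then \<psi> (U (Suc n) i 0 0) else 0)"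
    by (intro sum.cong refl) (simp add: tr)
  finally show ?thesis using j by simp
qed

lemma trace_weight_sum:
  assumes \<psi>: "trace_functional \<psi>"
  shows "\<psi> 1 = (\<Sum>j\<le>n. \<psi> (U n j 0 0) * of_nat (kdim j))"
proof -
  \<comment> \<open>The unit is expressed in \<open>unital_star_hom_on\<close> through the
    dimensions of an arbitrary element; the zero element serves.\<close>
  define z where "z = slot n 0 (0\<^sub>m 1 1)"
  have z: "z \<in> A_alg n" unfolding z_def by (rule slot_A_alg) simp
  let ?e = "map (\<lambda>a. 1\<^sub>m (dim_row a) :: complex mat) z"
  have e: "?e \<in> A_alg n" by (rule A_alg_map(2)[OF z]) (simp add: A_alg_dims[OF z])
  have "?e ! j = 1\<^sub>m (kdim j)" if "j \<le> n" for j
    using A_alg_map(1)[OF z that, of "\<lambda>a. 1\<^sub>m (dim_row a) :: complex mat"] A_alg_dims[OF z that] by simp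
  then show ?thesis
    using trace_expand[OF \<psi> e] \<Phi>_one[OF z] by (simp add: mat_trace_one)
qed

section \<open>Density of the finite stages\<close>

abbreviation D :: "'a set" where "D \<equiv> \<Union>n. \<Phi> n ` A_alg n"

lemma \<Phi>_lift:
  assumes "as \<in> A_alg n" "n \<le> m"
  obtains bs where "bs \<in> A_alg m" "\<Phi> m bs = \<Phi> n as" "\<And>j. j \<le> n \<Longrightarrow> bs ! j = as ! j"
proof -
  have "\<Phi> (n + k) (connect \<phi>_map n k as) = \<Phi> n as" for k
    by (induction k) (use assms connect_A_alg compat in auto)
  from this[of "m - n"] show thesis
    using connect_A_alg[OF assms(1), of "m - n"] assms by (intro that[of "connect \<phi>_map n (m - n) as"]) auto
qed

text \<open>A common stage for two elements, as late as wanted: taking \<open>N\<close> to be j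
  ensures that the j-th component exists.\<close>

lemma D_pair:
  assumes "x \<in> D" "y \<in> D"
  shows "\<exists>n\<ge>N. \<exists>as\<in>A_alg n. \<exists>bs\<in>A_alg n. x = \<Phi> n as \<and> y = \<Phi> n bs"
proof -
  obtain n1 as n2 bs where *: "as \<in> A_alg n1" "x = \<Phi> n1 as" "bs \<in> A_alg n2" "y = \<Phi> n2 bs"
    using assms by blast
  define n where "n = max N (max n1 n2)"
  have le: "n1 \<le> n" "n2 \<le> n" "N \<le> n" by (auto simp: n_def)
  obtain as' where "as' \<in> A_alg n" "\<Phi> n as' = \<Phi> n1 as" using \<Phi>_lift[OF *(1) le(1)] .
  moreover obtain bs' where "bs' \<in> A_alg n" "\<Phi> n bs' = \<Phi> n2 bs" using \<Phi>_lift[OF *(3) le(2)] .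
  ultimately show ?thesis using * le(3) by metis
qed

lemma dense_eq2:
  fixes F G :: "'a \<times> 'a \<Rightarrow> 'b::t2_space"
  assumes "continuous_on UNIV F" "continuous_on UNIV G" "\<And>x y. x \<in> D \<Longrightarrow> y \<in> D \<Longrightarrow> F (x, y) = G (x, y)"
  shows "F (x, y) = G (x, y)"
proof -
  have "closed {p. F p = G p}" by (rule closed_Collect_eq[OF assms(1,2)])
  moreover have "D \<times> D \<subseteq> {p. F p = G p}" using assms(3) by auto
  ultimately have "closure (D \<times> D) \<subseteq> {p. F p = G p}" by (rule closure_minimal[rotated])
  then show ?thesis by (auto simp: closure_Times dense)
qed

text \<open>The images of the stages increase, so those from \<open>N\<close> on already have dense
  union.\<close>

lemma dense_eq:
  fixes F G :: "'a \<Rightarrow> 'b::t2_space"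
  assumes "continuous_on UNIV F" "continuous_on UNIV G"
    and "\<And>n as. N \<le> n \<Longrightarrow> as \<in> A_alg n \<Longrightarrow> F (\<Phi> n as) = G (\<Phi> n as)"
  shows "F x = G x"
proof -
  have "closed {p. F p = G p}" by (rule closed_Collect_eq[OF assms(1,2)])
  moreover have "D \<subseteq> {p. F p = G p}"
  proof
    fix x assume "x \<in> D"
    then obtain n as where "n \<ge> N" "as \<in> A_alg n" "x = \<Phi> n as" using D_pair[of x x N] by blast
    then show "x \<in> {p. F p = G p}" using assms(3) by simp
  qed
  ultimately have "closure D \<subseteq> {p. F p = G p}" by (rule closure_minimal[rotated])
  then show ?thesis by (auto simp: dense)
qed

section \<open>The quotient maps onto the summands\<close>

lemma entry_le_norm:
  assumes as: "as \<in> A_alg n" and j: "j \<le> n" "r < kdim j" "s < kdim j"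
  shows "cmod (as ! j $$ (r, s)) \<le> norm (\<Phi> n as)"
proof (rule LIMSEQ_le_const[OF lim_norm[OF as]])
  \<comment> \<open>The connecting maps keep the earlier components, so the bound holds at every
    later stage and passes to the limit of the norms.\<close>
  have "cmod (as ! j $$ (r, s)) \<le> ms_norm (connect \<phi>_map n m as)" for m
  proof -
    have c: "connect \<phi>_map n m as \<in> A_alg (n + m)" "connect \<phi>_map n m as ! j = as ! j"
      using connect_A_alg[OF as, of m] j by auto
    then show ?thesis
      using entry_le_ms_norm[of j "connect \<phi>_map n m as" "kdim j" "kdim j" r s] j A_alg_nth[OF as]
      by (simp add: A_alg_length)
  qed
  then show "\<exists>N. \<forall>m\<ge>N. cmod (as ! j $$ (r, s)) \<le> ms_norm (connect \<phi>_map n m as)" by blast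
qed

text \<open>For equal images this shows that an entry is well defined on the dense subalgebra; in
  general, that it is 1-Lipschitz there.\<close>

lemma entry_diff_le_norm:
  assumes as: "as \<in> A_alg n" "bs \<in> A_alg m" and j: "j \<le> n" "j \<le> m" "r < kdim j" "s < kdim j"
  shows "cmod (as ! j $$ (r, s) - bs ! j $$ (r, s)) \<le> norm (\<Phi> n as - \<Phi> m bs)"
proof -
  define N where "N = max n m"
  obtain a where a: "a \<in> A_alg N" "\<Phi> N a = \<Phi> n as" "\<And>j. j \<le> n \<Longrightarrow> a ! j = as ! j"
    using \<Phi>_lift[OF as(1), of N] by (simp add: N_def) blast
  obtain b where b: "b \<in> A_alg N" "\<Phi> N b = \<Phi> m bs" "\<And>j. j \<le> m \<Longrightarrow> b ! j = bs ! j"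
    using \<Phi>_lift[OF as(2), of N] by (simp add: N_def) blast
  let ?c = "map2 (+) a (map (\<lambda>x. (-1) \<cdot>\<^sub>m x) b)"
  have jN: "j \<le> N" using j by (simp add: N_def)
  have c: "?c \<in> A_alg N" by (intro A_alg_add A_alg_smult a b)
  have "?c ! j $$ (r, s) = as ! j $$ (r, s) - bs ! j $$ (r, s)"
    using a(3) b(3) j A_alg_nth[OF as(1) j(1)] A_alg_nth[OF as(2) j(2)]
    by (simp add: A_alg_map2(1)[OF a(1) A_alg_smult[OF b(1)] jN] A_alg_map(1)[OF b(1) jN] carrier_matD)
  moreover have "\<Phi> N ?c = \<Phi> n as - \<Phi> m bs"
    by (simp only: \<Phi>_add[OF a(1) A_alg_smult[OF b(1)]] \<Phi>_scale[OF b(1)] a b scaleC_minus_one add_uminus_conv_diff)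
  ultimately show ?thesis using entry_le_norm[OF c jN j(3,4)] by metis
qed

lemma entry_extension:
  assumes rs: "r < kdim j" "s < kdim j"
  shows "\<exists>g. continuous_on UNIV g \<and> (\<forall>n\<ge>j. \<forall>as\<in>A_alg n. g (\<Phi> n as) = as ! j $$ (r, s))"
proof -
  \<comment> \<open>An arbitrary representative is chosen; \<open>f\<close> below shows that the
    entry does not depend on it.\<close>
  define f where "f x = (SOME z. \<exists>n\<ge>j. \<exists>as\<in>A_alg n. \<Phi> n as = x \<and> z = as ! j $$ (r, s))" for x
  have f: "f (\<Phi> n as) = as ! j $$ (r, s)" if "n \<ge> j" "as \<in> A_alg n" for n as
  proof -
    have "\<exists>m\<ge>j. \<exists>bs\<in>A_alg m. \<Phi> m bs = \<Phi> n as \<and> f (\<Phi> n as) = bs ! j $$ (r, s)"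
      unfolding f_def by (rule someI_ex) (use that in blast)
    then obtain m bs where "m \<ge> j" "bs \<in> A_alg m" "\<Phi> m bs = \<Phi> n as" "f (\<Phi> n as) = bs ! j $$ (r, s)"
      by blast
    then show ?thesis using entry_diff_le_norm[of bs m as n j r s] that rs by simp
  qed
  have lip: "dist (f x) (f y) \<le> dist x y" if xy: "x \<in> D" "y \<in> D" for x y
  proof -
    obtain n as bs where *: "j \<le> n" "as \<in> A_alg n" "bs \<in> A_alg n" "x = \<Phi> n as" "y = \<Phi> n bs"
      using D_pair[OF xy, of j] by blast
    then show ?thesis using entry_diff_le_norm[of as n bs n j r s] rs by (simp add: f dist_norm)
  qed
  have uc: "uniformly_continuous_on D f"
    unfolding uniformly_continuous_on_def
  proof (intro allI impI)
    fix e :: real assume "e > 0"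
    moreover have "dist (f x') (f x) < e" if "x \<in> D" "x' \<in> D" "dist x' x < e" for x x'
      using lip[OF that(2,1)] that(3) by linarith
    ultimately show "\<exists>d>0. \<forall>x\<in>D. \<forall>x'\<in>D. dist x' x < d \<longrightarrow> dist (f x') (f x) < e" by blast
  qed
  obtain g where g: "uniformly_continuous_on (closure D) g" "\<And>x. x \<in> D \<Longrightarrow> f x = g x"
    by (rule uniformly_continuous_on_extension_on_closure[OF uc]) (rule that)
  have "continuous_on UNIV g" using uniformly_continuous_imp_continuous[OF g(1)] by (simp add: dense)
  moreover have "g (\<Phi> n as) = as ! j $$ (r, s)" if "n \<ge> j" "as \<in> A_alg n" for n as
  proof -
    have "\<Phi> n as \<in> D" using that by blast
    then show ?thesis using f[OF that] g(2)[of "\<Phi> n as"] by simp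
  qed
  ultimately show ?thesis by blast
qed

text \<open>The entries are extended by continuity from the dense subalgebra. Each algebraic law is
  then an equality of continuous functions and is checked at a finite stage that contains the j-th
  summand.\<close>

lemma \<pi>_exists: "\<exists>p. surj_star_hom_mat (kdim j) p \<and> (\<forall>n\<ge>j. \<forall>as\<in>A_alg n. p (\<Phi> n as) = as ! j)"
proof -
  define k where "k = kdim j"
  \<comment> \<open>Indices outside the matrix are given a constant function, so that
    \<open>g\<close> can be chosen for all r and s at once.\<close>
  have "\<exists>g. continuous_on UNIV g \<and> (\<forall>n\<ge>j. \<forall>as\<in>A_alg n. r < kdim j \<longrightarrow> s < kdim j \<longrightarrow> g (\<Phi> n as) = as ! j $$ (r, s))" for r s
    using entry_extension[of r j s] continuous_on_const by (cases "r < kdim j \<and> s < kdim j") blast+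
  then obtain g where cont: "\<And>r s. continuous_on UNIV (g r s)"
    and g: "\<And>r s n as. n \<ge> j \<Longrightarrow> as \<in> A_alg n \<Longrightarrow> r < k \<Longrightarrow> s < k \<Longrightarrow> g r s (\<Phi> n as) = as ! j $$ (r, s)"
    unfolding k_def by metis
  note cont' = continuous_on_compose2[OF cont _ subset_UNIV]
  define p where "p x = mat k k (\<lambda>(r, s). g r s x)" for x
  have pc: "p x \<in> carrier_mat k k" for x by (simp add: p_def)
  have pD: "p (\<Phi> n as) = as ! j" if "n \<ge> j" "as \<in> A_alg n" for n as
    using A_alg_nth[OF that(2,1)] g[OF that] by (intro eq_matI) (auto simp: p_def k_def[symmetric])
  have add: "g r s (x + y) = g r s x + g r s y" if rs: "r < k" "s < k" for x y r s
  proof -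
    have "(\<lambda>p. g r s (fst p + snd p)) (x, y) = (\<lambda>p. g r s (fst p) + g r s (snd p)) (x, y)"
    proof (rule dense_eq2)
      fix x y assume xy: "x \<in> D" "y \<in> D"
      then obtain n as bs where *: "j \<le> n" "as \<in> A_alg n" "bs \<in> A_alg n" "x = \<Phi> n as" "y = \<Phi> n bs"
        using D_pair[OF xy, of j] by blast
      have "g r s (\<Phi> n as + \<Phi> n bs) = map2 (+) as bs ! j $$ (r, s)"
        using * rs by (simp add: \<Phi>_add[symmetric] g A_alg_add)
      then show "g r s (fst (x, y) + snd (x, y)) = g r s (fst (x, y)) + g r s (snd (x, y))"
        using * rs A_alg_nth[OF *(2,1)] A_alg_nth[OF *(3,1)] by (simp add: g A_alg_map2(1) k_def)
    qed (intro continuous_intros cont')+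
    then show ?thesis by simp
  qed
  have scale: "g r s (c *\<^sub>C x) = c * g r s x" if rs: "r < k" "s < k" for x c r s
  proof (rule dense_eq[where N = j])
    fix n as assume *: "j \<le> n" "as \<in> A_alg n"
    have "g r s (c *\<^sub>C \<Phi> n as) = map (\<lambda>a. c \<cdot>\<^sub>m a) as ! j $$ (r, s)"
      using * rs by (simp only: \<Phi>_scale[symmetric] g A_alg_smult)
    then show "g r s (c *\<^sub>C \<Phi> n as) = c * g r s (\<Phi> n as)"
      using * rs A_alg_nth[OF *(2,1)] by (simp add: g A_alg_map(1) k_def)
  qed (intro continuous_intros cont')+
  have mult: "g r s (x * y) = (\<Sum>t<k. g r t x * g t s y)" if rs: "r < k" "s < k" for x y r s
  proof -
    have "(\<lambda>p. g r s (fst p * snd p)) (x, y) = (\<lambda>p. \<Sum>t<k. g r t (fst p) * g t s (snd p)) (x, y)"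
    proof (rule dense_eq2)
      fix x y assume xy: "x \<in> D" "y \<in> D"
      then obtain n as bs where *: "j \<le> n" "as \<in> A_alg n" "bs \<in> A_alg n" "x = \<Phi> n as" "y = \<Phi> n bs"
        using D_pair[OF xy, of j] by blast
      have "g r s (\<Phi> n as * \<Phi> n bs) = map2 (*) as bs ! j $$ (r, s)"
        using * rs by (simp only: \<Phi>_mult[symmetric] g A_alg_mult)
      also have "\<dots> = (as ! j * bs ! j) $$ (r, s)" using * by (simp add: A_alg_map2(1))
      also have "\<dots> = (\<Sum>t<k. as ! j $$ (r, t) * bs ! j $$ (t, s))"
        using A_alg_nth[OF *(2,1)] A_alg_nth[OF *(3,1)] rs unfolding k_def by (rule mat_mult_index)
      finally show "g r s (fst (x, y) * snd (x, y)) = (\<Sum>t<k. g r t (fst (x, y)) * g t s (snd (x, y)))"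
        using * rs by (simp add: g)
    qed (intro continuous_intros cont')+
    then show ?thesis by simp
  qed
  have star: "g r s (adj x) = cnj (g s r x)" if rs: "r < k" "s < k" for x r s
  proof (rule dense_eq[where N = j])
    fix n as assume *: "j \<le> n" "as \<in> A_alg n"
    have "g r s (adj (\<Phi> n as)) = map mat_adjoint as ! j $$ (r, s)"
      using * rs by (simp only: \<Phi>_adj[symmetric] g A_alg_adjoint)
    then show "g r s (adj (\<Phi> n as)) = cnj (g s r (\<Phi> n as))"
      using * rs A_alg_nth[OF *(2,1)] by (simp add: g A_alg_map(1) k_def)
  qed (intro continuous_intros cont')+
  have "surj_star_hom_mat k p"
    unfolding surj_star_hom_mat_def
  proof (intro conjI allI)
    have "Y \<in> range p" if "Y \<in> carrier_mat k k" for Y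
      using pD[of j "slot j j Y"] that slot_A_alg[of Y j j]
      by (intro image_eqI[of Y p "\<Phi> j (slot j j Y)"]) (auto simp: slot_nth k_def)
    then show "range p = carrier_mat k k" using pc by auto
    show "p (x + y) = p x + p y" for x y by (rule eq_matI) (auto simp: p_def add)
    show "p (c *\<^sub>C x) = c \<cdot>\<^sub>m p x" for x c by (rule eq_matI) (auto simp: p_def scale)
    show "p (x * y) = p x * p y" for x y
    proof (rule eq_matI)
      fix r s assume "r < dim_row (p x * p y)" "s < dim_col (p x * p y)"
      then have rs: "r < k" "s < k" using pc[of x] pc[of y] by auto
      show "p (x * y) $$ (r, s) = (p x * p y) $$ (r, s)"
        unfolding mat_mult_index[OF pc pc rs] using rs by (simp add: p_def mult)
    qed (use pc[of x] pc[of y] pc[of "x * y"] in auto)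
    show "p (adj x) = mat_adjoint (p x)" for x by (rule eq_matI) (auto simp: p_def star)
  qed
  then show ?thesis using pD unfolding k_def by blast
qed

text \<open>Both maps have continuous entries by \<open>surj_star_hom_mat_entry\<close>, so
  agreement on the dense subalgebra suffices. This justifies the definite description in
  \<open>\<pi>_map\<close>.\<close>

lemma \<pi>_unique:
  assumes p: "surj_star_hom_mat (kdim j) p" "\<forall>n\<ge>j. \<forall>as\<in>A_alg n. p (\<Phi> n as) = as ! j"
    and p': "surj_star_hom_mat (kdim j) p'" "\<forall>n\<ge>j. \<forall>as\<in>A_alg n. p' (\<Phi> n as) = as ! j"
  shows "p = p'"
proof (rule ext, rule eq_matI)
  fix x r s
  have c: "p x \<in> carrier_mat (kdim j) (kdim j)" "p' x \<in> carrier_mat (kdim j) (kdim j)"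
    using p p' by (auto simp: surj_star_hom_mat_def)
  then show "dim_row (p x) = dim_row (p' x)" "dim_col (p x) = dim_col (p' x)" by auto
  assume "r < dim_row (p' x)" "s < dim_col (p' x)"
  then have rs: "r < kdim j" "s < kdim j" using c by auto
  show "p x $$ (r, s) = p' x $$ (r, s)"
    by (rule dense_eq[where N = j])
       (use p(2) p'(2) in \<open>auto intro!: linear_continuous_on surj_star_hom_mat_entry[OF p(1) rs]
          surj_star_hom_mat_entry[OF p'(1) rs]\<close>)
qed

lemma \<pi>_map: "surj_star_hom_mat (kdim j) (\<pi>_map \<Phi> j)"
  and \<pi>_map_\<Phi>: "j \<le> n \<Longrightarrow> as \<in> A_alg n \<Longrightarrow> \<pi>_map \<Phi> j (\<Phi> n as) = as ! j"
proof -
  have "\<exists>!p. surj_star_hom_mat (kdim j) p \<and> (\<forall>n\<ge>j. \<forall>as\<in>A_alg n. p (\<Phi> n as) = as ! j)"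
    using \<pi>_exists \<pi>_unique by (intro ex_ex1I) auto
  from theI'[OF this] show "surj_star_hom_mat (kdim j) (\<pi>_map \<Phi> j)"
    "j \<le> n \<Longrightarrow> as \<in> A_alg n \<Longrightarrow> \<pi>_map \<Phi> j (\<Phi> n as) = as ! j"
    unfolding \<pi>_map_def by blast+
qed

end

section \<open>The traces of the limit algebra\<close>

lemma (in tracial_state) trace_functional: "trace_functional \<tau>"
  using add scaleC commute by (simp add: trace_functional_def)

lemma tracial_state_iff: "tracial_state \<tau> \<longleftrightarrow> \<tau> \<in> tracial_states"
  by (auto simp: tracial_states_def tracial_state_def tracial_state_axioms_def state_def)

context dyadic_limit
begin

section \<open>Traces pulled back from the matrix quotients\<close>

lemma \<pi>_carrier: "\<pi>_map \<Phi> j x \<in> carrier_mat (kdim j) (kdim j)"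
  using \<pi>_map[of j] by (auto simp: surj_star_hom_mat_def)

lemma \<pi>_dim [simp]: "dim_row (\<pi>_map \<Phi> j x) = kdim j" "dim_col (\<pi>_map \<Phi> j x) = kdim j"
  using \<pi>_carrier[of j x] by auto

lemma \<pi>_scale: "\<pi>_map \<Phi> j (c *\<^sub>C x) = c \<cdot>\<^sub>m \<pi>_map \<Phi> j x"
  and \<pi>_mult: "\<pi>_map \<Phi> j (x * y) = \<pi>_map \<Phi> j x * \<pi>_map \<Phi> j y"
  and \<pi>_adj: "\<pi>_map \<Phi> j (adj x) = mat_adjoint (\<pi>_map \<Phi> j x)"
  and \<pi>_surj: "X \<in> carrier_mat (kdim j) (kdim j) \<Longrightarrow> \<exists>x. \<pi>_map \<Phi> j x = X"
proof -
  note p = \<pi>_map[of j, unfolded surj_star_hom_mat_def]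
  show "X \<in> carrier_mat (kdim j) (kdim j) \<Longrightarrow> \<exists>x. \<pi>_map \<Phi> j x = X"
    using p by (metis rangeE)
qed (use \<pi>_map[of j] in \<open>auto simp: surj_star_hom_mat_def\<close>)

lemma \<pi>_entry: "r < kdim j \<Longrightarrow> s < kdim j \<Longrightarrow> bounded_linear (\<lambda>x. \<pi>_map \<Phi> j x $$ (r, s))"
  by (rule surj_star_hom_mat_entry[OF \<pi>_map])

lemma \<pi>_diff_entry:
  "r < kdim j \<Longrightarrow> s < kdim j \<Longrightarrow> \<pi>_map \<Phi> j (x - y) $$ (r, s) = \<pi>_map \<Phi> j x $$ (r, s) - \<pi>_map \<Phi> j y $$ (r, s)"
  by (rule bounded_linear.linear[OF \<pi>_entry, THEN linear_diff])

lemma \<tau>_tr_tracial: "tracial_state (\<tau>_tr \<Phi> j)"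
proof -
  have eq: "\<tau>_tr \<Phi> j x = (\<Sum>i<kdim j. \<pi>_map \<Phi> j x $$ (i, i)) / of_nat (kdim j)" for x
    by (simp add: \<tau>_tr_def mat_trace_def)
  have "bounded_linear (\<tau>_tr \<Phi> j)"
    unfolding eq[abs_def]
    by (intro bounded_linear_compose[OF bounded_linear_divide] bounded_linear_sum \<pi>_entry) auto
  moreover have "\<tau>_tr \<Phi> j (c *\<^sub>C x) = c * \<tau>_tr \<Phi> j x" for c x
    by (simp add: \<tau>_tr_def \<pi>_scale mat_trace_smult[OF \<pi>_carrier])
  moreover have "\<tau>_tr \<Phi> j (adj x * x) \<in> \<real>\<^sub>\<ge>\<^sub>0" for x
  proof -
    have "\<tau>_tr \<Phi> j (adj x * x)
        = complex_of_real ((\<Sum>i<kdim j. \<Sum>k<kdim j. (cmod (\<pi>_map \<Phi> j x $$ (k, i)))\<^sup>2) / real (kdim j))"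
      by (simp add: \<tau>_tr_def \<pi>_mult \<pi>_adj mat_trace_adjoint_mult[OF \<pi>_carrier])
    also have "\<dots> \<in> \<real>\<^sub>\<ge>\<^sub>0"
      unfolding nonneg_Reals_of_real_iff by (intro divide_nonneg_nonneg sum_nonneg) auto
    finally show ?thesis .
  qed
  moreover have "\<tau>_tr \<Phi> j 1 = 1"
    using surj_star_hom_mat_one[OF \<pi>_map[of j]] by (simp add: \<tau>_tr_def mat_trace_one less_imp_neq[symmetric])
  moreover have "\<tau>_tr \<Phi> j (x * y) = \<tau>_tr \<Phi> j (y * x)" for x y
    by (simp add: \<tau>_tr_def \<pi>_mult mat_trace_comm[OF \<pi>_carrier \<pi>_carrier])
  ultimately show ?thesis unfolding tracial_state_iff tracial_states_def is_state_def by blast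
qed

lemma \<tau>_tr_q:
  "(gns_seminorm (\<tau>_tr \<Phi> j) x)\<^sup>2 = (\<Sum>i<kdim j. \<Sum>k<kdim j. (cmod (\<pi>_map \<Phi> j x $$ (k, i)))\<^sup>2) / real (kdim j)"
proof -
  interpret tracial_state "\<tau>_tr \<Phi> j" by (rule \<tau>_tr_tracial)
  show ?thesis
    unfolding q_square by (simp add: \<tau>_tr_def \<pi>_mult \<pi>_adj mat_trace_adjoint_mult[OF \<pi>_carrier])
qed

lemma \<tau>_tr_\<Phi>: "j \<le> n \<Longrightarrow> as \<in> A_alg n \<Longrightarrow> \<tau>_tr \<Phi> j (\<Phi> n as) = \<tau>_fin j as"
  by (simp add: \<tau>_tr_def \<tau>_fin_def \<pi>_map_\<Phi>)

lemma \<tau>_tr_U: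
  "i \<le> n \<Longrightarrow> \<tau>_tr \<Phi> i (U n j 0 0) = (if i = j then 1 / of_nat (kdim j) else 0)"
  unfolding U_def by (subst \<tau>_tr_\<Phi>) (auto simp: \<tau>_fin_def slot_A_alg mat_trace_slot mat_trace_emat)

text \<open>At stage i - 1 the weight comes from the new summand i alone and equals 1 / k_i = 1 /
  2^(i-1); each step back doubles it. Hence on stage n all traces with index above n
  coincide.\<close>

lemma \<tau>_tr_U_less:
  assumes "n < i" "j \<le> n" shows "\<tau>_tr \<Phi> i (U n j 0 0) = 1 / 2 ^ n"
proof -
  note tf = tracial_state.trace_functional[OF \<tau>_tr_tracial[of i]]
  obtain m where i: "i = Suc m" using assms by (cases i) auto
  have "n \<le> m" using assms i by simp
  then have "\<forall>j\<le>n. \<tau>_tr \<Phi> i (U n j 0 0) = 1 / 2 ^ n"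
  proof (induction rule: inc_induct)
    case base
    show ?case
      using trace_weight_step[OF tf, of _ m] \<tau>_tr_U[of i "Suc m"] by (auto simp: i)
  next
    case (step k)
    show ?case
      using trace_weight_step[OF tf, of _ k] step.IH by (auto simp: field_simps)
  qed
  then show ?thesis using assms by blast
qed

text \<open>The factor \<open>c\<close> is 1 when two traces are compared, and
  \<open>\<psi> 1\<close> when a functional is shown to be a multiple of a trace.\<close>

lemma trace_functional_eq_on:
  assumes "trace_functional \<psi>" "trace_functional \<phi>" "\<And>j. j \<le> n \<Longrightarrow> \<psi> (U n j 0 0) = c * \<phi> (U n j 0 0)"
    and "as \<in> A_alg n"
  shows "\<psi> (\<Phi> n as) = c * \<phi> (\<Phi> n as)"
  unfolding trace_expand[OF assms(1,4)] trace_expand[OF assms(2,4)] sum_distrib_left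
  by (intro sum.cong refl) (simp add: assms(3) mult.assoc)

subsection \<open>The limit trace\<close>

lemma \<tau>_tr_convergent: "convergent (\<lambda>i. \<tau>_tr \<Phi> i x)"
proof -
  have "Cauchy (\<lambda>i. \<tau>_tr \<Phi> i x)"
  proof (rule CauchyI)
    fix e :: real assume e: "e > 0"
    have "x \<in> closure D" by (simp add: dense)
    then obtain y where y: "y \<in> D" "dist y x < e / 2" using e closure_approachable[of x D] by (metis half_gt_zero)
    then obtain n as where n: "as \<in> A_alg n" "y = \<Phi> n as" by blast
    have "norm (\<tau>_tr \<Phi> i x - \<tau>_tr \<Phi> k x) < e" if ik: "i \<ge> Suc n" "k \<ge> Suc n" for i k
    proof -
      \<comment> \<open>Both traces agree on the stage containing y, so only the small element x - y
        contributes.\<close>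
      have "\<tau>_tr \<Phi> i y = 1 * \<tau>_tr \<Phi> k y"
        unfolding n(2)
      proof (rule trace_functional_eq_on[OF _ _ _ n(1)])
        show "\<tau>_tr \<Phi> i (U n j 0 0) = 1 * \<tau>_tr \<Phi> k (U n j 0 0)" if "j \<le> n" for j
          using ik that by (simp add: \<tau>_tr_U_less)
      qed (rule tracial_state.trace_functional[OF \<tau>_tr_tracial])+
      then have "\<tau>_tr \<Phi> i x - \<tau>_tr \<Phi> k x = \<tau>_tr \<Phi> i (x - y) - \<tau>_tr \<Phi> k (x - y)"
        using bounded_linear.linear[OF state.bl[OF tracial_state.axioms(1)[OF \<tau>_tr_tracial]], THEN linear_diff]
        by simp
      also have "norm \<dots> \<le> norm (x - y) + norm (x - y)"
        by (intro order_trans[OF norm_triangle_ineq4] add_mono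
            state.cmod_le_norm[OF tracial_state.axioms(1)[OF \<tau>_tr_tracial]])
      also have "\<dots> < e" using y by (simp add: dist_norm norm_minus_commute)
      finally show ?thesis .
    qed
    then show "\<exists>M. \<forall>m\<ge>M. \<forall>n\<ge>M. norm (\<tau>_tr \<Phi> m x - \<tau>_tr \<Phi> n x) < e" by blast
  qed
  then show ?thesis by (rule Cauchy_convergent)
qed

definition \<tau>inf :: "'a \<Rightarrow> complex" where
  "\<tau>inf x = lim (\<lambda>i. \<tau>_tr \<Phi> i x)"

lemma \<tau>inf_lim: "(\<lambda>i. \<tau>_tr \<Phi> i x) \<longlonglongrightarrow> \<tau>inf x"
  using \<tau>_tr_convergent[of x] by (simp add: \<tau>inf_def convergent_LIMSEQ_iff)

lemma \<tau>inf_tracial: "tracial_state \<tau>inf"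
proof -
  note st = tracial_state.axioms(1)[OF \<tau>_tr_tracial]
  note lin = bounded_linear.linear[OF state.bl[OF st]]
  have "bounded_linear \<tau>inf"
  proof (rule bounded_linear_intro[where K = 1])
    show "\<tau>inf (x + y) = \<tau>inf x + \<tau>inf y" for x y
      using LIMSEQ_unique[OF \<tau>inf_lim[of "x + y"]] tendsto_add[OF \<tau>inf_lim[of x] \<tau>inf_lim[of y]]
      by (simp add: linear_add[OF lin])
    show "\<tau>inf (r *\<^sub>R x) = r *\<^sub>R \<tau>inf x" for r x
      using LIMSEQ_unique[OF \<tau>inf_lim[of "r *\<^sub>R x"]] tendsto_scaleR[OF tendsto_const \<tau>inf_lim[of x]]
      by (simp add: linear_cmul[OF lin])
    show "norm (\<tau>inf x) \<le> norm x * 1" for x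
      using state.cmod_le_norm[OF st] by (intro LIMSEQ_le_const2[OF tendsto_norm[OF \<tau>inf_lim]]) auto
  qed
  moreover have "\<tau>inf (c *\<^sub>C x) = c * \<tau>inf x" for c x
    using LIMSEQ_unique[OF \<tau>inf_lim[of "c *\<^sub>C x"]] tendsto_mult_left[OF \<tau>inf_lim[of x], of c]
    by (simp add: state.scaleC[OF st])
  moreover have "\<tau>inf (adj x * x) \<in> \<real>\<^sub>\<ge>\<^sub>0" for x
    by (rule closed_sequentially[OF closed_nonneg_Reals_complex state.pos[OF st] \<tau>inf_lim])
  moreover have "\<tau>inf 1 = 1"
    using LIMSEQ_unique[OF \<tau>inf_lim[of 1]] by (simp add: state.unit[OF st])
  moreover have "\<tau>inf (x * y) = \<tau>inf (y * x)" for x y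
    using LIMSEQ_unique[OF \<tau>inf_lim[of "x * y"]] \<tau>inf_lim[of "y * x"] tracial_state.commute[OF \<tau>_tr_tracial]
    by simp
  ultimately show ?thesis unfolding tracial_state_iff tracial_states_def is_state_def by blast
qed

lemma \<tau>inf_U:
  assumes "j \<le> n" shows "\<tau>inf (U n j 0 0) = 1 / 2 ^ n"
proof -
  have ev: "\<forall>\<^sub>F i in sequentially. \<tau>_tr \<Phi> i (U n j 0 0) = 1 / 2 ^ n"
    using \<tau>_tr_U_less[OF _ assms] by (auto simp: eventually_sequentially intro!: exI[of _ "Suc n"])
  show ?thesis by (rule LIMSEQ_unique[OF \<tau>inf_lim tendsto_eventually[OF ev]])
qed

lemma \<tau>inf_\<Phi>: "as \<in> A_alg n \<Longrightarrow> \<tau>inf (\<Phi> n as) = (\<Sum>j\<le>n. mat_trace (as ! j)) / 2 ^ n"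
  by (simp add: trace_expand[OF tracial_state.trace_functional[OF \<tau>inf_tracial]] \<tau>inf_U sum_divide_distrib)

section \<open>Weights of a trace functional, the factor property and the types\<close>

lemma weight_formula:
  assumes \<psi>: "trace_functional \<psi>" and w: "\<And>j. (\<lambda>n. \<psi> (U n j 0 0)) \<longlonglongrightarrow> w j" and j: "j \<le> n"
  shows "\<psi> (U n j 0 0) = w j + (\<psi> 1 - (\<Sum>i\<le>n. w i * of_nat (kdim i))) / 2 ^ n"
proof -
  have diff: "\<psi> (U n i 0 0) - \<psi> (U n j 0 0) = w i - w j" if i: "i \<le> n" for i
  proof -
    have "\<psi> (U (n + k) i 0 0) - \<psi> (U (n + k) j 0 0) = \<psi> (U n i 0 0) - \<psi> (U n j 0 0)" for k
    proof (induction k)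
      case (Suc k)
      then show ?case
        using trace_weight_step[OF \<psi>, of i "n + k"] trace_weight_step[OF \<psi>, of j "n + k"] i j by simp
    qed simp
    moreover have "(\<lambda>k. \<psi> (U (k + n) i 0 0) - \<psi> (U (k + n) j 0 0)) \<longlonglongrightarrow> w i - w j"
      by (intro tendsto_diff LIMSEQ_ignore_initial_segment w)
    ultimately show ?thesis by (simp add: add.commute LIMSEQ_const_iff)
  qed
  \<comment> \<open>The excess of a weight over its limit; by \<open>diff\<close> it is the same for
    all summands of stage n.\<close>
  define s where "s = \<psi> (U n j 0 0) - w j"
  have "\<psi> 1 = (\<Sum>i\<le>n. (w i + s) * of_nat (kdim i))"
  proof -
    have "\<psi> (U n i 0 0) = w i + s" if "i \<le> n" for i using diff[OF that] by (simp add: s_def algebra_simps)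
    then show ?thesis unfolding trace_weight_sum[OF \<psi>, of n] by (intro sum.cong refl) simp
  qed
  also have "\<dots> = (\<Sum>i\<le>n. w i * of_nat (kdim i)) + s * of_nat (\<Sum>i\<le>n. kdim i)"
    by (simp add: distrib_right sum.distrib sum_distrib_left)
  finally have "\<psi> 1 - (\<Sum>i\<le>n. w i * of_nat (kdim i)) = s * 2 ^ n" by (simp add: sum_kdim)
  then show ?thesis by (simp add: s_def)
qed

lemma U_projection: "adj (U n j 0 0) * U n j 0 0 = U n j 0 0" if "j \<le> n"
  using that by (simp add: U_adj U_mult)

lemma q_U:
  assumes "tracial_state \<tau>" "j \<le> n" shows "(gns_seminorm \<tau> (U n j 0 0))\<^sup>2 = Re (\<tau> (U n j 0 0))"
  using state.q_square[OF tracial_state.axioms(1)[OF assms(1)], of "U n j 0 0"] assms(2)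
  by (simp add: U_projection)

lemma continuous_trace_functional: "bounded_linear \<psi> \<Longrightarrow> continuous_on UNIV \<psi>"
  by (rule linear_continuous_on)

lemma \<tau>inf_factor: "is_factor (gns_space \<tau>inf) (gns_vN \<tau>inf)"
proof -
  interpret tracial_state \<tau>inf by (rule \<tau>inf_tracial)
  show ?thesis
  proof (rule is_factorI)
    fix \<psi> :: "'a \<Rightarrow> complex"
    assume \<psi>: "bounded_linear \<psi>" "\<And>c x. \<psi> (c *\<^sub>C x) = c * \<psi> x" "\<And>x y. \<psi> (x * y) = \<psi> (y * x)"
      and "\<exists>C. \<forall>x. cmod (\<psi> x) \<le> C * q x"
    then obtain C where C: "\<And>x. cmod (\<psi> x) \<le> C * q x" by blast
    have tf: "trace_functional \<psi>"
      using \<psi> linear_add[OF bounded_linear.linear[OF \<psi>(1)]] by (auto simp: trace_functional_def)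
    have w: "(\<lambda>n. \<psi> (U n j 0 0)) \<longlonglongrightarrow> 0" for j
    proof (rule Lim_null_comparison)
      \<comment> \<open>A minimal projection of stage n has trace 2^(-n), hence seminorm 2^(-n/2);
        the bound on \<open>\<psi>\<close> makes its weights tend to 0.\<close>
      have qU: "q (U n j 0 0) = sqrt ((1 / 2) ^ n)" if "j \<le> n" for n
        using q_U[OF \<tau>inf_tracial that] \<tau>inf_U[OF that]
        by (intro real_sqrt_unique[symmetric]) (simp_all add: power_divide Re_divide_of_real[of 1 "2 ^ n", simplified])
      show "\<forall>\<^sub>F n in sequentially. norm (\<psi> (U n j 0 0)) \<le> C * sqrt ((1 / 2) ^ n)"
        using C qU by (auto simp: eventually_sequentially intro!: exI[of _ j]) (metis)
      have "(\<lambda>n. C * sqrt ((1 / 2) ^ n)) \<longlonglongrightarrow> C * sqrt 0"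
        by (intro tendsto_intros LIMSEQ_power_zero) simp
      then show "(\<lambda>n. C * sqrt ((1 / 2) ^ n)) \<longlonglongrightarrow> 0" by simp
    qed
    \<comment> \<open>With all limits equal to 0, \<open>weight_formula\<close> says that each
      weight at stage n is \<open>\<psi> 1\<close> divided by 2^n, a multiple of the weight of
      \<open>\<tau>inf\<close>.\<close>
    have eq: "\<psi> (\<Phi> n as) = \<psi> 1 * \<tau>inf (\<Phi> n as)" if "as \<in> A_alg n" for n as
      by (rule trace_functional_eq_on[OF tf trace_functional _ that])
         (use weight_formula[OF tf w] \<tau>inf_U in auto)
    have "\<psi> x = \<psi> 1 * \<tau>inf x" for x
    proof (rule dense_eq[where F = \<psi> and G = "\<lambda>x. \<psi> 1 * \<tau>inf x" and N = 0])
      show "continuous_on UNIV (\<lambda>x. \<psi> 1 * \<tau>inf x)"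
        by (rule continuous_on_mult[OF continuous_on_const continuous_trace_functional[OF bl]])
    qed (rule continuous_trace_functional[OF \<psi>(1)], rule eq)
    then show "\<exists>c. \<forall>x. \<psi> x = c * \<tau>inf x" by blast
  qed
qed

text \<open>From stage J on, minimal projections outside summand J have seminorm 0, so the bound on
  \<open>\<psi>\<close> leaves weight on summand J alone, where it is fixed by
  \<open>\<psi> 1\<close>.\<close>

lemma \<tau>_tr_factor: "is_factor (gns_space (\<tau>_tr \<Phi> J)) (gns_vN (\<tau>_tr \<Phi> J))"
proof -
  interpret tracial_state "\<tau>_tr \<Phi> J" by (rule \<tau>_tr_tracial)
  show ?thesis
  proof (rule is_factorI)
    fix \<psi> :: "'a \<Rightarrow> complex"
    assume \<psi>: "bounded_linear \<psi>" "\<And>c x. \<psi> (c *\<^sub>C x) = c * \<psi> x" "\<And>x y. \<psi> (x * y) = \<psi> (y * x)"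
      and "\<exists>C. \<forall>x. cmod (\<psi> x) \<le> C * q x"
    then obtain C where C: "\<And>x. cmod (\<psi> x) \<le> C * q x" by blast
    have tf: "trace_functional \<psi>"
      using \<psi> linear_add[OF bounded_linear.linear[OF \<psi>(1)]] by (auto simp: trace_functional_def)
    have zero: "\<psi> (U n i 0 0) = 0" if "J \<le> n" "i \<le> n" "i \<noteq> J" for n i
    proof -
      have "(q (U n i 0 0))\<^sup>2 = 0"
        using q_U[OF \<tau>_tr_tracial that(2)] \<tau>_tr_U[OF that(1)] that(3) by simp
      then show ?thesis using C[of "U n i 0 0"] by simp
    qed
    have eq: "\<psi> (\<Phi> n as) = \<psi> 1 * \<tau>_tr \<Phi> J (\<Phi> n as)" if "J \<le> n" "as \<in> A_alg n" for n as
    proof (rule trace_functional_eq_on[OF tf trace_functional _ that(2)])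
      have "\<psi> 1 = (\<Sum>i\<le>n. if i = J then \<psi> (U n i 0 0) * of_nat (kdim i) else 0)"
        unfolding trace_weight_sum[OF tf, of n] using zero[OF that(1)] by (intro sum.cong refl) auto
      then have "\<psi> 1 = \<psi> (U n J 0 0) * of_nat (kdim J)" using that(1) by simp
      then show "\<psi> (U n i 0 0) = \<psi> 1 * \<tau>_tr \<Phi> J (U n i 0 0)" if "i \<le> n" for i
        using zero[OF \<open>J \<le> n\<close> that] \<tau>_tr_U[OF \<open>J \<le> n\<close>] by (simp add: less_imp_neq[symmetric])
    qed
    have "\<psi> x = \<psi> 1 * \<tau>_tr \<Phi> J x" for x
    proof (rule dense_eq[where F = \<psi> and G = "\<lambda>x. \<psi> 1 * \<tau>_tr \<Phi> J x" and N = J])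
      show "continuous_on UNIV (\<lambda>x. \<psi> 1 * \<tau>_tr \<Phi> J x)"
        by (rule continuous_on_mult[OF continuous_on_const continuous_trace_functional[OF bl]])
    qed (rule continuous_trace_functional[OF \<psi>(1)], rule eq)
    then show "\<exists>c. \<forall>x. \<psi> x = c * \<tau>_tr \<Phi> J x" by blast
  qed
qed

text \<open>The seminorm is the normalized Hilbert-Schmidt norm of the image in the J-th matrix
  algebra. That algebra is finite-dimensional, so the quotient is already complete and the GNS space
  is the matrix algebra itself.\<close>

lemma \<tau>_tr_type_I: "trace_type_I (\<tau>_tr \<Phi> J) (kdim J)"
proof -
  interpret tracial_state "\<tau>_tr \<Phi> J" by (rule \<tau>_tr_tracial)
  let ?k = "kdim J"
  have null: "q x = 0" if "\<And>r s. r < ?k \<Longrightarrow> s < ?k \<Longrightarrow> \<pi>_map \<Phi> J x $$ (r, s) = 0" for x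
    using \<tau>_tr_q[of J x] that by simp
  have entry: "cmod (\<pi>_map \<Phi> J x $$ (r, s)) \<le> sqrt ?k * q x" if rs: "r < ?k" "s < ?k" for x r s
  proof -
    have "(cmod (\<pi>_map \<Phi> J x $$ (r, s)))\<^sup>2 \<le> (\<Sum>i<?k. \<Sum>k<?k. (cmod (\<pi>_map \<Phi> J x $$ (k, i)))\<^sup>2)"
      by (rule entry_square_le_sum[OF rs])
    also have "\<dots> = (sqrt ?k * q x)\<^sup>2"
      by (simp add: \<tau>_tr_q power_mult_distrib less_imp_neq[symmetric])
    finally show ?thesis by (rule power2_le_imp_le) simp
  qed
  have \<pi>U: "\<pi>_map \<Phi> J (U J J r s) = emat ?k r s" for r s
    by (simp add: U_def \<pi>_map_\<Phi> slot_A_alg slot_nth)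
  have "factor_type_I H M ?k"
  proof (rule factor_type_I_matrix_units[where u = "U J J"])
    show "is_factor H M" by (rule \<tau>_tr_factor)
  next
    fix x assume x: "x \<in> Cau"
    have "convergent (\<lambda>n. \<pi>_map \<Phi> J (x n) $$ (r, s))" if rs: "r < ?k" "s < ?k" for r s
    proof (rule Cauchy_convergent, rule CauchyI)
      fix e :: real assume e: "e > 0"
      have k: "sqrt ?k > 0" by simp
      obtain N where N: "\<forall>m\<ge>N. \<forall>n\<ge>N. q (x m - x n) < e / sqrt ?k"
        using CauD[OF x, of "e / sqrt ?k"] e k by auto
      have "norm (\<pi>_map \<Phi> J (x m) $$ (r, s) - \<pi>_map \<Phi> J (x n) $$ (r, s)) < e" if "m \<ge> N" "n \<ge> N" for m n
      proof -
        have "norm (\<pi>_map \<Phi> J (x m) $$ (r, s) - \<pi>_map \<Phi> J (x n) $$ (r, s)) \<le> sqrt ?k * q (x m - x n)"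
          using entry[OF rs, of "x m - x n"] by (simp add: \<pi>_diff_entry rs)
        also have "\<dots> < sqrt ?k * (e / sqrt ?k)"
          using N that k by (intro mult_strict_left_mono) auto
        also have "\<dots> = e" using k by (simp add: less_imp_neq[symmetric])
        finally show ?thesis .
      qed
      then show "\<exists>M. \<forall>m\<ge>M. \<forall>n\<ge>M. norm (\<pi>_map \<Phi> J (x m) $$ (r, s) - \<pi>_map \<Phi> J (x n) $$ (r, s)) < e"
        by blast
    qed
    then have lim: "(\<lambda>n. \<pi>_map \<Phi> J (x n) $$ (r, s)) \<longlonglongrightarrow> lim (\<lambda>n. \<pi>_map \<Phi> J (x n) $$ (r, s))"
      if "r < ?k" "s < ?k" for r s
      using that by (simp add: convergent_LIMSEQ_iff)
    \<comment> \<open>Surjectivity lifts the matrix of entrywise limits to an element of the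
      algebra.\<close>
    obtain a where a: "\<pi>_map \<Phi> J a = mat ?k ?k (\<lambda>(r, s). lim (\<lambda>n. \<pi>_map \<Phi> J (x n) $$ (r, s)))"
      using \<pi>_surj[of "mat ?k ?k (\<lambda>(r, s). lim (\<lambda>n. \<pi>_map \<Phi> J (x n) $$ (r, s)))" J] by auto
    have "(\<lambda>n. (\<Sum>i<?k. \<Sum>k<?k. (cmod (\<pi>_map \<Phi> J (x n) $$ (k, i) - \<pi>_map \<Phi> J a $$ (k, i)))\<^sup>2) / real ?k)
        \<longlonglongrightarrow> (\<Sum>i<?k. \<Sum>k<?k. (cmod (\<pi>_map \<Phi> J a $$ (k, i) - \<pi>_map \<Phi> J a $$ (k, i)))\<^sup>2) / real ?k"
      using lim a by (intro tendsto_intros) auto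
    then have "(\<lambda>n. (q (x n - a))\<^sup>2) \<longlonglongrightarrow> 0" by (simp add: \<tau>_tr_q \<pi>_diff_entry)
    then have "(\<lambda>n. sqrt ((q (x n - a))\<^sup>2)) \<longlonglongrightarrow> sqrt 0" by (intro tendsto_intros)
    then have "cl x = v a" using x by (simp add: cl_eq_iff)
    then show "\<exists>a. cl x = v a" ..
  next
    \<comment> \<open>The sum is the unit of summand J of stage J, which becomes 1 only after
      applying the quotient map.\<close>
    show "q ((\<Sum>r<?k. U J J r r) - 1) = 0"
    proof (rule null)
      fix r s assume rs: "r < ?k" "s < ?k"
      have "\<pi>_map \<Phi> J (\<Sum>r<?k. U J J r r) $$ (r, s) = (\<Sum>i<?k. emat ?k i i $$ (r, s))"
        unfolding \<pi>U[symmetric] by (rule linear_sum[OF bounded_linear.linear[OF \<pi>_entry[OF rs]]])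
      also have "\<dots> = (\<Sum>i<?k. if i = r then (if r = s then 1 else 0) else 0)"
        using rs by (intro sum.cong refl) auto
      also have "\<dots> = 1\<^sub>m ?k $$ (r, s)" using rs by simp
      finally show "\<pi>_map \<Phi> J ((\<Sum>r<?k. U J J r r) - 1) $$ (r, s) = 0"
        using rs by (simp add: \<pi>_diff_entry surj_star_hom_mat_one[OF \<pi>_map])
    qed
  next
    fix r a assume r: "r < ?k"
    let ?c = "\<pi>_map \<Phi> J a $$ (r, r)"
    have "\<pi>_map \<Phi> J (U J J r r * (a * U J J r r)) = \<pi>_map \<Phi> J (?c *\<^sub>C U J J r r)"
      unfolding \<pi>_mult \<pi>_scale \<pi>U by (rule emat_corner[OF \<pi>_carrier r])
    then have "q (U J J r r * (a * U J J r r) - ?c *\<^sub>C U J J r r) = 0"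
      by (intro null) (simp only: \<pi>_diff_entry diff_self)
    then show "\<exists>c. q (U J J r r * (a * U J J r r) - c *\<^sub>C U J J r r) = 0" ..
  qed (auto simp: U_mult U_adj)
  then show ?thesis by (simp add: trace_type_I_def)
qed

text \<open>In \<open>A_alg (m + 2)\<close> the image of \<open>A_alg m\<close> has last component of the form \<open>diag c c\<close>, so it
  commutes with the corner partial isometry.\<close>

lemma central_partial_isometry:
  obtains u where "u * u = 0" "(u * adj u) * (u * adj u) = u * adj u"
    "\<And>as. as \<in> A_alg m \<Longrightarrow> u * \<Phi> m as = \<Phi> m as * u"
    "\<And>as. as \<in> A_alg m \<Longrightarrow> adj u * \<Phi> m as = \<Phi> m as * adj u"
    "\<And>as. as \<in> A_alg m \<Longrightarrow> \<tau>inf (\<Phi> m as * (u * adj u)) = \<tau>inf (\<Phi> m as) / 4"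
proof -
  define h :: nat where "h = 2 ^ m"
  \<comment> \<open>The last component at stage m + 1 is c = diag(a_0, ..., a_m), of size h = 2^m;
    at stage m + 2 it is the diagonal of all earlier components, that is, of a_0, ..., a_m and c,
    which is diag(c, c).\<close>
  define N where "N = Suc (Suc m)"
  define Z where "Z = (0\<^sub>m h h :: complex mat)"
  define I where "I = (1\<^sub>m h :: complex mat)"
  have ZI [simp]: "Z \<in> carrier_mat h h" "I \<in> carrier_mat h h" by (auto simp: Z_def I_def)
  have kN: "kdim N = h + h" by (simp add: N_def h_def)
  define E where "E = four_block_mat Z I Z Z"
  define E' where "E' = four_block_mat Z Z I Z"
  define F where "F = four_block_mat I Z Z Z"
  have car [simp]: "E \<in> carrier_mat (kdim N) (kdim N)" "E' \<in> carrier_mat (kdim N) (kdim N)"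
    "F \<in> carrier_mat (kdim N) (kdim N)"
    unfolding kN E_def E'_def F_def by auto
  have Zm [simp]: "Z * X = Z" "X * Z = Z" "I * X = X" "X * I = X" "Z + X = X" "X + Z = X"
    if "X \<in> carrier_mat h h" for X
    using that by (auto simp: Z_def I_def)
  have EE: "E * E = slot N N (0\<^sub>m (kdim N) (kdim N)) ! N"
  proof -
    have "E * E = four_block_mat Z Z Z Z"
      unfolding E_def by (subst mult_four_block_mat[where ?nr1.0 = h and ?nr2.0 = h and ?n1.0 = h and ?n2.0 = h and ?nc1.0 = h and ?nc2.0 = h]) auto
    also have "\<dots> = 0\<^sub>m (kdim N) (kdim N)" unfolding Z_def kN by (rule eq_matI) auto
    finally show ?thesis by (simp add: slot_nth)
  qed
  have EE': "E * E' = F"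
    unfolding E_def E'_def F_def by (subst mult_four_block_mat[where ?nr1.0 = h and ?nr2.0 = h and ?n1.0 = h and ?n2.0 = h and ?nc1.0 = h and ?nc2.0 = h]) auto
  have FF: "F * F = F"
    unfolding F_def by (subst mult_four_block_mat[where ?nr1.0 = h and ?nr2.0 = h and ?n1.0 = h and ?n2.0 = h and ?nc1.0 = h and ?nc2.0 = h]) auto
  have adjE: "mat_adjoint E = E'"
    unfolding E_def E'_def Z_def I_def by (rule eq_matI) auto
  define u where "u = \<Phi> N (slot N N E)"
  have sE: "slot N N X \<in> A_alg N" if "X \<in> carrier_mat (kdim N) (kdim N)" for X
    using slot_A_alg[OF that] .
  have u': "adj u = \<Phi> N (slot N N E')"
    unfolding u_def \<Phi>_adj[OF sE[OF car(1)], symmetric] slot_adjoint[OF car(1)] adjE ..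
  have prod: "\<Phi> N (slot N N X) * \<Phi> N (slot N N Y) = \<Phi> N (slot N N (X * Y))"
    if "X \<in> carrier_mat (kdim N) (kdim N)" "Y \<in> carrier_mat (kdim N) (kdim N)" for X Y
    using that by (simp add: \<Phi>_mult[symmetric] sE slot_mult(1) slot_nth)
  have uu: "u * adj u = \<Phi> N (slot N N F)"
    unfolding u' unfolding u_def prod[OF car(1,2)] EE' ..
  have lift: "\<exists>bs c. bs \<in> A_alg N \<and> \<Phi> N bs = \<Phi> m as \<and> c \<in> carrier_mat h h \<and>
      bs ! N = four_block_mat c Z Z c \<and> mat_trace c = (\<Sum>j\<le>m. mat_trace (as ! j))"
    if as: "as \<in> A_alg m" for as
  proof (intro exI conjI)
    let ?b = "\<phi>_map m as"
    let ?c = "diag_block_mat as"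
    have b: "?b \<in> A_alg (Suc m)" using \<phi>_map_A_alg[OF as] .
    show "\<phi>_map (Suc m) ?b \<in> A_alg N" unfolding N_def by (rule \<phi>_map_A_alg[OF b])
    show "\<Phi> N (\<phi>_map (Suc m) ?b) = \<Phi> m as" by (simp add: N_def compat b as)
    show c: "?c \<in> carrier_mat h h" unfolding h_def by (rule diag_block_carrier[OF as])
    have "\<phi>_map (Suc m) ?b ! N = diag_block_mat ?b" unfolding N_def by (rule \<phi>_map_last[OF b])
    also have "\<dots> = four_block_mat ?c Z Z ?c"
      using c unfolding \<phi>_map_def diag_block_mat_last Let_def Z_def by (simp add: carrier_matD)
    finally show "\<phi>_map (Suc m) ?b ! N = four_block_mat ?c Z Z ?c" .
    show "mat_trace ?c = (\<Sum>j\<le>m. mat_trace (as ! j))" by (rule mat_trace_diag_block_A_alg[OF as])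
  qed
  show thesis
  proof (rule that[of u])
    show "u * u = 0"
      unfolding u_def prod[OF car(1) car(1)] EE
      by (rule \<Phi>_zero) (auto simp: slot_nth intro!: slot_A_alg)
    show "(u * adj u) * (u * adj u) = u * adj u"
      unfolding uu prod[OF car(3,3)] FF ..
    fix as assume as: "as \<in> A_alg m"
    then obtain bs c where bs: "bs \<in> A_alg N" "\<Phi> N bs = \<Phi> m as" "c \<in> carrier_mat h h"
      "bs ! N = four_block_mat c Z Z c" "mat_trace c = (\<Sum>j\<le>m. mat_trace (as ! j))"
      using lift by blast
    have cE: "E * bs ! N = bs ! N * E" "E' * bs ! N = bs ! N * E'"
      unfolding bs(4) E_def E'_def using bs(3)
      by (subst (1 2) mult_four_block_mat[where ?nr1.0 = h and ?nr2.0 = h and ?n1.0 = h and ?n2.0 = h and ?nc1.0 = h and ?nc2.0 = h]; simp)+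
    have comm: "\<Phi> N (slot N N X) * \<Phi> m as = \<Phi> m as * \<Phi> N (slot N N X)"
      if "X \<in> carrier_mat (kdim N) (kdim N)" "X * bs ! N = bs ! N * X" for X
      unfolding bs(2)[symmetric] using that bs(1)
      by (simp add: \<Phi>_mult[symmetric] sE slot_mult)
    show "u * \<Phi> m as = \<Phi> m as * u" unfolding u_def by (rule comm[OF car(1) cE(1)])
    show "adj u * \<Phi> m as = \<Phi> m as * adj u" unfolding u' by (rule comm[OF car(2) cE(2)])
    have cF: "bs ! N * F \<in> carrier_mat (kdim N) (kdim N)"
      using A_alg_nth[OF bs(1), of N] by (intro mult_carrier_mat[OF _ car(3)]) simp
    have "bs ! N * F = four_block_mat c Z Z Z"
      unfolding bs(4) F_def using bs(3) by (subst mult_four_block_mat[where ?nr1.0 = h and ?nr2.0 = h and ?n1.0 = h and ?n2.0 = h and ?nc1.0 = h and ?nc2.0 = h]) auto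
    then have trF: "mat_trace (bs ! N * F) = mat_trace c"
      using bs(3) by (simp add: mat_trace_four_block Z_def) (simp add: mat_trace_def)
    have "\<Phi> m as * (u * adj u) = \<Phi> N (slot N N (bs ! N * F))"
      unfolding uu bs(2)[symmetric]
      by (simp add: \<Phi>_mult[OF bs(1) sE[OF car(3)], symmetric] slot_mult(2)[OF car(3) bs(1)])
    then have "\<tau>inf (\<Phi> m as * (u * adj u)) = (\<Sum>j\<le>N. mat_trace (slot N N (bs ! N * F) ! j)) / 2 ^ N"
      by (simp only: \<tau>inf_\<Phi>[OF sE[OF cF]])
    also have "(\<Sum>j\<le>N. mat_trace (slot N N (bs ! N * F) ! j)) = (\<Sum>j\<le>N. if j = N then mat_trace c else 0)"
      by (intro sum.cong refl) (auto simp: mat_trace_slot trF)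
    also have "\<dots> = mat_trace c" by simp
    \<comment> \<open>The matrix trace of c is divided by 2^(m+2) here and by 2^m for
      \<open>\<Phi> m as\<close>, whence the 1/4.\<close>
    finally show "\<tau>inf (\<Phi> m as * (u * adj u)) = \<tau>inf (\<Phi> m as) / 4"
      by (simp add: \<tau>inf_\<Phi>[OF as] bs(5) N_def)
  qed
qed

lemma \<tau>inf_type_II1: "trace_type_II1 \<tau>inf"
proof -
  interpret tracial_state \<tau>inf by (rule \<tau>inf_tracial)
  have "P = op_zero H" if P: "abelian_projection H M P" for P
  proof (rule abelian_projection_eq_zero[OF _ P])
    fix x :: 'a and e :: real assume e: "e > 0"
    have "x \<in> closure D" by (simp add: dense)
    then obtain b where b: "b \<in> D" "dist b x < e" using e closure_approachable[of x D] by metis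
    then obtain m as where m: "as \<in> A_alg m" "b = \<Phi> m as" by blast
    obtain u where u: "u * u = 0" "(u * adj u) * (u * adj u) = u * adj u"
      "\<And>as. as \<in> A_alg m \<Longrightarrow> u * \<Phi> m as = \<Phi> m as * u"
      "\<And>as. as \<in> A_alg m \<Longrightarrow> adj u * \<Phi> m as = \<Phi> m as * adj u"
      "\<And>as. as \<in> A_alg m \<Longrightarrow> \<tau>inf (\<Phi> m as * (u * adj u)) = \<tau>inf (\<Phi> m as) / 4"
      using central_partial_isometry[of m] by metis
    have bb: "adj b * b = \<Phi> m (map2 (*) (map mat_adjoint as) as)"
      by (simp add: m \<Phi>_mult A_alg_adjoint \<Phi>_adj)
    have "q (x - b) < e" using q_le_norm[of "x - b"] b by (simp add: dist_norm norm_minus_commute)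
    moreover have "\<tau>inf (adj b * b * (u * adj u)) = \<tau>inf (adj b * b) / 4"
      unfolding bb by (rule u(5)) (intro A_alg_mult A_alg_adjoint m(1))
    ultimately show "\<exists>b u. q (x - b) < e \<and> u * u = 0 \<and> (u * adj u) * (u * adj u) = u * adj u \<and>
        u * b = b * u \<and> adj u * b = b * adj u \<and> \<tau>inf (adj b * b * (u * adj u)) = \<tau>inf (adj b * b) / 4"
      using u(1-4) m by blast
  qed
  then show ?thesis
    using \<tau>inf_factor finite_projection_id by (auto simp: trace_type_II1_def factor_type_II1_def)
qed

lemma \<tau>_tr_not_II1: "\<not> trace_type_II1 (\<tau>_tr \<Phi> j)"
  using tracial_state.factor_type_I_not_II1[OF \<tau>_tr_tracial] \<tau>_tr_type_I
  by (auto simp: trace_type_I_def trace_type_II1_def)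

end

section \<open>Probability measures on the one-point compactification of the naturals\<close>

text \<open>Compact sets of a discrete space are the finite ones, so the open sets containing the
  point \<open>None\<close> at infinity are the cofinite ones.\<close>

lemma openin_\<Delta>_space:
  "openin \<Delta>_space V \<longleftrightarrow> None \<notin> V \<or> finite (- V)"
proof
  assume "openin \<Delta>_space V"
  then consider U where "V = Some ` U" | C where "finite C" "V = insert None (Some ` (UNIV - C))"
    by (auto simp: \<Delta>_space_def openin_Alexandroff_compactification compactin_discrete_topology)
  then show "None \<notin> V \<or> finite (- V)"
  proof cases
    case 2
    have "- V \<subseteq> Some ` C"
    proof
      show "x \<in> Some ` C" if "x \<in> - V" for x using that 2 by (cases x) auto
    qed
    then show ?thesis using 2 finite_subset by blast
  qed auto
next
  assume V: "None \<notin> V \<or> finite (- V)"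
  show "openin \<Delta>_space V"
  proof (cases "None \<in> V")
    case False
    have "x \<in> V \<longleftrightarrow> x \<in> Some ` (Some -` V)" for x using False by (cases x) auto
    then have "V = Some ` (Some -` V)" by blast
    then show ?thesis
      unfolding \<Delta>_space_def openin_Alexandroff_compactification
      by (intro disjI1 exI[of _ "Some -` V"] conjI) simp
  next
    case True
    let ?C = "Some -` (- V)"
    have "finite ?C" using V True by (intro finite_vimageI) auto
    moreover have "x \<in> V \<longleftrightarrow> x \<in> insert None (Some ` (UNIV - ?C))" for x
      using True by (cases x) auto
    then have "V = insert None (Some ` (UNIV - ?C))" by blast
    ultimately show ?thesis
      by (auto simp: \<Delta>_space_def openin_Alexandroff_compactification compactin_discrete_topology)
  qed
qed

lemma topspace_\<Delta>_space [simp]: "topspace \<Delta>_space = UNIV"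
  by (auto simp: \<Delta>_space_def UNIV_option_conv)

lemma continuous_map_\<Delta>_space_iff:
  fixes f :: "nat option \<Rightarrow> 'b::metric_space"
  shows "continuous_map \<Delta>_space euclidean f \<longleftrightarrow> (\<lambda>j. f (Some j)) \<longlonglongrightarrow> f None"
proof
  assume c: "continuous_map \<Delta>_space euclidean f"
  show "(\<lambda>j. f (Some j)) \<longlonglongrightarrow> f None"
  proof (rule topological_tendstoI)
    fix S assume S: "open S" "f None \<in> S"
    have "openin \<Delta>_space {i. f i \<in> S}"
      using c S openin_continuous_map_preimage[OF c, of S] by simp
    then have "finite (- {i. f i \<in> S})" using S by (auto simp: openin_\<Delta>_space)
    then have "finite (Some -` (- {i. f i \<in> S}))" by (intro finite_vimageI) auto
    then have "finite {j. f (Some j) \<notin> S}" by (simp add: vimage_def)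
    then show "\<forall>\<^sub>F j in sequentially. f (Some j) \<in> S"
      by (simp add: cofinite_eq_sequentially[symmetric] eventually_cofinite)
  qed
next
  assume lim: "(\<lambda>j. f (Some j)) \<longlonglongrightarrow> f None"
  have "openin \<Delta>_space {i. f i \<in> S}" if S: "open S" for S
  proof (cases "f None \<in> S")
    case True
    have "finite {j. f (Some j) \<notin> S}"
      using topological_tendstoD[OF lim S True]
      by (simp add: cofinite_eq_sequentially[symmetric] eventually_cofinite)
    moreover have "- {i. f i \<in> S} \<subseteq> Some ` {j. f (Some j) \<notin> S}"
    proof
      show "x \<in> Some ` {j. f (Some j) \<notin> S}" if "x \<in> - {i. f i \<in> S}" for x
        using that True by (cases x) auto
    qed
    ultimately have "finite (- {i. f i \<in> S})" by (meson finite_imageI finite_subset)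
    then show ?thesis by (simp add: openin_\<Delta>_space)
  qed (simp add: openin_\<Delta>_space)
  then show "continuous_map \<Delta>_space euclidean f" by (simp add: continuous_map)
qed

text \<open>Sets that avoid \<open>None\<close> are open, and the others are complements of such
  sets.\<close>

lemma sigma_sets_\<Delta>_space: "sigma_sets UNIV {U. openin \<Delta>_space U} = UNIV"
proof -
  have basic: "U \<in> sigma_sets UNIV {U. openin \<Delta>_space U}" if "None \<notin> U" for U
    using that by (intro sigma_sets.Basic) (simp add: openin_\<Delta>_space)
  have "U \<in> sigma_sets UNIV {U. openin \<Delta>_space U}" for U
  proof (cases "None \<in> U")
    case True
    then have "UNIV - (- U) \<in> sigma_sets UNIV {U. openin \<Delta>_space U}"
      by (intro sigma_sets.Compl basic) auto
    then show ?thesis by (simp add: double_compl Compl_eq_Diff_UNIV[symmetric])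
  qed (rule basic)
  then show ?thesis by blast
qed

lemma borel_prob_measures_\<Delta>_space: "borel_prob_measures \<Delta>_space = range measure_pmf"
proof
  show "range measure_pmf \<subseteq> borel_prob_measures \<Delta>_space"
    by (auto simp: borel_prob_measures_def sigma_sets_\<Delta>_space measure_pmf.prob_space_axioms)
  show "borel_prob_measures \<Delta>_space \<subseteq> range measure_pmf"
  proof
    fix M assume "M \<in> borel_prob_measures \<Delta>_space"
    then have M: "prob_space M" "sets M = UNIV"
      by (auto simp: borel_prob_measures_def sigma_sets_\<Delta>_space)
    interpret prob_space M by (rule M)
    have sp: "space M = UNIV" using sets_eq_imp_space_eq[of M "count_space UNIV"] M(2) by simp
    \<comment> \<open>Countability of the space enters here: the null points together form a null
      set, so the measure is discrete.\<close>
    have "(\<Union>x\<in>{x. measure M {x} = 0}. {x}) \<in> null_sets M"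
      by (rule null_sets_UN') (auto simp: null_sets_def M(2) emeasure_eq_measure)
    then have "AE x in M. measure M {x} \<noteq> 0"
      by (rule AE_I') (auto simp: sp)
    then show "M \<in> range measure_pmf"
      using M by (intro image_eqI[of _ _ "Abs_pmf M"]) (auto simp: Abs_pmf_inverse)
  qed
qed

text \<open>\<open>embed_spmf\<close> puts the missing mass at \<open>None\<close>, which here is
  the point at infinity.\<close>

lemma pmf_option_exists:
  fixes f :: "nat \<Rightarrow> real"
  assumes "\<And>j. 0 \<le> f j" "\<And>n. (\<Sum>j\<le>n. f j) \<le> 1"
  shows "\<exists>p. \<forall>j. pmf p (Some j) = f j"
proof -
  have sm: "summable f" using assms by (rule bounded_imp_summable)
  have "(\<integral>\<^sup>+ x. ennreal (f x) \<partial>count_space UNIV) = ennreal (suminf f)"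
    using suminf_ennreal_eq[OF assms(1) summable_sums[OF sm]] by (simp add: nn_integral_count_space_nat)
  also have "\<dots> \<le> 1"
  proof -
    have "suminf f \<le> 1"
    proof (rule suminf_le_const[OF sm])
      show "sum f {..<n} \<le> 1" for n
        by (rule order_trans[OF sum_mono2 assms(2)[of n]]) (auto simp: assms(1))
    qed
    then show ?thesis by simp
  qed
  finally have "\<forall>j. pmf (embed_spmf f) (Some j) = f j" using assms(1) by simp
  then show ?thesis ..
qed

section \<open>Integrals and convex combinations of discrete distributions\<close>

lemma integrable_measure_pmf_bounded:
  fixes f :: "'x \<Rightarrow> 'b::{banach,second_countable_topology}"
  assumes "\<And>i. norm (f i) \<le> B" shows "integrable (measure_pmf p) f"
  using assms by (intro measure_pmf.integrable_const_bound[where B = B]) auto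

lemma norm_integral_measure_pmf_le:
  fixes f :: "'x \<Rightarrow> 'b::{banach,second_countable_topology}"
  assumes "\<And>i. norm (f i) \<le> B" shows "norm (\<integral>i. f i \<partial>measure_pmf p) \<le> B"
proof -
  have "norm (\<integral>i. f i \<partial>measure_pmf p) \<le> (\<integral>i. norm (f i) \<partial>measure_pmf p)"
    by (rule integral_norm_bound)
  also have "\<dots> \<le> B"
    using assms by (intro measure_pmf.integral_le_const integrable_measure_pmf_bounded[where B = B]) auto
  finally show ?thesis .
qed

lemma measure_pmf_convex:
  assumes "\<And>i. pmf r i = (1 - t) * pmf p i + t * pmf q i"
  shows "measure (measure_pmf r) B = (1 - t) * measure (measure_pmf p) B + t * measure (measure_pmf q) B"
  unfolding measure_pmf_conv_infsetsum assms
  by (subst infsetsum_add) (auto simp: infsetsum_cmult_right pmf_abs_summable intro!: abs_summable_on_cmult_right)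

lemma pmf_convex_exists:
  assumes "t \<in> {0..1}" shows "\<exists>r. \<forall>i. pmf r i = (1 - t) * pmf p i + t * pmf q i"
proof
  show "\<forall>i. pmf (bind_pmf (bernoulli_pmf t) (\<lambda>b. if b then q else p)) i = (1 - t) * pmf p i + t * pmf q i"
    using assms by (simp add: pmf_bind)
qed

section \<open>The trace simplex\<close>

lemma tracial_states_convex:
  assumes \<sigma>: "\<sigma> \<in> tracial_states" and \<tau>: "\<tau> \<in> tracial_states" and t: "0 \<le> t" "t \<le> 1"
  shows "(1 - t) *\<^sub>R \<sigma> + t *\<^sub>R \<tau> \<in> tracial_states"
proof -
  define s where "s = 1 - t"
  have st: "s \<ge> 0" "complex_of_real s + complex_of_real t = 1" using t by (auto simp: s_def)
  define \<rho> where "\<rho> x = complex_of_real s * \<sigma> x + complex_of_real t * \<tau> x" for x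
  have eq: "(1 - t) *\<^sub>R \<sigma> + t *\<^sub>R \<tau> = \<rho>"
    by (simp add: fun_eq_iff scaleR_fun_def scaleR_conv_of_real \<rho>_def s_def)
  note * = \<sigma>[unfolded tracial_states_def is_state_def mem_Collect_eq]
    \<tau>[unfolded tracial_states_def is_state_def mem_Collect_eq]
  have "bounded_linear \<rho>"
    unfolding \<rho>_def[abs_def] using * by (intro bounded_linear_add bounded_linear_const_mult) auto
  moreover have "\<rho> (c *\<^sub>C x) = c * \<rho> x" for c x
    using * by (simp add: \<rho>_def algebra_simps)
  moreover have "\<rho> (adj x * x) \<in> \<real>\<^sub>\<ge>\<^sub>0" for x
  proof -
    have "\<sigma> (adj x * x) \<in> \<real>\<^sub>\<ge>\<^sub>0" "\<tau> (adj x * x) \<in> \<real>\<^sub>\<ge>\<^sub>0" using * by blast+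
    then show ?thesis
      unfolding \<rho>_def using st(1) t(1) by (intro nonneg_Reals_add_I nonneg_Reals_mult_I) auto
  qed
  moreover have "\<rho> 1 = 1" using * st by (simp add: \<rho>_def)
  moreover have "\<rho> (x * y) = \<rho> (y * x)" for x y
  proof -
    have "\<sigma> (x * y) = \<sigma> (y * x)" "\<tau> (x * y) = \<tau> (y * x)" using * by blast+
    then show ?thesis by (simp add: \<rho>_def)
  qed
  ultimately show ?thesis unfolding eq tracial_states_def is_state_def by blast
qed

context dyadic_limit
begin

section \<open>Candidate extreme traces, masses of a trace, and barycentres\<close>

definition T :: "nat option \<Rightarrow> 'a \<Rightarrow> complex" where
  "T i = (case i of Some j \<Rightarrow> \<tau>_tr \<Phi> j | None \<Rightarrow> \<tau>inf)"

lemma T_simps [simp]: "T (Some j) = \<tau>_tr \<Phi> j" "T None = \<tau>inf"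
  by (simp_all add: T_def)

lemma T_tracial: "tracial_state (T i)"
  by (cases i) (auto simp: \<tau>inf_tracial \<tau>_tr_tracial)

lemma T_norm: "cmod (T i x) \<le> norm x"
  using T_tracial[of i] by (intro state.cmod_le_norm tracial_state.axioms)

lemma range_T: "range T = range (\<tau>_tr \<Phi>) \<union> {\<tau>inf}"
  by (auto simp: UNIV_option_conv image_image)

text \<open>\<open>mass \<sigma> j\<close> is the coefficient of \<open>\<tau>\<^sub>j\<close> in \<open>\<sigma>\<close>; for a trace the limit exists because the
  sequence decreases from \<open>n = j\<close> on.\<close>

definition mass :: "('a \<Rightarrow> complex) \<Rightarrow> nat \<Rightarrow> real" where
  "mass \<sigma> j = lim (\<lambda>n. Re (\<sigma> (U n j 0 0)) * real (kdim j))"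

lemma trace_weights:
  assumes \<sigma>: "tracial_state \<sigma>"
  shows mass_tendsto: "(\<lambda>n. Re (\<sigma> (U n j 0 0)) * real (kdim j)) \<longlonglongrightarrow> mass \<sigma> j"
    and mass_nonneg: "0 \<le> mass \<sigma> j"
    and mass_sum_le: "(\<Sum>j\<le>n. mass \<sigma> j) \<le> 1"
    and weight_eq: "j \<le> n \<Longrightarrow> \<sigma> (U n j 0 0) =
      complex_of_real (mass \<sigma> j / real (kdim j) + (1 - (\<Sum>i\<le>n. mass \<sigma> i)) / 2 ^ n)"
proof -
  interpret tracial_state \<sigma> by (rule \<sigma>)
  note tf = trace_functional
  have real: "\<sigma> (U n j 0 0) = complex_of_real (Re (\<sigma> (U n j 0 0)))" "0 \<le> Re (\<sigma> (U n j 0 0))"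
    if "j \<le> n" for n j
    using pos_real[of "U n j 0 0"] pos_Re[of "U n j 0 0"] U_projection[OF that] by auto
  have step: "Re (\<sigma> (U (Suc n) j 0 0)) \<le> Re (\<sigma> (U n j 0 0))" if "j \<le> n" for n j
    using trace_weight_step[OF tf that] real(2)[of "Suc n" "Suc n"] by simp
  have "\<exists>L. (\<lambda>n. Re (\<sigma> (U n j 0 0))) \<longlonglongrightarrow> L \<and> 0 \<le> L \<and> (\<forall>n\<ge>j. L \<le> Re (\<sigma> (U n j 0 0)))" for j
  proof -
    have dec: "decseq (\<lambda>n. Re (\<sigma> (U (n + j) j 0 0)))" by (rule decseq_SucI) (simp add: step)
    have nn: "\<forall>n. 0 \<le> Re (\<sigma> (U (n + j) j 0 0))" by (simp add: real(2))
    obtain L where L: "(\<lambda>n. Re (\<sigma> (U (n + j) j 0 0))) \<longlonglongrightarrow> L" "\<forall>n. L \<le> Re (\<sigma> (U (n + j) j 0 0))"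
      using decseq_convergent[OF dec nn] by blast
    have "0 \<le> L" by (rule LIMSEQ_le_const[OF L(1)]) (auto simp: real(2))
    moreover have "L \<le> Re (\<sigma> (U n j 0 0))" if "n \<ge> j" for n
      using L(2)[rule_format, of "n - j"] that by simp
    ultimately show ?thesis using LIMSEQ_offset[OF L(1)] by blast
  qed
  then obtain w where w: "\<And>j. (\<lambda>n. Re (\<sigma> (U n j 0 0))) \<longlonglongrightarrow> w j" "\<And>j. 0 \<le> w j"
    "\<And>j n. n \<ge> j \<Longrightarrow> w j \<le> Re (\<sigma> (U n j 0 0))" by metis
  have lim: "(\<lambda>n. Re (\<sigma> (U n j 0 0)) * real (kdim j)) \<longlonglongrightarrow> w j * real (kdim j)" for j
    by (rule tendsto_mult_right[OF w(1)])
  have mw: "mass \<sigma> j = w j * real (kdim j)" for j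
    unfolding mass_def by (rule limI[OF lim])
  show "(\<lambda>n. Re (\<sigma> (U n j 0 0)) * real (kdim j)) \<longlonglongrightarrow> mass \<sigma> j" using lim by (simp add: mw)
  show "0 \<le> mass \<sigma> j" using w(2) by (simp add: mw)
  have cw: "(\<lambda>n. \<sigma> (U n j 0 0)) \<longlonglongrightarrow> complex_of_real (w j)" for j
  proof (rule Lim_transform_eventually[OF tendsto_of_real[OF w(1)]])
    show "\<forall>\<^sub>F n in sequentially. complex_of_real (Re (\<sigma> (U n j 0 0))) = \<sigma> (U n j 0 0)"
      by (rule eventually_sequentiallyI[of j]) (rule real(1)[symmetric])
  qed
  have eq: "\<sigma> (U n j 0 0) = complex_of_real (mass \<sigma> j / real (kdim j) + (1 - (\<Sum>i\<le>n. mass \<sigma> i)) / 2 ^ n)"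
    if "j \<le> n" for n j
    using weight_formula[OF tf cw that] by (simp add: mw less_imp_neq[symmetric])
  show "j \<le> n \<Longrightarrow> \<sigma> (U n j 0 0) =
      complex_of_real (mass \<sigma> j / real (kdim j) + (1 - (\<Sum>i\<le>n. mass \<sigma> i)) / 2 ^ n)" by (rule eq)
  \<comment> \<open>The weight at summand 0 is at least its limit, and by \<open>eq\<close> the
    excess is the missing mass divided by 2^n; so the missing mass is nonnegative.\<close>
  have "w 0 \<le> mass \<sigma> 0 / real (kdim 0) + (1 - (\<Sum>i\<le>n. mass \<sigma> i)) / 2 ^ n"
    using w(3)[of 0 n] eq[of 0 n] by (metis Re_complex_of_real le0)
  then have "0 \<le> (1 - (\<Sum>i\<le>n. mass \<sigma> i)) / 2 ^ n" by (simp add: mw)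
  from mult_nonneg_nonneg[OF this, of "2 ^ n"] show "(\<Sum>j\<le>n. mass \<sigma> j) \<le> 1" by simp
qed

text \<open>The excess in \<open>weight_eq\<close> is the missing mass over 2^n, and that mass lies
  between 0 and 1. The bound is uniform in \<open>\<sigma>\<close>, which is what makes the masses
  weak* continuous.\<close>

lemma mass_approx:
  assumes \<sigma>: "tracial_state \<sigma>" and j: "j \<le> n"
  shows "\<bar>Re (\<sigma> (U n j 0 0)) * real (kdim j) - mass \<sigma> j\<bar> \<le> real (kdim j) / 2 ^ n"
proof -
  let ?S = "\<Sum>i\<le>n. mass \<sigma> i"
  have S: "0 \<le> ?S" "?S \<le> 1" using mass_nonneg[OF \<sigma>] mass_sum_le[OF \<sigma>] by (auto intro: sum_nonneg)
  have "Re (\<sigma> (U n j 0 0)) * real (kdim j) - mass \<sigma> j = (1 - ?S) * (real (kdim j) / 2 ^ n)"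
    unfolding weight_eq[OF \<sigma> j] by (simp add: distrib_right less_imp_neq[symmetric])
  also have "\<bar>\<dots>\<bar> \<le> 1 * (real (kdim j) / 2 ^ n)"
    unfolding abs_mult using S by (intro mult_mono) auto
  finally show ?thesis by simp
qed

lemma mass_le_1: "tracial_state \<sigma> \<Longrightarrow> mass \<sigma> j \<le> 1"
  and mass_pair_le_1: "tracial_state \<sigma> \<Longrightarrow> i \<noteq> j \<Longrightarrow> mass \<sigma> i + mass \<sigma> j \<le> 1"
proof -
  assume \<sigma>: "tracial_state \<sigma>"
  have "(\<Sum>k\<in>S. mass \<sigma> k) \<le> 1" if "S \<subseteq> {..n}" for S n
    using sum_mono2[OF _ that, of "mass \<sigma>"] mass_nonneg[OF \<sigma>] mass_sum_le[OF \<sigma>, of n] by simp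
  from this[of "{j}" j] this[of "{i, j}" "max i j"]
  show "mass \<sigma> j \<le> 1" "i \<noteq> j \<Longrightarrow> mass \<sigma> i + mass \<sigma> j \<le> 1" by auto
qed

text \<open>The masses determine all weights by \<open>weight_eq\<close>, hence the values on the
  dense subalgebra; the part at infinity is the remainder of the total mass 1.\<close>

lemma tracial_state_eqI:
  assumes \<sigma>: "tracial_state \<sigma>" and \<rho>: "tracial_state \<rho>" and m: "\<And>j. mass \<sigma> j = mass \<rho> j"
  shows "\<sigma> = \<rho>"
proof
  fix x
  have "\<sigma> (\<Phi> n as) = 1 * \<rho> (\<Phi> n as)" if "as \<in> A_alg n" for n as
    by (rule trace_functional_eq_on[OF tracial_state.trace_functional[OF \<sigma>] tracial_state.trace_functional[OF \<rho>] _ that])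
       (simp add: weight_eq[OF \<sigma>] weight_eq[OF \<rho>] m)
  then have eq: "\<sigma> (\<Phi> n as) = \<rho> (\<Phi> n as)" if "as \<in> A_alg n" for n as using that by simp
  show "\<sigma> x = \<rho> x"
    by (rule dense_eq[where F = \<sigma> and G = \<rho> and N = 0])
       (rule continuous_trace_functional[OF state.bl[OF tracial_state.axioms(1)[OF \<sigma>]]]
          continuous_trace_functional[OF state.bl[OF tracial_state.axioms(1)[OF \<rho>]]] eq | assumption)+
qed

text \<open>The bound is uniform in i, so it survives integration over i and yields
  \<open>mass_mix\<close>.\<close>

lemma T_U_approx:
  assumes "j \<le> n"
  shows "\<bar>Re (T i (U n j 0 0)) * real (kdim j) - (if i = Some j then 1 else 0)\<bar> \<le> real (kdim j) / 2 ^ n"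
proof (cases i)
  case None
  have "Re (1 / 2 ^ n) = Re (complex_of_real (1 / 2 ^ n))" by simp
  then have "Re (1 / 2 ^ n) = 1 / 2 ^ n" by (simp only: Re_complex_of_real)
  then show ?thesis using \<tau>inf_U[OF assms] None by simp
next
  case (Some k)
  show ?thesis
  proof (cases "k \<le> n")
    case True
    then show ?thesis using \<tau>_tr_U[OF True, of j] Some by (auto simp: Re_divide_of_nat less_imp_neq[symmetric])
  next
    case False
    then show ?thesis using \<tau>_tr_U_less[of n k j] assms Some by auto
  qed
qed

text \<open>The barycentre of the traces \<open>T i\<close>; the map inverse to
  \<open>weights\<close>.\<close>

definition mix :: "nat option pmf \<Rightarrow> 'a \<Rightarrow> complex" where
  "mix p x = (\<integral>i. T i x \<partial>measure_pmf p)"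

lemma T_integrable: "integrable (measure_pmf p) (\<lambda>i. T i x)"
  by (rule integrable_measure_pmf_bounded[OF T_norm])

lemma mix_tracial: "tracial_state (mix p)"
proof -
  note st = tracial_state.axioms(1)[OF T_tracial]
  note lin = bounded_linear.linear[OF state.bl[OF st]]
  have "bounded_linear (mix p)"
  proof (rule bounded_linear_intro[where K = 1])
    show "mix p (x + y) = mix p x + mix p y" for x y
      by (simp add: mix_def linear_add[OF lin] T_integrable)
    show "mix p (r *\<^sub>R x) = r *\<^sub>R mix p x" for r x
      by (simp add: mix_def linear_cmul[OF lin])
    show "norm (mix p x) \<le> norm x * 1" for x
      unfolding mix_def by (simp add: norm_integral_measure_pmf_le[OF T_norm])
  qed
  moreover have "mix p (c *\<^sub>C x) = c * mix p x" for c x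
    by (simp add: mix_def state.scaleC[OF st])
  moreover have "mix p (adj x * x) \<in> \<real>\<^sub>\<ge>\<^sub>0" for x
  proof -
    have "mix p (adj x * x) = (\<integral>i. complex_of_real (Re (T i (adj x * x))) \<partial>measure_pmf p)"
      unfolding mix_def by (intro Bochner_Integration.integral_cong refl state.pos_real[OF st])
    also have "\<dots> = complex_of_real (\<integral>i. Re (T i (adj x * x)) \<partial>measure_pmf p)" by simp
    also have "\<dots> \<in> \<real>\<^sub>\<ge>\<^sub>0"
      unfolding nonneg_Reals_of_real_iff
      by (intro Bochner_Integration.integral_nonneg) (simp add: state.pos_Re[OF st])
    finally show ?thesis .
  qed
  moreover have "mix p 1 = 1"
    by (simp add: mix_def state.unit[OF st])
  moreover have "mix p (x * y) = mix p (y * x)" for x y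
    by (simp add: mix_def tracial_state.commute[OF T_tracial, of _ x y])
  ultimately show ?thesis unfolding tracial_state_iff tracial_states_def is_state_def by blast
qed

lemma approx_tendsto_unique:
  fixes a :: "nat \<Rightarrow> real"
  assumes "a \<longlonglongrightarrow> b" "\<And>n. j \<le> n \<Longrightarrow> \<bar>a n - c\<bar> \<le> K / 2 ^ n"
  shows "b = c"
proof (rule LIMSEQ_unique[OF assms(1)])
  have "(\<lambda>n. K * (1 / 2) ^ n) \<longlonglongrightarrow> K * 0" by (intro tendsto_intros LIMSEQ_power_zero) simp
  then have "(\<lambda>n. K / 2 ^ n) \<longlonglongrightarrow> 0" by (simp add: power_divide)
  moreover have "\<forall>\<^sub>F n in sequentially. norm (a n - c) \<le> K / 2 ^ n"
    using assms(2) by (intro eventually_sequentiallyI[of j]) simp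
  ultimately have "(\<lambda>n. a n - c) \<longlonglongrightarrow> 0" by (rule Lim_null_comparison[rotated])
  then show "a \<longlonglongrightarrow> c" by (rule LIM_zero_cancel)
qed

lemma mass_T: "mass (T i) j = (if i = Some j then 1 else 0)"
  using T_U_approx by (intro approx_tendsto_unique[OF mass_tendsto[OF T_tracial]])

lemma mass_mix: "mass (mix p) j = pmf p (Some j)"
proof (rule approx_tendsto_unique[OF mass_tendsto[OF mix_tracial]])
  fix n assume n: "j \<le> n"
  let ?f = "\<lambda>i. Re (T i (U n j 0 0)) * real (kdim j)"
  let ?g = "indicat_real {Some j}"
  have If: "integrable (measure_pmf p) ?f" using T_integrable by auto
  have Ig: "integrable (measure_pmf p) ?g"
    by (rule integrable_measure_pmf_bounded[where B = 1]) (auto simp: indicator_def)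
  have "Re (mix p (U n j 0 0)) * real (kdim j) - pmf p (Some j)
      = (\<integral>i. ?f i \<partial>measure_pmf p) - (\<integral>i. ?g i \<partial>measure_pmf p)"
    using T_integrable by (simp add: mix_def pmf.rep_eq)
  also have "\<dots> = (\<integral>i. ?f i - ?g i \<partial>measure_pmf p)"
    by (rule Bochner_Integration.integral_diff[OF If Ig, symmetric])
  also have "\<bar>\<dots>\<bar> \<le> real (kdim j) / 2 ^ n"
  proof -
    have "norm (?f i - ?g i) \<le> real (kdim j) / 2 ^ n" for i
      using T_U_approx[OF n, of i] by (auto simp: indicator_def split: if_splits)
    from norm_integral_measure_pmf_le[OF this] show ?thesis by (simp only: real_norm_def)
  qed
  finally show "\<bar>Re (mix p (U n j 0 0)) * real (kdim j) - pmf p (Some j)\<bar> \<le> real (kdim j) / 2 ^ n" .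
qed

text \<open>Prescribing the masses at all \<open>Some j\<close> fixes the distribution, since
  \<open>None\<close> receives the remainder; for a tracial state existence comes from
  \<open>pmf_option_exists\<close>.\<close>

definition weights :: "('a \<Rightarrow> complex) \<Rightarrow> nat option pmf" where
  "weights \<sigma> = (THE p. \<forall>j. pmf p (Some j) = mass \<sigma> j)"

lemma weights_eqI: "(\<And>j. pmf p (Some j) = mass \<sigma> j) \<Longrightarrow> weights \<sigma> = p"
  unfolding weights_def by (rule the_equality) (auto intro: spmf_eqI)

lemma pmf_weights:
  assumes "tracial_state \<sigma>" shows "pmf (weights \<sigma>) (Some j) = mass \<sigma> j"
proof -
  obtain p where p: "\<forall>j. pmf p (Some j) = mass \<sigma> j"
    using pmf_option_exists[of "mass \<sigma>"] mass_nonneg[OF assms] mass_sum_le[OF assms] by blast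
  then show ?thesis using weights_eqI[of p \<sigma>] by simp
qed

lemma weights_mix: "weights (mix p) = p"
  by (rule weights_eqI) (simp add: mass_mix)

lemma mix_weights: "tracial_state \<sigma> \<Longrightarrow> mix (weights \<sigma>) = \<sigma>"
  by (rule tracial_state_eqI[OF mix_tracial]) (auto simp: mass_mix pmf_weights)

lemma mass_convex:
  assumes \<sigma>: "tracial_state \<sigma>" and \<rho>: "tracial_state \<rho>"
  shows "mass ((1 - t) *\<^sub>R \<sigma> + t *\<^sub>R \<rho>) j = (1 - t) * mass \<sigma> j + t * mass \<rho> j"
proof -
  have "(\<lambda>n. (1 - t) * (Re (\<sigma> (U n j 0 0)) * real (kdim j)) + t * (Re (\<rho> (U n j 0 0)) * real (kdim j)))
      \<longlonglongrightarrow> (1 - t) * mass \<sigma> j + t * mass \<rho> j"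
    by (intro tendsto_intros mass_tendsto \<sigma> \<rho>)
  then show ?thesis
    unfolding mass_def[of "(1 - t) *\<^sub>R \<sigma> + t *\<^sub>R \<rho>"]
    by (intro limI) (simp add: scaleR_fun_def algebra_simps)
qed

lemma weights_affine: "affine_into_measures tracial_states (\<lambda>\<sigma>. measure_pmf (weights \<sigma>))"
  unfolding affine_into_measures_def
proof (intro ballI allI)
  fix \<sigma> \<rho> :: "'a \<Rightarrow> complex" and t :: real and B
  assume "\<sigma> \<in> tracial_states" "\<rho> \<in> tracial_states" and t: "t \<in> {0..1}"
  then have *: "tracial_state \<sigma>" "tracial_state \<rho>" by (auto simp: tracial_state_iff)
  obtain r where r: "\<And>i. pmf r i = (1 - t) * pmf (weights \<sigma>) i + t * pmf (weights \<rho>) i"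
    using pmf_convex_exists[OF t] by blast
  have "weights ((1 - t) *\<^sub>R \<sigma> + t *\<^sub>R \<rho>) = r"
    by (rule weights_eqI) (simp add: r mass_convex[OF *] pmf_weights *)
  then show "measure (measure_pmf (weights ((1 - t) *\<^sub>R \<sigma> + t *\<^sub>R \<rho>))) B
      = (1 - t) * measure (measure_pmf (weights \<sigma>)) B + t * measure (measure_pmf (weights \<rho>)) B"
    using measure_pmf_convex[OF r] by simp
qed

section \<open>Weak* continuity and the homeomorphism\<close>

lemma continuous_on_eval: "continuous_on S (\<lambda>\<sigma>. \<sigma> (x::'a) :: complex)"
  by (rule continuous_on_subset[OF continuous_on_product_coordinates]) simp

text \<open>Each approximant is evaluation at a fixed element and hence continuous;
  \<open>mass_approx\<close> makes the convergence uniform over all tracial states.\<close>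

lemma continuous_on_mass: "continuous_on tracial_states (\<lambda>\<sigma>. mass \<sigma> j)"
proof (rule uniform_limit_theorem)
  show "\<forall>\<^sub>F n in sequentially. continuous_on tracial_states (\<lambda>\<sigma>. Re (\<sigma> (U n j 0 0)) * real (kdim j))"
    by (intro always_eventually allI continuous_intros continuous_on_eval)
  show "uniform_limit tracial_states (\<lambda>n \<sigma>. Re (\<sigma> (U n j 0 0)) * real (kdim j)) (\<lambda>\<sigma>. mass \<sigma> j) sequentially"
  proof (rule uniform_limitI)
    fix e :: real assume e: "e > 0"
    have "(\<lambda>n. real (kdim j) * (1 / 2) ^ n) \<longlonglongrightarrow> real (kdim j) * 0"
      by (intro tendsto_intros LIMSEQ_power_zero) simp
    then have "(\<lambda>n. real (kdim j) * (1 / 2) ^ n) \<longlonglongrightarrow> 0" by (simp only: mult_zero_right)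
    then have "\<forall>\<^sub>F n in sequentially. real (kdim j) * (1 / 2) ^ n < e" using e by (rule order_tendstoD(2))
    moreover have "\<forall>\<^sub>F n in sequentially. j \<le> n" by (rule eventually_ge_at_top)
    ultimately show "\<forall>\<^sub>F n in sequentially. \<forall>\<sigma>\<in>tracial_states.
        dist (Re (\<sigma> (U n j 0 0)) * real (kdim j)) (mass \<sigma> j) < e"
    proof eventually_elim
      case (elim n)
      show ?case
      proof
        fix \<sigma> :: "'a \<Rightarrow> complex" assume "\<sigma> \<in> tracial_states"
        then have "\<bar>Re (\<sigma> (U n j 0 0)) * real (kdim j) - mass \<sigma> j\<bar> \<le> real (kdim j) / 2 ^ n"
          using elim by (intro mass_approx) (simp_all add: tracial_state_iff)
        then show "dist (Re (\<sigma> (U n j 0 0)) * real (kdim j)) (mass \<sigma> j) < e"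
          using elim by (simp add: dist_real_def power_divide)
      qed
    qed
  qed
qed simp

text \<open>A function continuous at infinity is a uniform limit of functions that are constant near
  infinity, whose integrals depend on finitely many masses.\<close>

lemma continuous_on_integral_weights:
  fixes h :: "nat option \<Rightarrow> real"
  assumes h: "(\<lambda>j. h (Some j)) \<longlonglongrightarrow> h None"
  shows "continuous_on tracial_states (\<lambda>\<sigma>. \<integral>i. h i \<partial>measure_pmf (weights \<sigma>))"
proof (rule uniform_limit_theorem)
  let ?F = "\<lambda>n \<sigma>. h None + (\<Sum>j<n. (h (Some j) - h None) * mass \<sigma> j)"
  show "\<forall>\<^sub>F n in sequentially. continuous_on tracial_states (?F n)"
    by (intro always_eventually allI continuous_intros continuous_on_mass)
  show "uniform_limit tracial_states ?F (\<lambda>\<sigma>. \<integral>i. h i \<partial>measure_pmf (weights \<sigma>)) sequentially"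
  proof (rule uniform_limitI)
    fix e :: real assume e: "e > 0"
    obtain N where N: "\<And>n. n \<ge> N \<Longrightarrow> \<bar>h (Some n) - h None\<bar> < e / 2"
      using LIMSEQ_D[OF h, of "e / 2"] e by auto
    have "dist (?F n \<sigma>) (\<integral>i. h i \<partial>measure_pmf (weights \<sigma>)) < e"
      if n: "n \<ge> N" and \<sigma>: "\<sigma> \<in> tracial_states" for n \<sigma>
    proof -
      let ?g = "\<lambda>i. h None + (\<Sum>j<n. (h (Some j) - h None) * indicat_real {Some j} i)"
      let ?p = "weights \<sigma>"
      have g: "?g (Some k) = (if k < n then h (Some k) else h None)" "?g None = h None" for k
      proof -
        have "(\<Sum>j<n. (h (Some j) - h None) * indicat_real {Some j} (Some k))
            = (\<Sum>j<n. if j = k then h (Some j) - h None else 0)"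
          by (intro sum.cong refl) (auto simp: indicator_def)
        then show "?g (Some k) = (if k < n then h (Some k) else h None)" by (simp add: sum.delta)
      qed (simp add: indicator_def)
      have close: "\<bar>?g i - h i\<bar> \<le> e / 2" for i
        using N n e less_imp_le[OF N] by (cases i) (auto simp only: g abs_minus_commute split: if_splits)
      have ind: "integrable (measure_pmf ?p) (indicat_real A)" for A
        by (rule integrable_measure_pmf_bounded[where B = 1]) (auto simp: indicator_def)
      have Ig: "integrable (measure_pmf ?p) ?g"
        by (intro Bochner_Integration.integrable_add Bochner_Integration.integrable_sum
            integrable_mult_right ind) simp
      have Id: "integrable (measure_pmf ?p) (\<lambda>i. ?g i - h i)"
        by (rule integrable_measure_pmf_bounded[where B = "e / 2"]) (use close in simp)
      have Ih: "integrable (measure_pmf ?p) h"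
        using Bochner_Integration.integrable_diff[OF Ig Id] by simp
      let ?c = "\<lambda>j. h (Some j) - h None"
      have Ic: "integrable (measure_pmf ?p) (\<lambda>i. ?c j * indicat_real {Some j} i)" for j
        by (intro integrable_mult_right ind)
      have "(\<integral>i. ?g i \<partial>measure_pmf ?p)
          = (\<integral>i. h None \<partial>measure_pmf ?p) + (\<integral>i. (\<Sum>j<n. ?c j * indicat_real {Some j} i) \<partial>measure_pmf ?p)"
        by (intro Bochner_Integration.integral_add Bochner_Integration.integrable_sum Ic) simp
      also have "(\<integral>i. (\<Sum>j<n. ?c j * indicat_real {Some j} i) \<partial>measure_pmf ?p)
          = (\<Sum>j<n. \<integral>i. ?c j * indicat_real {Some j} i \<partial>measure_pmf ?p)"
        by (intro Bochner_Integration.integral_sum Ic)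
      also have "\<dots> = (\<Sum>j<n. ?c j * mass \<sigma> j)"
      proof (intro sum.cong refl)
        fix j
        have "(\<integral>i. ?c j * indicat_real {Some j} i \<partial>measure_pmf ?p) = ?c j * (\<integral>i. indicat_real {Some j} i \<partial>measure_pmf ?p)"
          by (rule integral_mult_right_zero)
        also have "(\<integral>i. indicat_real {Some j} i \<partial>measure_pmf ?p) = mass \<sigma> j"
          using pmf_weights[of \<sigma> j] \<sigma> by (simp add: pmf.rep_eq tracial_state_iff)
        finally show "(\<integral>i. ?c j * indicat_real {Some j} i \<partial>measure_pmf ?p) = ?c j * mass \<sigma> j" .
      qed
      finally have "(\<integral>i. ?g i \<partial>measure_pmf ?p) = ?F n \<sigma>" by simp
      then have "?F n \<sigma> - (\<integral>i. h i \<partial>measure_pmf ?p) = (\<integral>i. ?g i - h i \<partial>measure_pmf ?p)"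
        by (simp only: Bochner_Integration.integral_diff[OF Ig Ih])
      also have "\<bar>\<dots>\<bar> \<le> e / 2"
        using norm_integral_measure_pmf_le[of "\<lambda>i. ?g i - h i" "e / 2" ?p] close by simp
      finally show ?thesis using e by (simp add: dist_real_def)
    qed
    then show "\<forall>\<^sub>F n in sequentially. \<forall>\<sigma>\<in>tracial_states.
        dist (?F n \<sigma>) (\<integral>i. h i \<partial>measure_pmf (weights \<sigma>)) < e"
      by (intro eventually_sequentiallyI[of N]) blast
  qed
qed simp

text \<open>The barycentre as a function of a measure, since the points of
  \<open>prob_simplex\<close> are measures; on the measures of discrete distributions it is
  \<open>mix\<close>.\<close>

definition integ :: "nat option measure \<Rightarrow> 'a \<Rightarrow> complex" where
  "integ M x = (\<integral>i. T i x \<partial>M)"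

lemma integ_measure_pmf: "integ (measure_pmf p) = mix p"
  by (simp add: integ_def mix_def fun_eq_iff)

lemma topspace_prob_simplex: "topspace (prob_simplex \<Delta>_space) = range measure_pmf"
  by (auto simp: prob_simplex_def Let_def topspace_pullback_topology borel_prob_measures_\<Delta>_space)

lemma continuous_map_prob_simplex_integral:
  assumes "continuous_map \<Delta>_space euclideanreal h"
  shows "continuous_map (prob_simplex \<Delta>_space) euclideanreal (\<lambda>M. \<integral>i. h i \<partial>M)"
proof -
  let ?C = "{f. continuous_map \<Delta>_space euclideanreal f}"
  have "continuous_map (prob_simplex \<Delta>_space) euclideanreal ((\<lambda>\<phi>. \<phi> h) \<circ> (\<lambda>M. \<lambda>f\<in>?C. integral\<^sup>L M f))"
    unfolding prob_simplex_def Let_def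
    by (intro continuous_map_pullback continuous_map_product_projection) (use assms in simp)
  then show ?thesis using assms by (simp add: o_def)
qed

lemma T_continuous: "(\<lambda>j. T (Some j) x) \<longlonglongrightarrow> T None x"
  by (simp add: \<tau>inf_lim)

text \<open>For fixed x the function sending i to \<open>T i x\<close> is continuous on the
  compactification, because the matrix traces converge to \<open>\<tau>inf\<close>. The topology of
  \<open>prob_simplex\<close> tests real functions, hence the split into real and imaginary
  parts.\<close>

lemma integ_continuous: "continuous_map (prob_simplex \<Delta>_space) (trace_space :: ('a \<Rightarrow> complex) topology) integ"
  unfolding trace_space_def
proof (rule continuous_map_into_subtopology)
  show "integ \<in> topspace (prob_simplex \<Delta>_space) \<rightarrow> tracial_states"
    using mix_tracial by (auto simp: topspace_prob_simplex integ_measure_pmf tracial_state_iff)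
  have "continuous_map (prob_simplex \<Delta>_space) euclidean (\<lambda>M. integ M x)" for x
  proof (rule continuous_map_eq)
    have c: "continuous_map \<Delta>_space euclideanreal (\<lambda>i. Re (T i x))" "continuous_map \<Delta>_space euclideanreal (\<lambda>i. Im (T i x))"
      by (simp_all only: continuous_map_\<Delta>_space_iff) (intro tendsto_Re tendsto_Im T_continuous)+
    have of: "continuous_map (prob_simplex \<Delta>_space) euclidean (\<lambda>M. complex_of_real (f M))"
      if "continuous_map (prob_simplex \<Delta>_space) euclideanreal f" for f
      using continuous_map_compose[OF that, of euclidean complex_of_real] by (simp add: o_def continuous_on_of_real_id)
    have ofi: "continuous_map (prob_simplex \<Delta>_space) euclidean (\<lambda>M. \<i> * complex_of_real (f M))"
      if "continuous_map (prob_simplex \<Delta>_space) euclideanreal f" for f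
      using continuous_map_compose[OF of[OF that], of euclidean "\<lambda>z. \<i> * z"]
      by (simp add: o_def continuous_on_mult_left)
    show "continuous_map (prob_simplex \<Delta>_space) euclidean
        (\<lambda>M. complex_of_real (\<integral>i. Re (T i x) \<partial>M) + \<i> * complex_of_real (\<integral>i. Im (T i x) \<partial>M))"
      by (intro continuous_map_add of ofi continuous_map_prob_simplex_integral c)
    fix M assume "M \<in> topspace (prob_simplex \<Delta>_space)"
    then obtain p where "M = measure_pmf p" by (auto simp: topspace_prob_simplex)
    then show "complex_of_real (\<integral>i. Re (T i x) \<partial>M) + \<i> * complex_of_real (\<integral>i. Im (T i x) \<partial>M) = integ M x"
      using T_integrable[of p x] by (simp add: integ_def complex_eq_iff)
  qed
  then have "continuous_map (prob_simplex \<Delta>_space) (product_topology (\<lambda>_. euclidean) UNIV) integ"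
    by (simp add: continuous_map_componentwise)
  then show "continuous_map (prob_simplex \<Delta>_space) euclidean integ"
    by (simp add: euclidean_product_topology)
qed

lemma weights_continuous:
  "continuous_map (trace_space :: ('a \<Rightarrow> complex) topology) (prob_simplex \<Delta>_space) (\<lambda>\<sigma>. measure_pmf (weights \<sigma>))"
  unfolding prob_simplex_def Let_def
proof (rule continuous_map_pullback')
  let ?C = "{f. continuous_map \<Delta>_space euclideanreal f}"
  show "continuous_map trace_space (product_topology (\<lambda>_. euclideanreal) ?C)
      ((\<lambda>M. \<lambda>f\<in>?C. integral\<^sup>L M f) \<circ> (\<lambda>\<sigma>::'a \<Rightarrow> complex. measure_pmf (weights \<sigma>)))"
    unfolding continuous_map_componentwise
  proof (intro conjI ballI)
    fix h assume h: "h \<in> ?C"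
    then have "(\<lambda>j. h (Some j)) \<longlonglongrightarrow> h None" by (simp add: continuous_map_\<Delta>_space_iff)
    from continuous_on_integral_weights[OF this] h
    show "continuous_map trace_space euclideanreal
        (\<lambda>x. ((\<lambda>M. \<lambda>f\<in>?C. integral\<^sup>L M f) \<circ> (\<lambda>\<sigma>::'a \<Rightarrow> complex. measure_pmf (weights \<sigma>))) x h)"
      by (simp add: trace_space_def)
  qed auto
  show "topspace trace_space \<subseteq> (\<lambda>\<sigma>::'a \<Rightarrow> complex. measure_pmf (weights \<sigma>)) -` borel_prob_measures \<Delta>_space"
    by (auto simp: borel_prob_measures_\<Delta>_space)
qed

lemma homeomorphic_weights:
  "homeomorphic_map (trace_space :: ('a \<Rightarrow> complex) topology) (prob_simplex \<Delta>_space) (\<lambda>\<sigma>. measure_pmf (weights \<sigma>))"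
  unfolding homeomorphic_map_maps homeomorphic_maps_def
proof (intro exI[of _ integ] conjI ballI weights_continuous integ_continuous)
  show "integ (measure_pmf (weights \<sigma>)) = \<sigma>" if "\<sigma> \<in> topspace trace_space" for \<sigma>
    using that by (simp add: integ_measure_pmf mix_weights trace_space_def tracial_state_iff)
  show "measure_pmf (weights (integ M)) = M" if "M \<in> topspace (prob_simplex \<Delta>_space)" for M
    using that by (auto simp: topspace_prob_simplex integ_measure_pmf weights_mix)
qed

section \<open>Extreme points\<close>

lemma T_extreme: "T i extreme_point_of tracial_states"
  unfolding extreme_point_of_def
proof (intro conjI ballI notI)
  show "T i \<in> tracial_states" using T_tracial by (simp add: tracial_state_iff)
  fix a b :: "'a \<Rightarrow> complex"
  assume "a \<in> tracial_states" "b \<in> tracial_states" and seg: "T i \<in> open_segment a b"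
  then have ab: "tracial_state a" "tracial_state b" by (auto simp: tracial_state_iff)
  obtain u where u: "0 < u" "u < 1" "T i = (1 - u) *\<^sub>R a + u *\<^sub>R b" and ne: "a \<noteq> b"
    using seg by (auto simp: in_segment)
  \<comment> \<open>Every mass of \<open>T i\<close> is 0 or 1, an end of the interval to which
    masses are confined, so a proper convex combination attains it only if both of its terms
    do.\<close>
  have "mass a j = mass b j" for j
  proof -
    have eq: "(1 - u) * mass a j + u * mass b j = (if i = Some j then 1 else 0)"
      using mass_convex[OF ab, of u j] u(3) mass_T[of i j] by simp
    have m: "0 \<le> mass a j" "0 \<le> mass b j" "mass a j \<le> 1" "mass b j \<le> 1"
      using ab mass_nonneg mass_le_1 by auto
    show ?thesis
    proof (cases "i = Some j")
      case True
      then have "(1 - u) * (1 - mass a j) + u * (1 - mass b j) = 0" using eq by (simp add: algebra_simps)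
      then have "(1 - u) * (1 - mass a j) = 0" "u * (1 - mass b j) = 0"
        using u m by (auto simp: add_nonneg_eq_0_iff)
      then show ?thesis using u by simp
    next
      case False
      then have "(1 - u) * mass a j = 0" "u * mass b j = 0"
        using eq u m by (auto simp: add_nonneg_eq_0_iff)
      then show ?thesis using u by simp
    qed
  qed
  then show False using tracial_state_eqI[OF ab] ne by blast
qed

text \<open>A mass strictly between 0 and 1 would split \<open>\<sigma>\<close> properly into
  \<open>T (Some j)\<close> and a renormalized remainder. So all masses are 0 or 1: one equal to 1
  excludes the others and gives a matrix trace, and if all vanish the trace is
  \<open>\<tau>inf\<close>.\<close>

lemma extreme_imp_T:
  assumes "\<sigma> extreme_point_of tracial_states" shows "\<sigma> \<in> range T"
proof -
  have \<sigma>: "tracial_state \<sigma>" using assms by (simp add: extreme_point_of_def tracial_state_iff)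
  have m01: "mass \<sigma> j = 0 \<or> mass \<sigma> j = 1" for j
  proof (rule ccontr)
    assume "\<not> ?thesis"
    then have m: "0 < mass \<sigma> j" "mass \<sigma> j < 1"
      using mass_nonneg[OF \<sigma>, of j] mass_le_1[OF \<sigma>, of j] by auto
    \<comment> \<open>The distribution of \<open>\<sigma>\<close> conditioned on the index being
      different from j.\<close>
    let ?f = "\<lambda>i. if i = j then 0 else mass \<sigma> i / (1 - mass \<sigma> j)"
    have f0: "0 \<le> ?f i" for i using m mass_nonneg[OF \<sigma>] by simp
    have f1: "(\<Sum>i\<le>n. ?f i) \<le> 1" for n
    proof -
      have "(\<Sum>i\<le>n. ?f i) \<le> (\<Sum>i\<le>max n j. ?f i)"
        using m mass_nonneg[OF \<sigma>] by (intro sum_mono2) auto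
      also have "\<dots> = (\<Sum>i\<in>{..max n j} - {j}. mass \<sigma> i / (1 - mass \<sigma> j))"
        by (intro sum.mono_neutral_cong_right) auto
      also have "\<dots> = ((\<Sum>i\<le>max n j. mass \<sigma> i) - mass \<sigma> j) / (1 - mass \<sigma> j)"
        by (simp add: sum_diff1 sum_divide_distrib[symmetric] diff_divide_distrib)
      also have "\<dots> \<le> 1" using mass_sum_le[OF \<sigma>, of "max n j"] m by simp
      finally show ?thesis .
    qed
    obtain p where p: "\<And>i. pmf p (Some i) = ?f i"
      using pmf_option_exists[of ?f, OF f0 f1] by blast
    define u where "u = 1 - mass \<sigma> j"
    have u: "0 < u" "u < 1" using m by (auto simp: u_def)
    have tj: "tracial_state (T (Some j))" by (rule T_tracial)
    have "\<sigma> = (1 - u) *\<^sub>R T (Some j) + u *\<^sub>R mix p"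
    proof (rule tracial_state_eqI[OF \<sigma>])
      show "tracial_state ((1 - u) *\<^sub>R T (Some j) + u *\<^sub>R mix p)"
        using tracial_states_convex[of "T (Some j)" "mix p" u] u tj mix_tracial by (simp add: tracial_state_iff)
      show "mass \<sigma> i = mass ((1 - u) *\<^sub>R T (Some j) + u *\<^sub>R mix p) i" for i
        unfolding mass_convex[OF tj mix_tracial] using m by (auto simp: mass_T mass_mix p u_def simp del: T_simps)
    qed
    \<comment> \<open>Their masses at j are 1 and 0.\<close>
    moreover have "T (Some j) \<noteq> mix p" using mass_T[of "Some j" j] mass_mix[of p j] p[of j] by auto
    ultimately have "\<sigma> \<in> open_segment (T (Some j)) (mix p)" using u by (auto simp: in_segment)
    then show False
      using assms tj mix_tracial by (auto simp: extreme_point_of_def tracial_state_iff)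
  qed
  show ?thesis
  proof (cases "\<exists>j. mass \<sigma> j = 1")
    case True
    then obtain j where j: "mass \<sigma> j = 1" by blast
    have "mass \<sigma> i = mass (T (Some j)) i" for i
      using mass_pair_le_1[OF \<sigma>, of i j] mass_nonneg[OF \<sigma>, of i] j by (auto simp: mass_T simp del: T_simps)
    then show ?thesis using tracial_state_eqI[OF \<sigma> T_tracial] by blast
  next
    case False
    then have "mass \<sigma> i = mass (T None) i" for i
      using m01[of i] by (auto simp: mass_T simp del: T_simps)
    then show ?thesis using tracial_state_eqI[OF \<sigma> T_tracial] by blast
  qed
qed

lemma extreme_points: "{\<sigma>. \<sigma> extreme_point_of tracial_states} = range (\<tau>_tr \<Phi>) \<union> {\<tau>inf}"
  unfolding range_T[symmetric] using extreme_imp_T T_extreme by blast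

section \<open>Convergence of the matrix traces and the formula for their limit\<close>

lemma \<tau>_tr_limitin: "limitin trace_space (\<tau>_tr \<Phi>) \<tau>inf sequentially"
proof -
  have "limitin (product_topology (\<lambda>_. euclidean) UNIV) (\<tau>_tr \<Phi>) \<tau>inf sequentially"
    by (simp add: limitin_componentwise \<tau>inf_lim)
  then have "limitin euclidean (\<tau>_tr \<Phi>) \<tau>inf sequentially"
    by (simp add: euclidean_product_topology)
  then show ?thesis
    using \<tau>inf_tracial \<tau>_tr_tracial by (simp add: trace_space_def limitin_subtopology tracial_state_iff)
qed

text \<open>By \<open>\<tau>inf_\<Phi>\<close> the limit trace is the sum of the matrix traces over
  2^n, and the matrix trace on summand j is k_j times the normalized one; the coefficients 1, 1, 2,
  4, ... are the k_j.\<close>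

lemma \<tau>inf_formula:
  assumes "as \<in> A_alg n"
  shows "\<tau>inf (\<Phi> n as) = (\<tau>_fin 0 as + (\<Sum>j=1..n. 2 ^ (j - 1) * \<tau>_fin j as)) / 2 ^ n"
proof -
  have t: "mat_trace (as ! j) = 2 ^ (j - 1) * \<tau>_fin j as" if "j \<in> {1..n}" for j
    using that by (cases j) (auto simp: \<tau>_fin_def)
  have "(\<Sum>j\<le>n. mat_trace (as ! j)) = mat_trace (as ! 0) + (\<Sum>j=1..n. mat_trace (as ! j))"
    by (simp add: atMost_atLeast0 sum.atLeast_Suc_atMost)
  also have "\<dots> = \<tau>_fin 0 as + (\<Sum>j=1..n. 2 ^ (j - 1) * \<tau>_fin j as)"
    using t by (simp add: \<tau>_fin_def)
  finally show ?thesis by (simp add: \<tau>inf_\<Phi>[OF assms])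
qed

lemma \<tau>inf_characterization:
  assumes "\<sigma> \<in> tracial_states"
  shows "\<sigma> = \<tau>inf \<longleftrightarrow> (\<forall>n\<ge>1. \<forall>a\<in>A_alg n.
     \<sigma> (\<Phi> n a) = (\<tau>_fin 0 a + (\<Sum>j=1..n. 2 ^ (j - 1) * \<tau>_fin j a)) / 2 ^ n)"
proof
  assume R: "\<forall>n\<ge>1. \<forall>a\<in>A_alg n.
     \<sigma> (\<Phi> n a) = (\<tau>_fin 0 a + (\<Sum>j=1..n. 2 ^ (j - 1) * \<tau>_fin j a)) / 2 ^ n"
  show "\<sigma> = \<tau>inf"
  proof
    \<comment> \<open>The formula is available from stage 1 on, hence \<open>N = 1\<close>; the
      image of stage 0 lies in that of stage 1.\<close>
    show "\<sigma> x = \<tau>inf x" for x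
    proof (rule dense_eq[where F = \<sigma> and G = \<tau>inf and N = 1])
      show "continuous_on UNIV \<sigma>" "continuous_on UNIV \<tau>inf"
        using assms \<tau>inf_tracial
        by (auto simp: tracial_state_iff tracial_states_def is_state_def intro: continuous_trace_functional)
    qed (use R \<tau>inf_formula in auto)
  qed
qed (simp add: \<tau>inf_formula)

end

theorem mainTheorem4:
  fixes \<Phi> :: "nat \<Rightarrow> complex mat list \<Rightarrow> 'a::unital_cstar_algebra"
  assumes "inductive_limit A_alg \<phi>_map \<Phi>"
  shows "(\<exists>\<Psi>. homeomorphic_map (trace_space :: ('a \<Rightarrow> complex) topology)
               (prob_simplex \<Delta>_space) \<Psi> \<and>
             affine_into_measures tracial_states \<Psi>) \<and>
    (\<exists>\<tau>inf \<in> tracial_states.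
       {\<tau> :: 'a \<Rightarrow> complex. \<tau> extreme_point_of tracial_states}
         = range (\<tau>_tr \<Phi>) \<union> {\<tau>inf} \<and>
       limitin trace_space (\<tau>_tr \<Phi>) \<tau>inf sequentially \<and>
       (\<forall>j. trace_type_I (\<tau>_tr \<Phi> j) (kdim j)) \<and>
       trace_type_II1 \<tau>inf \<and>
       (\<exists>!\<tau> :: 'a \<Rightarrow> complex. \<tau> extreme_point_of tracial_states \<and> trace_type_II1 \<tau>) \<and>
       (\<forall>\<sigma>\<in>tracial_states. \<sigma> = \<tau>inf \<longleftrightarrow>
          (\<forall>n\<ge>1. \<forall>a\<in>A_alg n.
             \<sigma> (\<Phi> n a) = (\<tau>_fin 0 a + (\<Sum>j=1..n. 2 ^ (j - 1) * \<tau>_fin j a)) / 2 ^ n)))"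
proof -
  interpret dyadic_limit \<Phi> by (rule dyadic_limit.intro[OF assms])
  show ?thesis
  proof (intro conjI bexI[of _ \<tau>inf])
    show "\<exists>\<Psi>. homeomorphic_map (trace_space :: ('a \<Rightarrow> complex) topology) (prob_simplex \<Delta>_space) \<Psi> \<and>
        affine_into_measures tracial_states \<Psi>"
      using homeomorphic_weights weights_affine by blast
    \<comment> \<open>The other extreme traces are of type I, which excludes type II_1.\<close>
    show "\<exists>!\<tau> :: 'a \<Rightarrow> complex. \<tau> extreme_point_of tracial_states \<and> trace_type_II1 \<tau>"
      using extreme_points \<tau>inf_type_II1 \<tau>_tr_not_II1 by (intro ex1I[of _ \<tau>inf]) auto
    show "\<tau>inf \<in> tracial_states" using \<tau>inf_tracial by (simp add: tracial_state_iff)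
  qed (use extreme_points \<tau>_tr_limitin \<tau>_tr_type_I \<tau>inf_type_II1 \<tau>inf_characterization in auto)
qed

end
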